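(* Assume Hypothesis A (see context) holds for $G,L_1,L_2,\dots$ and $C$, and let $A\in\mathfrak L(\mathfrak h)$. Then for every real $t\ge 0$ there exists a unique operator $\mathcal T_t(A)\in\mathfrak L(\mathfrak h)$ such that for all $x,y\in\mathcal D(C)$, $$\langle x,\mathcal T_t(A)y\rangle=\mathbb E\langle X_t(x),AX_t(y)\rangle .$$ Moreover, any $C$-solution $(\mathcal A_t)_{t\ge0}$ of the adjoint quantum master equation with initial datum $A$ satisfies $\mathcal A_t=\mathcal T_t(A)$ for all $t\ge0$, and $\|\mathcal T_t(A)\|_{\mathfrak L(\mathfrak h)}\le\|A\|_{\mathfrak L(\mathfrak h)}$ for all $t\ge 0$.
   Context: Let $(\mathfrak h,\langle\cdot,\cdot\rangle)$ be a separable complex Hilbert space, with inner product linear in the second variable; $\mathfrak L(\mathfrak h)$ denotes the bounded operators on $\mathfrak h$ and $\mathcal D(A)$ the domain of an operator $A$. Let $G,L_1,L_2,\dots$ be (possibly unbounded) linear operators in $\mathfrak h$, let $C$ be a self-adjoint positive (i.e. nonnegative) operator in $\mathfrak h$, and let $W^1,W^2,\dots$ be real valued independent Wiener processes on a filtered complete probability space $(\Omega,\mathfrak F,(\mathfrak F_t)_{t\ge0},\mathbb P)$. For $x\in\mathcal D(C)$ set $\|x\|_C^2=\|x\|^2+\|Cx\|^2$. Let $\pi_C:\mathfrak h\to\mathfrak h$ be $\pi_C(x)=x$ if $x\in\mathcal D(C)$ and $\pi_C(x)=0$ otherwise. $L^2_C(\mathbb P,\mathfrak h)$ is the set of square integrable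 $\mathfrak h$-valued random variables $\xi$ with $\xi\in\mathcal D(C)$ a.s. and $\mathbb E\|\xi\|_C^2<\infty$. Strong $C$-solution. Let $\mathbb I$ be $[0,\infty[$ or $[0,T]$. A strong $C$-solution on $\mathbb I$ with initial datum $\xi$ of the linear stochastic Schrödinger equation is an adapted $\mathfrak h$-valued process $(X_t(\xi))_{t\in\mathbb I}$ with continuous paths such that for all $t\in\mathbb I$: $\mathbb E\|X_t(\xi)\|^2\le\mathbb E\|\xi\|^2$, $X_t(\xi)\in\mathcal D(C)$ a.s., $\sup_{s\in[0,t]}\mathbb E\|CX_s(\xi)\|^2<\infty$, and a.s. $X_t(\xi)=\xi+\int_0^tG\pi_C(X_s(\xi))\,ds+\sum_{k=1}^\infty\int_0^tL_k\pi_C(X_s(\xi))\,dW^k_s$. Hypothesis A. $\mathcal D(C)$ is contained in the domains of $G,L_1,L_2,\dots$; the maps $G\circ\pi_C,L_1\circ\pi_C,L_2\circ\pi_C,\dots$ are Borel measurable; $G$ is bounded from $(\mathcal D(C),\|\cdot\|_C)$ to $\mathfrak h$; for all $x\in\mathcal D(C)$, $2\Re\langle x,Gx\rangle+\sum_{k=1}^\infty\|L_kx\|^2=0$; and for every $\mathfrak F_0$-measurable $\xi\in L^2_C(\mathbb P,\mathfrak h)$ and every $T>0$ there is a unique strong $C$-solution on $[0,T]$ with initial datum $\xi$. $X(\xi)$ denotes this solution. A $C$-solution of the adjoint quantum master equation with initial datum $A\in\mathfrak L(\mathfrak h)$ is a family $(\mathcal A_t)_{t\ge0}$ in $\mathfrak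 L(\mathfrak h)$ with $\mathcal A_0=A$ such that for all $t\ge0$: (a) $\frac{d}{dt}\langle x,\mathcal A_ty\rangle=\langle x,\mathcal A_tGy\rangle+\langle Gx,\mathcal A_ty\rangle+\sum_{k=1}^\infty\langle L_kx,\mathcal A_tL_ky\rangle$ for all $x,y\in\mathcal D(C)$; (b) $\sup_{s\in[0,t]}\|\mathcal A_s\|_{\mathfrak L(\mathfrak h)}<\infty$. *)

theory Defs
  imports "HOL-Probability.Probability"
begin

section \<open>Complex Hilbert spaces\<close>

text \<open>The norm, the topology and completeness are inherited from the real Banach space; the last
  axiom ties the norm to the inner product and yields positive definiteness. Separability is
  expressed by the additional sort \<open>second_countable_topology\<close>.\<close>

class complex_hilbert_space = banach +
  fixes scaleC :: "complex \<Rightarrow> 'a \<Rightarrow> 'a" (infixr "*\<^sub>C" 75)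
    and cinner :: "'a \<Rightarrow> 'a \<Rightarrow> complex"
  assumes scaleC_add_right: "a *\<^sub>C (x + y) = a *\<^sub>C x + a *\<^sub>C y"
    and scaleC_add_left: "(a + b) *\<^sub>C x = a *\<^sub>C x + b *\<^sub>C x"
    and scaleC_scaleC: "a *\<^sub>C (b *\<^sub>C x) = (a * b) *\<^sub>C x"
    and scaleC_of_real: "complex_of_real r *\<^sub>C x = r *\<^sub>R x"
    and cinner_commute: "cinner x y = cnj (cinner y x)"
    and cinner_add_right: "cinner x (y + z) = cinner x y + cinner x z"
    and cinner_scaleC_right: "cinner x (a *\<^sub>C y) = a * cinner x y"
    and cinner_self: "cinner x x = complex_of_real ((norm x)\<^sup>2)"

instantiation complex :: complex_hilbert_space
begin

definition scaleC_complex_def: "(a::complex) *\<^sub>C z = a * z"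

definition cinner_complex_def: "cinner (z::complex) w = cnj z * w"

instance
proof
  fix a b x y z :: complex and r :: real
  show "a *\<^sub>C (x + y) = a *\<^sub>C x + a *\<^sub>C y"
    by (simp add: scaleC_complex_def distrib_left)
  show "(a + b) *\<^sub>C x = a *\<^sub>C x + b *\<^sub>C x"
    by (simp add: scaleC_complex_def distrib_right)
  show "a *\<^sub>C (b *\<^sub>C x) = (a * b) *\<^sub>C x"
    by (simp add: scaleC_complex_def mult.assoc)
  show "complex_of_real r *\<^sub>C x = r *\<^sub>R x"
    by (simp add: scaleC_complex_def scaleR_conv_of_real)
  show "cinner x y = cnj (cinner y x)"
    by (simp add: cinner_complex_def mult.commute)
  show "cinner x (y + z) = cinner x y + cinner x z"
    by (simp add: cinner_complex_def distrib_left)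
  show "cinner x (a *\<^sub>C y) = a * cinner x y"
    by (simp add: cinner_complex_def scaleC_complex_def)
  show "cinner x x = complex_of_real ((norm x)\<^sup>2)"
    by (simp only: cinner_complex_def complex_norm_square mult.commute)
qed

end

text \<open>The bounded operators on the whole space; their norm is \<^const>\<open>onorm\<close>.\<close>

definition bounded_clinear :: "('h::complex_hilbert_space \<Rightarrow> 'h) \<Rightarrow> bool" where
  "bounded_clinear B \<longleftrightarrow> bounded_linear B \<and> (\<forall>a x. B (a *\<^sub>C x) = a *\<^sub>C B x)"


section \<open>Possibly unbounded operators\<close>

text \<open>An operator in \<open>\<hh>\<close> is a partial function with domain \<^term>\<open>dom T\<close>. Application
  \<open>T \<odot> x\<close> is only meaningful for \<open>x \<in> dom T\<close>.\<close>

abbreviation op_app :: "('h \<rightharpoonup> 'h) \<Rightarrow> 'h \<Rightarrow> 'h" (infixr "\<odot>" 80) where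
  "T \<odot> x \<equiv> the (T x)"

definition linear_operator :: "('h::complex_hilbert_space \<rightharpoonup> 'h) \<Rightarrow> bool" where
  "linear_operator T \<longleftrightarrow>
     0 \<in> dom T \<and>
     (\<forall>x\<in>dom T. \<forall>y\<in>dom T. x + y \<in> dom T \<and> T \<odot> (x + y) = T \<odot> x + T \<odot> y) \<and>
     (\<forall>x\<in>dom T. \<forall>a. a *\<^sub>C x \<in> dom T \<and> T \<odot> (a *\<^sub>C x) = a *\<^sub>C (T \<odot> x))"

text \<open>For densely defined \<open>T\<close> the vector \<open>z\<close> below is unique.\<close>

definition adjoint_operator :: "('h::complex_hilbert_space \<rightharpoonup> 'h) \<Rightarrow> ('h \<rightharpoonup> 'h)" where
  "adjoint_operator T = (\<lambda>y.
     if \<exists>z. \<forall>x\<in>dom T. cinner (T \<odot> x) y = cinner x z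
     then Some (THE z. \<forall>x\<in>dom T. cinner (T \<odot> x) y = cinner x z)
     else None)"

definition self_adjoint :: "('h::complex_hilbert_space \<rightharpoonup> 'h) \<Rightarrow> bool" where
  "self_adjoint T \<longleftrightarrow>
     linear_operator T \<and> closure (dom T) = UNIV \<and> adjoint_operator T = T"

text \<open>For a self-adjoint operator \<open>\<langle>x, Tx\<rangle>\<close> is automatically real.\<close>

definition positive_operator :: "('h::complex_hilbert_space \<rightharpoonup> 'h) \<Rightarrow> bool" where
  "positive_operator T \<longleftrightarrow> (\<forall>x\<in>dom T. 0 \<le> Re (cinner x (T \<odot> x)))"

definition graph_norm :: "('h::complex_hilbert_space \<rightharpoonup> 'h) \<Rightarrow> 'h \<Rightarrow> real" where
  "graph_norm C x = sqrt ((norm x)\<^sup>2 + (norm (C \<odot> x))\<^sup>2)"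

definition domain_proj :: "('h::complex_hilbert_space \<rightharpoonup> 'h) \<Rightarrow> 'h \<Rightarrow> 'h" (\<open>\<pi>\<close>) where
  "\<pi> C x = (if x \<in> dom C then x else 0)"


section \<open>Filtered probability spaces and Wiener processes\<close>

text \<open>Only the \<sigma>-algebras \<open>F t\<close> with \<open>t \<ge> 0\<close> are used. No further conditions (such as
  right-continuity) are imposed on the filtration.\<close>

definition filtered_complete_prob_space :: "'w measure \<Rightarrow> (real \<Rightarrow> 'w measure) \<Rightarrow> bool" where
  "filtered_complete_prob_space M F \<longleftrightarrow>
     prob_space M \<and> complete_measure M \<and>
     (\<forall>t\<ge>0. subalgebra M (F t)) \<and> (\<forall>s\<ge>0. \<forall>t\<ge>s. subalgebra (F t) (F s))"

definition wiener_process ::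
  "'w measure \<Rightarrow> (real \<Rightarrow> 'w measure) \<Rightarrow> (real \<Rightarrow> 'w \<Rightarrow> real) \<Rightarrow> bool" where
  "wiener_process M F B \<longleftrightarrow>
     (\<forall>t\<ge>0. B t \<in> borel_measurable (F t)) \<and>
     (\<forall>\<omega>\<in>space M. continuous_on {0..} (\<lambda>t. B t \<omega>)) \<and>
     (AE \<omega> in M. B 0 \<omega> = 0) \<and>
     (\<forall>s\<ge>0. \<forall>t>s.
        distributed M lborel (\<lambda>\<omega>. B t \<omega> - B s \<omega>) (normal_density 0 (sqrt (t - s))) \<and>
        prob_space.indep_set M (sets (F s))
          (sets (vimage_algebra (space M) (\<lambda>\<omega>. B t \<omega> - B s \<omega>) borel)))"

text \<open>Independence is independence of the whole processes, viewed as random elements of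
  \<open>\<real>\<close> to the power \<open>[0,\<infinity>[\<close>. The index \<open>k = 1, 2, \<dots>\<close> is shifted to \<open>0, 1, \<dots>\<close>.\<close>

definition independent_wiener_processes ::
  "'w measure \<Rightarrow> (real \<Rightarrow> 'w measure) \<Rightarrow> (nat \<Rightarrow> real \<Rightarrow> 'w \<Rightarrow> real) \<Rightarrow> bool" where
  "independent_wiener_processes M F W \<longleftrightarrow>
     (\<forall>k. wiener_process M F (W k)) \<and>
     prob_space.indep_vars M (\<lambda>_. PiM {0..} (\<lambda>_. borel)) (\<lambda>k \<omega>. \<lambda>t\<in>{0..}. W k t \<omega>) UNIV"


section \<open>The Ito integral of square integrable integrands\<close>

text \<open>A list of triples \<open>(s, u, \<eta>)\<close> stands for the elementary process
  \<open>\<Sum> 1\<^bsub>]s,u]\<^esub> \<eta>\<close>; the intervals are allowed to overlap.\<close>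

type_synonym ('w, 'h) elementary = "(real \<times> real \<times> ('w \<Rightarrow> 'h)) list"

definition elementary_process ::
  "(real \<Rightarrow> 'w measure) \<Rightarrow> ('w, 'h::real_normed_vector) elementary \<Rightarrow> bool" where
  "elementary_process F H \<longleftrightarrow>
     (\<forall>(s, u, \<eta>)\<in>set H. 0 \<le> s \<and> s \<le> u \<and>
        \<eta> \<in> borel_measurable (F s) \<and> bounded (\<eta> ` space (F s)))"

definition elementary_value :: "('w, 'h::real_normed_vector) elementary \<Rightarrow> real \<Rightarrow> 'w \<Rightarrow> 'h" where
  "elementary_value H r \<omega> = (\<Sum>(s, u, \<eta>)\<leftarrow>H. indicat_real {s<..u} r *\<^sub>R \<eta> \<omega>)"

definition elementary_integral ::
  "(real \<Rightarrow> 'w \<Rightarrow> real) \<Rightarrow> real \<Rightarrow> ('w, 'h::real_normed_vector) elementary \<Rightarrow> 'w \<Rightarrow> 'h" where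
  "elementary_integral B t H \<omega> = (\<Sum>(s, u, \<eta>)\<leftarrow>H. (B (min u t) \<omega> - B (min s t) \<omega>) *\<^sub>R \<eta> \<omega>)"

definition progressively_measurable ::
  "(real \<Rightarrow> 'w measure) \<Rightarrow> real \<Rightarrow> (real \<Rightarrow> 'w \<Rightarrow> 'h::real_normed_vector) \<Rightarrow> bool" where
  "progressively_measurable F t \<phi> \<longleftrightarrow>
     (\<forall>s\<in>{0..t}. (\<lambda>(r, \<omega>). \<phi> r \<omega>) \<in> borel_measurable (restrict_space borel {0..s} \<Otimes>\<^sub>M F s))"

text \<open>\<open>J\<close> is (a version of) \<open>\<integral>\<^sub>0\<^sup>t \<phi>\<^sub>r dB\<^sub>r\<close>: it is the limit in \<open>L\<^sup>2(P)\<close> of integrals of elementary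
  processes that approximate \<open>\<phi>\<close> in \<open>L\<^sup>2(P \<otimes> dr)\<close>. Such approximations exist exactly for
  progressively measurable \<open>\<phi>\<close> with \<open>E \<integral>\<^sub>0\<^sup>t \<parallel>\<phi>\<^sub>r\<parallel>\<^sup>2 dr < \<infinity>\<close>.\<close>

definition has_ito_integral ::
  "'w measure \<Rightarrow> (real \<Rightarrow> 'w measure) \<Rightarrow> (real \<Rightarrow> 'w \<Rightarrow> real) \<Rightarrow> real \<Rightarrow>
   (real \<Rightarrow> 'w \<Rightarrow> 'h::{real_normed_vector, second_countable_topology}) \<Rightarrow> ('w \<Rightarrow> 'h) \<Rightarrow> bool" where
  "has_ito_integral M F B t \<phi> J \<longleftrightarrow>
     progressively_measurable F t \<phi> \<and> J \<in> borel_measurable M \<and>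
     (\<exists>H. (\<forall>n. elementary_process F (H n)) \<and>
        (\<lambda>n. \<integral>\<^sup>+\<omega>. (\<integral>\<^sup>+r\<in>{0..t}. ennreal ((norm (\<phi> r \<omega> - elementary_value (H n) r \<omega>))\<^sup>2) \<partial>lborel) \<partial>M)
          \<longlonglongrightarrow> 0 \<and>
        (\<lambda>n. \<integral>\<^sup>+\<omega>. ennreal ((norm (J \<omega> - elementary_integral B t (H n) \<omega>))\<^sup>2) \<partial>M) \<longlonglongrightarrow> 0)"


section \<open>The linear stochastic Schroedinger equation\<close>

definition L2_C ::
  "'w measure \<Rightarrow> ('h::{complex_hilbert_space, second_countable_topology} \<rightharpoonup> 'h) \<Rightarrow> ('w \<Rightarrow> 'h) set" where
  "L2_C M C = {\<xi> \<in> borel_measurable M.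
     (\<integral>\<^sup>+\<omega>. ennreal ((norm (\<xi> \<omega>))\<^sup>2) \<partial>M) < \<infinity> \<and>
     (AE \<omega> in M. \<xi> \<omega> \<in> dom C) \<and>
     (\<integral>\<^sup>+\<omega>. ennreal ((graph_norm C (\<pi> C (\<xi> \<omega>)))\<^sup>2) \<partial>M) < \<infinity>}"

text \<open>\<open>I\<close> is \<open>[0,\<infinity>[\<close> or \<open>[0,T]\<close>. In the equation, \<open>J k\<close> is the \<open>k\<close>-th stochastic integral and \<open>S\<close> is
  the sum, in \<open>L\<^sup>2(P)\<close>, of the series of stochastic integrals. If \<open>G\<close> is relatively bounded with
  respect to \<open>C\<close> and \<open>2 Re \<langle>x, Gx\<rangle> + \<Sum>\<^sub>k \<parallel>L\<^sub>k x\<parallel>\<^sup>2 = 0\<close>, then the bounds on \<open>X\<close> and \<open>CX\<close> give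
  \<open>\<Sum>\<^sub>k E \<integral>\<^sub>0\<^sup>t \<parallel>L\<^sub>k \<pi>\<^sub>C(X\<^sub>r)\<parallel>\<^sup>2 dr < \<infinity>\<close>, so the \<open>L\<^sup>2\<close> theory covers all the integrals that occur.\<close>

definition strong_C_solution ::
  "'w measure \<Rightarrow> (real \<Rightarrow> 'w measure) \<Rightarrow> (nat \<Rightarrow> real \<Rightarrow> 'w \<Rightarrow> real) \<Rightarrow>
   ('h::{complex_hilbert_space, second_countable_topology} \<rightharpoonup> 'h) \<Rightarrow> (nat \<Rightarrow> 'h \<rightharpoonup> 'h) \<Rightarrow> ('h \<rightharpoonup> 'h) \<Rightarrow>
   real set \<Rightarrow> ('w \<Rightarrow> 'h) \<Rightarrow> (real \<Rightarrow> 'w \<Rightarrow> 'h) \<Rightarrow> bool" where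
  "strong_C_solution M F W G L C I \<xi> X \<longleftrightarrow>
     (\<forall>t\<in>I. X t \<in> borel_measurable (F t)) \<and>
     (\<forall>\<omega>\<in>space M. continuous_on I (\<lambda>t. X t \<omega>)) \<and>
     (\<forall>t\<in>I.
        (\<integral>\<^sup>+\<omega>. ennreal ((norm (X t \<omega>))\<^sup>2) \<partial>M) \<le> (\<integral>\<^sup>+\<omega>. ennreal ((norm (\<xi> \<omega>))\<^sup>2) \<partial>M) \<and>
        (AE \<omega> in M. X t \<omega> \<in> dom C) \<and>
        (SUP s\<in>{0..t}. \<integral>\<^sup>+\<omega>. ennreal ((norm (C \<odot> \<pi> C (X s \<omega>)))\<^sup>2) \<partial>M) < \<infinity> \<and>
        (\<exists>J S.
           (\<forall>k. has_ito_integral M F (W k) t (\<lambda>s \<omega>. L k \<odot> \<pi> C (X s \<omega>)) (J k)) \<and>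
           S \<in> borel_measurable M \<and>
           (\<lambda>n. \<integral>\<^sup>+\<omega>. ennreal ((norm ((\<Sum>k<n. J k \<omega>) - S \<omega>))\<^sup>2) \<partial>M) \<longlonglongrightarrow> 0 \<and>
           (AE \<omega> in M.
              set_integrable lborel {0..t} (\<lambda>s. G \<odot> \<pi> C (X s \<omega>)) \<and>
              X t \<omega> = \<xi> \<omega> + (LINT s:{0..t}|lborel. G \<odot> \<pi> C (X s \<omega>)) + S \<omega>)))"

text \<open>Uniqueness of strong solutions is meant up to indistinguishability.\<close>

definition hypothesis_A ::
  "'w measure \<Rightarrow> (real \<Rightarrow> 'w measure) \<Rightarrow> (nat \<Rightarrow> real \<Rightarrow> 'w \<Rightarrow> real) \<Rightarrow>
   ('h::{complex_hilbert_space, second_countable_topology} \<rightharpoonup> 'h) \<Rightarrow> (nat \<Rightarrow> 'h \<rightharpoonup> 'h) \<Rightarrow> ('h \<rightharpoonup> 'h) \<Rightarrow>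
   bool" where
  "hypothesis_A M F W G L C \<longleftrightarrow>
     dom C \<subseteq> dom G \<and> (\<forall>k. dom C \<subseteq> dom (L k)) \<and>
     (\<lambda>x. G \<odot> \<pi> C x) \<in> borel_measurable borel \<and>
     (\<forall>k. (\<lambda>x. L k \<odot> \<pi> C x) \<in> borel_measurable borel) \<and>
     (\<exists>K. \<forall>x\<in>dom C. norm (G \<odot> x) \<le> K * graph_norm C x) \<and>
     (\<forall>x\<in>dom C. summable (\<lambda>k. (norm (L k \<odot> x))\<^sup>2) \<and>
        2 * Re (cinner x (G \<odot> x)) + (\<Sum>k. (norm (L k \<odot> x))\<^sup>2) = 0) \<and>
     (\<forall>\<xi>\<in>L2_C M C. \<forall>T>0. \<xi> \<in> borel_measurable (F 0) \<longrightarrow>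
        (\<exists>X. strong_C_solution M F W G L C {0..T} \<xi> X \<and>
           (\<forall>Y. strong_C_solution M F W G L C {0..T} \<xi> Y \<longrightarrow>
              (AE \<omega> in M. \<forall>t\<in>{0..T}. Y t \<omega> = X t \<omega>))))"


section \<open>The adjoint quantum master equation\<close>

text \<open>At \<open>t = 0\<close> the derivative is the right derivative.\<close>

definition adjoint_QME_C_solution ::
  "('h::complex_hilbert_space \<rightharpoonup> 'h) \<Rightarrow> (nat \<Rightarrow> 'h \<rightharpoonup> 'h) \<Rightarrow> ('h \<rightharpoonup> 'h) \<Rightarrow>
   ('h \<Rightarrow> 'h) \<Rightarrow> (real \<Rightarrow> 'h \<Rightarrow> 'h) \<Rightarrow> bool" where
  "adjoint_QME_C_solution G L C A \<A> \<longleftrightarrow>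
     (\<forall>t\<ge>0. bounded_clinear (\<A> t)) \<and> \<A> 0 = A \<and>
     (\<forall>t\<ge>0.
        (\<forall>x\<in>dom C. \<forall>y\<in>dom C.
           summable (\<lambda>k. cinner (L k \<odot> x) (\<A> t (L k \<odot> y))) \<and>
           ((\<lambda>s. cinner x (\<A> s y)) has_vector_derivative
              cinner x (\<A> t (G \<odot> y)) + cinner (G \<odot> x) (\<A> t y)
                + (\<Sum>k. cinner (L k \<odot> x) (\<A> t (L k \<odot> y)))) (at t within {0..})) \<and>
        bdd_above ((\<lambda>s. onorm (\<A> s)) ` {0..t}))"

text \<open>\<open>B\<close> is \<open>\<T>\<^sub>t(A)\<close>. Strong \<open>C\<close>-solutions are given on bounded intervals: \<open>X T x\<close> is a version of the
  solution on \<open>[0,T]\<close> with (deterministic) initial datum \<open>x\<close>, so every horizon \<open>T \<ge> t\<close> gives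
  access to \<open>X\<^sub>t(x)\<close>.\<close>

definition heisenberg_evolution ::
  "'w measure \<Rightarrow> ('h::{complex_hilbert_space, second_countable_topology} \<rightharpoonup> 'h) \<Rightarrow>
   (real \<Rightarrow> 'h \<Rightarrow> real \<Rightarrow> 'w \<Rightarrow> 'h) \<Rightarrow> ('h \<Rightarrow> 'h) \<Rightarrow> real \<Rightarrow> ('h \<Rightarrow> 'h) \<Rightarrow> bool" where
  "heisenberg_evolution M C X A t B \<longleftrightarrow>
     bounded_clinear B \<and>
     (\<forall>x\<in>dom C. \<forall>y\<in>dom C. \<forall>T>0. t \<le> T \<longrightarrow>
        cinner x (B y) = (LINT \<omega>|M. cinner (X T x t \<omega>) (A (X T y t \<omega>))))"

end

theory Submission
  imports Defs
begin

text \<open>Everything rests on an Ito formula that is only claimed in expectation. If \<open>X\<close>, \<open>Y\<close> are strong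
  solutions and \<open>b\<close> is a bounded bilinear form, then
  \<open>E b(X\<^sub>t, Y\<^sub>t) = b(x, y) + \<integral>\<^sub>0\<^sup>t E \<Phi>\<^sub>b(X\<^sub>r, Y\<^sub>r) dr\<close> with
  \<open>\<Phi>\<^sub>b(x, y) = b(Gx, y) + b(x, Gy) + \<Sum>\<^sub>k b(L\<^sub>k x, L\<^sub>k y)\<close>. It follows from the polarised Ito isometry, the
  martingale property and Fubini's theorem. For the inner product, \<open>\<Phi>\<close> vanishes by polarisation of
  the conservativity condition, so \<open>E \<langle>X\<^sub>t(x), X\<^sub>t(y)\<rangle> = \<langle>x, y\<rangle>\<close>; hence \<open>X\<^sub>t(x)\<close> is linear in \<open>x\<close> almost surely,
  \<open>E \<langle>X\<^sub>t(x), A X\<^sub>t(y)\<rangle>\<close> is a bounded sesquilinear form on the dense domain of \<open>C\<close>, and it is represented by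
  an operator of norm at most \<open>\<parallel>A\<parallel>\<close>. For a \<open>C\<close>-solution \<open>\<A>\<close> of the adjoint equation put
  \<open>g(u, s) = E \<langle>X\<^sub>s, \<A>\<^sub>u Y\<^sub>s\<rangle>\<close>. The Ito formula in \<open>s\<close> and the adjoint equation in \<open>u\<close> express the increments
  of \<open>g\<close> in both variables as integrals of the same function, so that \<open>g(t, 0) = g(0, t)\<close>.\<close>

section \<open>Square integrable functions\<close>

text \<open>The direct route to uniqueness would differentiate
  \<open>s -> E cinner (X s) (\<A> (t - s) (Y s))\<close> by a product rule. But the adjoint
  equation is given weakly, for vectors in \<open>dom C\<close>, the solution lies in
  \<open>dom C\<close> only almost surely at each fixed time, and \<open>E (Phi (X s) (Y s))\<close>
  is handled only as a bounded measurable function of \<open>s\<close>. So the two evolutions keep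
  separate times, are used in integrated form and are compared on a triangle; a derivative is taken
  only along its edges. The Ito formula is wanted for the inner product and for all the forms
  \<open>cinner x (\<A> u y)\<close> at once, which is why the tools are stated for arbitrary
  complex valued forms that are bounded and bilinear over the reals. A second obstacle is
  measurability: it is assumed for \<open>G\<close> and \<open>L k\<close> composed with the
  projection to \<open>dom C\<close>, not for \<open>C\<close>. Moments are therefore controlled by
  \<open>energy\<close>, which is built from \<open>G\<close>. Linearity of \<open>x -> X t\<close>
  is read off from conserved inner products; this avoids checking that linear combinations of strong
  solutions are strong solutions.\<close>

definition sq_integrable :: "'a measure \<Rightarrow> ('a \<Rightarrow> 'b::real_normed_vector) \<Rightarrow> bool" where
  "sq_integrable N f \<longleftrightarrow> f \<in> borel_measurable N \<and> integrable N (\<lambda>x. (norm (f x))\<^sup>2)"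

lemma sq_integrable_measurable [dest]: "sq_integrable N f \<Longrightarrow> f \<in> borel_measurable N"
  by (simp add: sq_integrable_def)

lemma sq_integrable_iff_nn:
  "sq_integrable N f \<longleftrightarrow>
     f \<in> borel_measurable N \<and> (\<integral>\<^sup>+x. ennreal ((norm (f x))\<^sup>2) \<partial>N) < \<infinity>"
  by (auto simp: sq_integrable_def integrable_iff_bounded)

lemma norm_add_sq_le: "(norm (x + y))\<^sup>2 \<le> 2 * (norm x)\<^sup>2 + 2 * (norm y)\<^sup>2"
  for x y :: "'a::real_normed_vector"
proof -
  have "(norm (x + y))\<^sup>2 \<le> (norm x + norm y)\<^sup>2"
    by (intro power_mono norm_triangle_ineq) simp
  also have "\<dots> \<le> 2 * (norm x)\<^sup>2 + 2 * (norm y)\<^sup>2"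
    using sum_squares_bound[of "norm x" "norm y"] by (simp add: power2_sum)
  finally show ?thesis .
qed

lemma sq_integrable_bound:
  assumes "f \<in> borel_measurable N" "integrable N g" "\<And>x. x \<in> space N \<Longrightarrow> (norm (f x))\<^sup>2 \<le> g x"
  shows "sq_integrable N f"
  unfolding sq_integrable_def
proof
  show "integrable N (\<lambda>x. (norm (f x))\<^sup>2)"
    using assms(1,3) by (intro Bochner_Integration.integrable_bound[OF assms(2)])
      (auto intro!: AE_I2 order_trans[OF _ abs_ge_self])
qed fact

lemma sq_integrable_add:
  fixes f g :: "'a \<Rightarrow> 'b::{real_normed_vector, second_countable_topology}"
  assumes "sq_integrable N f" "sq_integrable N g"
  shows "sq_integrable N (\<lambda>x. f x + g x)"
  by (rule sq_integrable_bound[where g = "\<lambda>x. 2 * (norm (f x))\<^sup>2 + 2 * (norm (g x))\<^sup>2"])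
    (use assms in \<open>auto simp: sq_integrable_def norm_add_sq_le\<close>)

lemma sq_integrable_scaleR:
  fixes f :: "'a \<Rightarrow> 'b::{real_normed_vector, second_countable_topology}"
  assumes "sq_integrable N f"
  shows "sq_integrable N (\<lambda>x. c *\<^sub>R f x)"
  using assms by (auto simp: sq_integrable_def power_mult_distrib)

lemma sq_integrable_diff:
  fixes f g :: "'a \<Rightarrow> 'b::{real_normed_vector, second_countable_topology}"
  assumes "sq_integrable N f" "sq_integrable N g"
  shows "sq_integrable N (\<lambda>x. f x - g x)"
  using sq_integrable_add[OF assms(1) sq_integrable_scaleR[OF assms(2), of "-1"]] by simp

lemma sq_integrable_zero: "sq_integrable N (\<lambda>_. 0)"
  by (simp add: sq_integrable_def)

lemma sq_integrable_sum:
  fixes f :: "'i \<Rightarrow> 'a \<Rightarrow> 'b::{real_normed_vector, second_countable_topology}"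
  assumes "\<And>i. i \<in> I \<Longrightarrow> sq_integrable N (f i)"
  shows "sq_integrable N (\<lambda>x. \<Sum>i\<in>I. f i x)"
  using assms
  by (induction I rule: infinite_finite_induct) (auto intro: sq_integrable_add sq_integrable_zero)

lemma (in finite_measure) sq_integrable_bounded:
  assumes "f \<in> borel_measurable M" "\<And>x. x \<in> space M \<Longrightarrow> norm (f x) \<le> c"
  shows "sq_integrable M f"
  by (rule sq_integrable_bound[where g = "\<lambda>_. c\<^sup>2"]) (use assms in \<open>auto intro!: power_mono\<close>)

lemma sq_integrable_cong_AE:
  fixes f g :: "'a \<Rightarrow> 'b::real_normed_vector"
  assumes "sq_integrable N f" "g \<in> borel_measurable N" "AE x in N. f x = g x"
  shows "sq_integrable N g"
proof -
  have [measurable]: "f \<in> borel_measurable N" "g \<in> borel_measurable N"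
    using assms by (auto simp: sq_integrable_def)
  have "integrable N (\<lambda>x. (norm (f x))\<^sup>2) \<longleftrightarrow> integrable N (\<lambda>x. (norm (g x))\<^sup>2)"
    using assms(3) by (intro integrable_cong_AE) auto
  then show ?thesis
    using assms by (simp add: sq_integrable_def)
qed

lemma sq_integrable_norm_mult:
  fixes f :: "'a \<Rightarrow> 'b::{real_normed_vector, second_countable_topology}"
    and g :: "'a \<Rightarrow> 'c::{real_normed_vector, second_countable_topology}"
  assumes "sq_integrable N f" "sq_integrable N g"
  shows "integrable N (\<lambda>x. norm (f x) * norm (g x))"
proof (rule Bochner_Integration.integrable_bound)
  show "integrable N (\<lambda>x. (norm (f x))\<^sup>2 + (norm (g x))\<^sup>2)"
    using assms by (auto simp: sq_integrable_def)
  show "(\<lambda>x. norm (f x) * norm (g x)) \<in> borel_measurable N"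
    using assms by (auto simp: sq_integrable_def)
  have "norm (f x) * norm (g x) \<le> (norm (f x))\<^sup>2 + (norm (g x))\<^sup>2" for x
  proof -
    have "2 * norm (f x) * norm (g x) \<le> (norm (f x))\<^sup>2 + (norm (g x))\<^sup>2"
      by (rule sum_squares_bound)
    moreover have "0 \<le> norm (f x) * norm (g x)" by simp
    ultimately show ?thesis by linarith
  qed
  then show "AE x in N. norm (norm (f x) * norm (g x)) \<le> norm ((norm (f x))\<^sup>2 + (norm (g x))\<^sup>2)"
    by (auto simp: abs_mult)
qed

lemma integral_norm_mult_le:
  fixes f :: "'a \<Rightarrow> 'b::{real_normed_vector, second_countable_topology}"
    and g :: "'a \<Rightarrow> 'c::{real_normed_vector, second_countable_topology}"
  assumes "sq_integrable N f" "sq_integrable N g"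
  shows "(\<integral>x. norm (f x) * norm (g x) \<partial>N)
    \<le> sqrt (\<integral>x. (norm (f x))\<^sup>2 \<partial>N) * sqrt (\<integral>x. (norm (g x))\<^sup>2 \<partial>N)"
proof -
  have [measurable]: "f \<in> borel_measurable N" "g \<in> borel_measurable N"
    using assms by auto
  have nn: "(\<integral>\<^sup>+x. (ennreal (norm (f x)))\<^sup>2 \<partial>N) = ennreal (\<integral>x. (norm (f x))\<^sup>2 \<partial>N)"
    if "sq_integrable N f" for f :: "'a \<Rightarrow> 'd::real_normed_vector"
    using that by (subst nn_integral_eq_integral[symmetric])
      (auto simp: sq_integrable_def ennreal_power)
  have "(\<integral>\<^sup>+x. ennreal (norm (f x)) * ennreal (norm (g x)) \<partial>N)
      = ennreal (\<integral>x. norm (f x) * norm (g x) \<partial>N)"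
    using sq_integrable_norm_mult[OF assms]
    by (subst nn_integral_eq_integral[symmetric]) (auto simp: ennreal_mult)
  with Cauchy_Schwarz_nn_integral[of "\<lambda>x. ennreal (norm (f x))" N "\<lambda>x. ennreal (norm (g x))"]
  have "(ennreal (\<integral>x. norm (f x) * norm (g x) \<partial>N))\<^sup>2
      \<le> ennreal (\<integral>x. (norm (f x))\<^sup>2 \<partial>N) * ennreal (\<integral>x. (norm (g x))\<^sup>2 \<partial>N)"
    by (simp add: nn assms)
  then have "(\<integral>x. norm (f x) * norm (g x) \<partial>N)\<^sup>2
      \<le> (\<integral>x. (norm (f x))\<^sup>2 \<partial>N) * (\<integral>x. (norm (g x))\<^sup>2 \<partial>N)"
    by (simp add: ennreal_power ennreal_mult[symmetric])
  then show ?thesis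
    by (metis real_le_rsqrt real_sqrt_mult)
qed

lemma borel_measurable_bilinear:
  fixes b :: "'a::{real_normed_vector, second_countable_topology}
      \<Rightarrow> 'b::{real_normed_vector, second_countable_topology} \<Rightarrow> 'c::real_normed_vector"
  assumes "bounded_bilinear b" "f \<in> borel_measurable N" "g \<in> borel_measurable N"
  shows "(\<lambda>x. b (f x) (g x)) \<in> borel_measurable N"
proof -
  have "continuous_on UNIV (\<lambda>p. b (fst p) (snd p))"
    by (intro bounded_bilinear.continuous_on[OF assms(1)] continuous_intros)
  from borel_measurable_continuous_Pair[OF assms(2,3) this] show ?thesis
    by simp
qed

lemma sq_integrable_bilinear:
  fixes b :: "'a::{real_normed_vector, second_countable_topology}
      \<Rightarrow> 'b::{real_normed_vector, second_countable_topology}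
      \<Rightarrow> 'c::{banach, second_countable_topology}"
  assumes b: "bounded_bilinear b" and fg: "sq_integrable N f" "sq_integrable N g"
  shows "integrable N (\<lambda>x. b (f x) (g x))"
proof -
  obtain K where K: "\<And>x y. norm (b x y) \<le> norm x * norm y * K"
    using bounded_bilinear.bounded[OF b] by blast
  have "integrable N (\<lambda>x. norm (f x) * norm (g x) * K)"
    using sq_integrable_norm_mult[OF fg] by simp
  then show ?thesis
    by (rule Bochner_Integration.integrable_bound)
      (use fg K in \<open>auto intro!: borel_measurable_bilinear[OF b] AE_I2 order_trans[OF _ abs_ge_self]\<close>)
qed

text \<open>The constant \<open>K\<close> is kept explicit: with \<open>K = onorm A\<close> this
  Cauchy-Schwarz estimate becomes the contraction bound for \<T>.\<close>

lemma norm_integral_bilinear_le: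
  fixes b :: "'a::{real_normed_vector, second_countable_topology}
      \<Rightarrow> 'b::{real_normed_vector, second_countable_topology}
      \<Rightarrow> 'c::{banach, second_countable_topology}"
  assumes b: "bounded_bilinear b" and K: "\<And>x y. norm (b x y) \<le> norm x * norm y * K" "K \<ge> 0"
    and fg: "sq_integrable N f" "sq_integrable N g"
  shows "norm (\<integral>x. b (f x) (g x) \<partial>N)
    \<le> sqrt (\<integral>x. (norm (f x))\<^sup>2 \<partial>N) * sqrt (\<integral>x. (norm (g x))\<^sup>2 \<partial>N) * K"
proof -
  have "norm (\<integral>x. b (f x) (g x) \<partial>N) \<le> (\<integral>x. norm (b (f x) (g x)) \<partial>N)"
    by (rule integral_norm_bound)
  also have "\<dots> \<le> (\<integral>x. norm (f x) * norm (g x) * K \<partial>N)"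
    by (intro integral_mono integrable_norm sq_integrable_bilinear[OF b fg] K(1)
        integrable_mult_left sq_integrable_norm_mult[OF fg])
  also have "\<dots> = (\<integral>x. norm (f x) * norm (g x) \<partial>N) * K"
    by simp
  also have "\<dots> \<le> (sqrt (\<integral>x. (norm (f x))\<^sup>2 \<partial>N) * sqrt (\<integral>x. (norm (g x))\<^sup>2 \<partial>N)) * K"
    by (intro mult_right_mono integral_norm_mult_le fg K)
  finally show ?thesis .
qed

section \<open>Convergence in mean square\<close>

definition L2_tendsto ::
  "'a measure \<Rightarrow> (nat \<Rightarrow> 'a \<Rightarrow> 'b::real_normed_vector) \<Rightarrow> ('a \<Rightarrow> 'b) \<Rightarrow> bool" where
  "L2_tendsto N f g \<longleftrightarrow>
     (\<forall>n. sq_integrable N (f n)) \<and> sq_integrable N g \<and>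
     (\<lambda>n. \<integral>x. (norm (f n x - g x))\<^sup>2 \<partial>N) \<longlonglongrightarrow> 0"

lemma L2_tendstoD:
  assumes "L2_tendsto N f g"
  shows "sq_integrable N (f n)" "sq_integrable N g"
    "(\<lambda>n. \<integral>x. (norm (f n x - g x))\<^sup>2 \<partial>N) \<longlonglongrightarrow> 0"
  using assms by (auto simp: L2_tendsto_def)

text \<open>The Ito integral is defined through extended nonnegative integrals and a limit that is
  merely measurable. A single \<open>n\<close> at squared distance below 1 makes
  \<open>g - f n\<close>, hence \<open>g\<close>, square integrable; then all these integrals are
  finite and equal Bochner integrals.\<close>

lemma L2_tendstoI_nn:
  fixes f :: "nat \<Rightarrow> 'a \<Rightarrow> 'b::{real_normed_vector, second_countable_topology}"
  assumes f: "\<And>n. sq_integrable N (f n)" and g [measurable]: "g \<in> borel_measurable N"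
    and lim: "(\<lambda>n. \<integral>\<^sup>+x. ennreal ((norm (g x - f n x))\<^sup>2) \<partial>N) \<longlonglongrightarrow> 0"
  shows "L2_tendsto N f g"
proof -
  have [measurable]: "\<And>n. f n \<in> borel_measurable N" using f by auto
  have "eventually (\<lambda>n. (\<integral>\<^sup>+x. ennreal ((norm (g x - f n x))\<^sup>2) \<partial>N) < 1) sequentially"
    using order_tendstoD(2)[OF lim, of 1] by simp
  then obtain n where n: "(\<integral>\<^sup>+x. ennreal ((norm (g x - f n x))\<^sup>2) \<partial>N) < 1"
    by (auto simp: eventually_sequentially)
  have "sq_integrable N (\<lambda>x. g x - f n x)"
    unfolding sq_integrable_iff_nn
  proof
    show "(\<lambda>x. g x - f n x) \<in> borel_measurable N" by measurable
    show "(\<integral>\<^sup>+x. ennreal ((norm (g x - f n x))\<^sup>2) \<partial>N) < \<infinity>"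
      using n by (rule less_trans) simp
  qed
  from sq_integrable_add[OF this f[of n]] have g2: "sq_integrable N g" by simp
  have "(\<lambda>n. ennreal (\<integral>x. (norm (f n x - g x))\<^sup>2 \<partial>N)) \<longlonglongrightarrow> ennreal 0"
  proof -
    have "ennreal (\<integral>x. (norm (f n x - g x))\<^sup>2 \<partial>N) = (\<integral>\<^sup>+x. ennreal ((norm (g x - f n x))\<^sup>2) \<partial>N)" for n
      using sq_integrable_diff[OF f[of n] g2]
      by (subst nn_integral_eq_integral[symmetric])
        (auto simp: sq_integrable_def norm_minus_commute intro!: nn_integral_cong)
    then show ?thesis using lim by simp
  qed
  then have "(\<lambda>n. \<integral>x. (norm (f n x - g x))\<^sup>2 \<partial>N) \<longlonglongrightarrow> 0"
    by (subst (asm) tendsto_ennreal_iff) auto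
  with f g2 show ?thesis
    by (simp add: L2_tendsto_def)
qed

lemma L2_tendsto_const: "sq_integrable N f \<Longrightarrow> L2_tendsto N (\<lambda>_. f) f"
  by (simp add: L2_tendsto_def)

lemma L2_tendsto_add:
  fixes f :: "nat \<Rightarrow> 'a \<Rightarrow> 'b::{real_normed_vector, second_countable_topology}"
  assumes "L2_tendsto N f f'" "L2_tendsto N g g'"
  shows "L2_tendsto N (\<lambda>n x. f n x + g n x) (\<lambda>x. f' x + g' x)"
proof -
  note D = L2_tendstoD[OF assms(1)] L2_tendstoD[OF assms(2)]
  have "(\<lambda>n. 2 * (\<integral>x. (norm (f n x - f' x))\<^sup>2 \<partial>N) + 2 * (\<integral>x. (norm (g n x - g' x))\<^sup>2 \<partial>N)) \<longlonglongrightarrow> 0"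
    using tendsto_add[OF tendsto_mult_right_zero[OF D(3)] tendsto_mult_right_zero[OF D(6)]] by simp
  then have "(\<lambda>n. \<integral>x. (norm (f n x + g n x - (f' x + g' x)))\<^sup>2 \<partial>N) \<longlonglongrightarrow> 0"
  proof (rule tendsto_sandwich[OF _ _ tendsto_const, rotated 2], goal_cases)
    case 2
    have i: "integrable N (\<lambda>x. (norm (f n x - f' x))\<^sup>2)" "integrable N (\<lambda>x. (norm (g n x - g' x))\<^sup>2)"
      "integrable N (\<lambda>x. (norm (f n x + g n x - (f' x + g' x)))\<^sup>2)" for n
      using sq_integrable_diff[OF D(1)[of n] D(2)] sq_integrable_diff[OF D(4)[of n] D(5)]
        sq_integrable_diff[OF sq_integrable_add[OF D(1)[of n] D(4)[of n]]
          sq_integrable_add[OF D(2) D(5)]]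
      by (simp_all add: sq_integrable_def)
    have "(\<integral>x. (norm (f n x + g n x - (f' x + g' x)))\<^sup>2 \<partial>N)
      \<le> (\<integral>x. 2 * (norm (f n x - f' x))\<^sup>2 + 2 * (norm (g n x - g' x))\<^sup>2 \<partial>N)" for n
    proof (intro integral_mono Bochner_Integration.integrable_add integrable_mult_right i)
      fix x
      show "(norm (f n x + g n x - (f' x + g' x)))\<^sup>2
        \<le> 2 * (norm (f n x - f' x))\<^sup>2 + 2 * (norm (g n x - g' x))\<^sup>2"
        using norm_add_sq_le[of "f n x - f' x" "g n x - g' x"] by (simp add: algebra_simps)
    qed
    then show ?case
      using i by (intro always_eventually allI) simp
  qed auto
  with D show ?thesis
    by (auto simp: L2_tendsto_def intro!: sq_integrable_add)
qed

text \<open>Identities between expectations pass from elementary processes to Ito integrals through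
  this lemma. With \<open>df = f n - f'\<close> and \<open>dg = g n - g'\<close> the error is
  \<open>b df dg + b df g' + b f' dg\<close>, and Cauchy-Schwarz bounds each term by a product with
  a vanishing factor.\<close>

lemma tendsto_integral_bilinear:
  fixes b :: "'a::{real_normed_vector, second_countable_topology}
      \<Rightarrow> 'b::{real_normed_vector, second_countable_topology}
      \<Rightarrow> 'c::{banach, second_countable_topology}"
  assumes b: "bounded_bilinear b" and "L2_tendsto N f f'" "L2_tendsto N g g'"
  shows "(\<lambda>n. \<integral>x. b (f n x) (g n x) \<partial>N) \<longlonglongrightarrow> (\<integral>x. b (f' x) (g' x) \<partial>N)"
proof -
  interpret bounded_bilinear b by (rule b)
  obtain K where K: "\<And>x y. norm (b x y) \<le> norm x * norm y * K" "K \<ge> 0"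
    using nonneg_bounded by blast
  note D = L2_tendstoD[OF assms(2)] L2_tendstoD[OF assms(3)]
  let ?F = "\<lambda>n. sqrt (\<integral>x. (norm (f n x - f' x))\<^sup>2 \<partial>N)"
  let ?G = "\<lambda>n. sqrt (\<integral>x. (norm (g n x - g' x))\<^sup>2 \<partial>N)"
  let ?F' = "sqrt (\<integral>x. (norm (f' x))\<^sup>2 \<partial>N)" and ?G' = "sqrt (\<integral>x. (norm (g' x))\<^sup>2 \<partial>N)"
  have F: "?F \<longlonglongrightarrow> 0" and G: "?G \<longlonglongrightarrow> 0"
    using tendsto_real_sqrt[OF D(3)] tendsto_real_sqrt[OF D(6)] by simp_all
  have "(\<lambda>n. ?F n * ?G n * K + ?F n * ?G' * K + ?F' * ?G n * K) \<longlonglongrightarrow> 0 * 0 * K + 0 * ?G' * K + ?F' * 0 * K"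
    by (intro tendsto_intros F G)
  then have lim: "(\<lambda>n. ?F n * ?G n * K + ?F n * ?G' * K + ?F' * ?G n * K) \<longlonglongrightarrow> 0"
    by simp
  have "norm ((\<integral>x. b (f n x) (g n x) \<partial>N) - (\<integral>x. b (f' x) (g' x) \<partial>N))
      \<le> ?F n * ?G n * K + ?F n * ?G' * K + ?F' * ?G n * K" for n
  proof -
    note df = sq_integrable_diff[OF D(1)[of n] D(2)] and dg = sq_integrable_diff[OF D(4)[of n] D(5)]
    have "(\<integral>x. b (f n x) (g n x) \<partial>N) - (\<integral>x. b (f' x) (g' x) \<partial>N)
      = (\<integral>x. b (f n x) (g n x) - b (f' x) (g' x) \<partial>N)"
      by (intro Bochner_Integration.integral_diff[symmetric] sq_integrable_bilinear[OF b] D)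
    also have "\<dots> = (\<integral>x. b (f n x - f' x) (g n x - g' x) + b (f n x - f' x) (g' x)
        + b (f' x) (g n x - g' x) \<partial>N)"
      by (intro Bochner_Integration.integral_cong) (auto simp: diff_left diff_right)
    also have "\<dots> = (\<integral>x. b (f n x - f' x) (g n x - g' x) \<partial>N) + (\<integral>x. b (f n x - f' x) (g' x) \<partial>N)
        + (\<integral>x. b (f' x) (g n x - g' x) \<partial>N)"
      using sq_integrable_bilinear[OF b df dg] sq_integrable_bilinear[OF b df D(5)]
        sq_integrable_bilinear[OF b D(2) dg]
      by simp
    finally have eq: "(\<integral>x. b (f n x) (g n x) \<partial>N) - (\<integral>x. b (f' x) (g' x) \<partial>N) = \<dots>" .
    show ?thesis
      unfolding eq by (intro norm_triangle_mono norm_integral_bilinear_le[OF b K] df dg D)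
  qed
  then have "(\<lambda>n. (\<integral>x. b (f n x) (g n x) \<partial>N) - (\<integral>x. b (f' x) (g' x) \<partial>N)) \<longlonglongrightarrow> 0"
    by (intro Lim_null_comparison[OF _ lim] always_eventually allI)
  then show ?thesis
    by (rule LIM_zero_cancel)
qed

section \<open>Increments of independent Wiener processes\<close>

locale wiener_setting =
  fixes M :: "'w measure" and F :: "real \<Rightarrow> 'w measure" and W :: "nat \<Rightarrow> real \<Rightarrow> 'w \<Rightarrow> real"
  assumes filtered: "filtered_complete_prob_space M F"
    and wiener: "independent_wiener_processes M F W"
begin

sublocale prob_space M
  using filtered by (simp add: filtered_complete_prob_space_def)

lemma subalgebra_F: "0 \<le> t \<Longrightarrow> subalgebra M (F t)"
  and subalgebra_F_mono: "0 \<le> s \<Longrightarrow> s \<le> t \<Longrightarrow> subalgebra (F t) (F s)"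
  using filtered by (auto simp: filtered_complete_prob_space_def)

lemma space_F: "0 \<le> t \<Longrightarrow> space (F t) = space M"
  using subalgebra_F by (auto simp: subalgebra_def)

lemma F_measurable_M: "f \<in> measurable (F t) N \<Longrightarrow> 0 \<le> t \<Longrightarrow> f \<in> measurable M N"
  by (rule measurable_from_subalg[OF subalgebra_F])

lemma F_measurable_mono: "f \<in> measurable (F s) N \<Longrightarrow> 0 \<le> s \<Longrightarrow> s \<le> t \<Longrightarrow> f \<in> measurable (F t) N"
  by (rule measurable_from_subalg[OF subalgebra_F_mono])

lemma wiener_W: "wiener_process M F (W k)"
  using wiener by (simp add: independent_wiener_processes_def)

lemma W_measurable: "0 \<le> t \<Longrightarrow> W k t \<in> borel_measurable (F t)"
  using wiener_W[of k] by (simp add: wiener_process_def)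

definition incr :: "nat \<Rightarrow> real \<Rightarrow> real \<Rightarrow> 'w \<Rightarrow> real" where
  "incr k s t \<omega> = W k t \<omega> - W k s \<omega>"

lemma incr_same [simp]: "incr k s s \<omega> = 0"
  by (simp add: incr_def)

lemma incr_measurable: "0 \<le> s \<Longrightarrow> s \<le> t \<Longrightarrow> incr k s t \<in> borel_measurable (F t)"
  unfolding incr_def
  by (intro borel_measurable_diff W_measurable F_measurable_mono[OF W_measurable]) auto

lemma incr_measurable_M: "0 \<le> s \<Longrightarrow> s \<le> t \<Longrightarrow> incr k s t \<in> borel_measurable M"
  by (intro F_measurable_M[OF incr_measurable]) auto

lemma incr_normal:
  "0 \<le> s \<Longrightarrow> s < t \<Longrightarrow> distributed M lborel (incr k s t) (normal_density 0 (sqrt (t - s)))"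
  using wiener_W[of k] by (simp add: wiener_process_def incr_def[abs_def])

lemma incr_indep_set:
  "0 \<le> s \<Longrightarrow> s < t \<Longrightarrow> indep_set (sets (F s)) (sets (vimage_algebra (space M) (incr k s t) borel))"
  using wiener_W[of k] by (simp add: wiener_process_def incr_def[abs_def])

text \<open>The definition of a Wiener process gives independence of two \<sigma>-algebras; those
  generated by \<open>z\<close> and by a function of the increment are contained in them. The
  function \<open>h\<close> is there for the increment and its square, embedded in the field where
  \<open>z\<close> takes values.\<close>

lemma incr_indep:
  assumes st: "0 \<le> s" "s < t" and z: "z \<in> measurable (F s) N" and h: "h \<in> measurable borel N'"
  shows "indep_var N z N' (\<lambda>\<omega>. h (incr k s t \<omega>))"
proof -
  note I = incr_indep_set[OF st, of k]
  let ?V = "vimage_algebra (space M) (incr k s t) borel"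
  have 1: "sigma_sets (space M) {z -` A \<inter> space M |A. A \<in> sets N} \<subseteq> sets (F s)"
    using sets.sigma_sets_subset[of "{z -` A \<inter> space M |A. A \<in> sets N}" "F s"]
      measurable_sets[OF z] st by (auto simp: space_F)
  have hV: "(\<lambda>\<omega>. h (incr k s t \<omega>)) \<in> measurable ?V N'"
    by (rule measurable_compose[OF measurable_vimage_algebra1 h]) auto
  have 2: "sigma_sets (space M) {(\<lambda>\<omega>. h (incr k s t \<omega>)) -` A \<inter> space M |A. A \<in> sets N'} \<subseteq> sets ?V"
    using sets.sigma_sets_subset[of "{(\<lambda>\<omega>. h (incr k s t \<omega>)) -` A \<inter> space M |A. A \<in> sets N'}" ?V]
      measurable_sets[OF hV] by auto
  have m: "incr k s t \<in> borel_measurable M"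
    using st by (intro incr_measurable_M) auto
  show ?thesis
    unfolding indep_var_eq
  proof (intro conjI indep_setI)
    show "z \<in> measurable M N" using z st by (intro F_measurable_M[OF z])
    show "(\<lambda>\<omega>. h (incr k s t \<omega>)) \<in> measurable M N'"
      by (rule measurable_compose[OF m h])
    show "sigma_sets (space M) {z -` A \<inter> space M |A. A \<in> sets N} \<subseteq> events"
      using 1 indep_setD_ev1[OF I] by auto
    show "sigma_sets (space M) {(\<lambda>\<omega>. h (incr k s t \<omega>)) -` A \<inter> space M |A. A \<in> sets N'} \<subseteq> events"
      using 2 indep_setD_ev2[OF I] by auto
    fix a b
    assume "a \<in> sigma_sets (space M) {z -` A \<inter> space M |A. A \<in> sets N}"
      "b \<in> sigma_sets (space M) {(\<lambda>\<omega>. h (incr k s t \<omega>)) -` A \<inter> space M |A. A \<in> sets N'}"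
    with 1 2 show "prob (a \<inter> b) = prob a * prob b"
      by (intro indep_setD[OF I]) auto
  qed
qed

lemma incr_moments:
  assumes "0 \<le> s" "s \<le> t"
  shows sq_integrable_incr: "sq_integrable M (incr k s t)"
    and integrable_incr: "integrable M (incr k s t)"
    and expectation_incr: "expectation (incr k s t) = 0"
    and expectation_incr_sq: "expectation (\<lambda>\<omega>. (incr k s t \<omega>)\<^sup>2) = t - s"
proof -
  have "sq_integrable M (incr k s t) \<and> integrable M (incr k s t) \<and> expectation (incr k s t) = 0
    \<and> expectation (\<lambda>\<omega>. (incr k s t \<omega>)\<^sup>2) = t - s"
  \<comment> \<open>The law of an increment is specified for \<open>s < t\<close> only. Degenerate
    increments do occur later, when an interval is cut at the time horizon.\<close>
  proof (cases "s = t")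
    case True
    have "incr k t t = (\<lambda>_. 0)" by (simp add: incr_def fun_eq_iff)
    with True show ?thesis
      by (simp add: sq_integrable_zero)
  next
    case False
    with assms have st: "0 \<le> s" "s < t" by auto
    note D = incr_normal[OF st, of k]
    have pos: "0 < sqrt (t - s)" using st by simp
    have i2: "integrable M (\<lambda>\<omega>. (incr k s t \<omega>)\<^sup>2)"
      using distributed_integrable[OF D, of "\<lambda>x. x\<^sup>2"]
        integrable_normal_moment[OF pos, of 0 2] by simp
    have e0: "expectation (incr k s t) = 0"
      by (rule normal_distributed_expectation[OF pos D])
    have "integrable M (incr k s t)"
      using distributed_integrable[OF D, of "\<lambda>x. x"]
        integrable_normal_moment_nz_1[OF pos, of 0] by simp
    with i2 e0 show ?thesis
      using normal_distributed_variance[OF pos D] st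
      by (auto simp: sq_integrable_def incr_measurable_M)
  qed
  then show "sq_integrable M (incr k s t)" "integrable M (incr k s t)"
    "expectation (incr k s t) = 0" "expectation (\<lambda>\<omega>. (incr k s t \<omega>)\<^sup>2) = t - s"
    by auto
qed

text \<open>Independence, not a moment bound, makes the product integrable, so integrability of
  \<open>z\<close> is enough.\<close>

lemma expectation_mult_incr:
  fixes z :: "'w \<Rightarrow> 'c::{real_normed_field, banach, second_countable_topology}"
  assumes st: "0 \<le> s" "s \<le> t" and z: "z \<in> borel_measurable (F s)" "integrable M z"
  shows integrable_mult_incr: "integrable M (\<lambda>\<omega>. z \<omega> * of_real (incr k s t \<omega>))"
    and integral_mult_incr: "(\<integral>\<omega>. z \<omega> * of_real (incr k s t \<omega>) \<partial>M) = 0"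
proof -
  have "integrable M (\<lambda>\<omega>. z \<omega> * of_real (incr k s t \<omega>)) \<and>
    (\<integral>\<omega>. z \<omega> * of_real (incr k s t \<omega>) \<partial>M) = 0"
  proof (cases "s = t")
    case False
    with st have st: "0 \<le> s" "s < t" by auto
    have ind: "indep_var borel z borel (\<lambda>\<omega>. of_real (incr k s t \<omega>) :: 'c)"
      by (rule incr_indep[OF st z(1)]) simp
    have i: "integrable M (\<lambda>\<omega>. of_real (incr k s t \<omega>) :: 'c)"
      using st by (intro integrable_of_real integrable_incr) auto
    show ?thesis
      using indep_var_integrable[OF ind z(2) i] indep_var_lebesgue_integral[OF ind z(2) i]
        expectation_incr[of s t k] integrable_incr[of s t k] st by (simp add: integral_of_real)
  qed simp
  then show "integrable M (\<lambda>\<omega>. z \<omega> * of_real (incr k s t \<omega>))"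
    "(\<integral>\<omega>. z \<omega> * of_real (incr k s t \<omega>) \<partial>M) = 0" by auto
qed

lemma integral_mult_incr_sq:
  fixes z :: "'w \<Rightarrow> 'c::{real_normed_field, banach, second_countable_topology}"
  assumes st: "0 \<le> s" "s \<le> t" and z: "z \<in> borel_measurable (F s)" "integrable M z"
  shows "(\<integral>\<omega>. z \<omega> * of_real ((incr k s t \<omega>)\<^sup>2) \<partial>M) = of_real (t - s) * (\<integral>\<omega>. z \<omega> \<partial>M)"
proof (cases "s = t")
  case False
  with st have st': "0 \<le> s" "s < t" by auto
  have ind: "indep_var borel z borel (\<lambda>\<omega>. of_real ((incr k s t \<omega>)\<^sup>2) :: 'c)"
    by (rule incr_indep[OF st' z(1)]) simp
  have i: "integrable M (\<lambda>\<omega>. of_real ((incr k s t \<omega>)\<^sup>2) :: 'c)"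
    using sq_integrable_incr[OF st, of k]
    by (intro integrable_of_real) (simp add: sq_integrable_def)
  have "(\<integral>\<omega>. of_real ((incr k s t \<omega>)\<^sup>2) \<partial>M) = (of_real (t - s) :: 'c)"
    using sq_integrable_incr[OF st, of k]
    by (simp only: integral_of_real expectation_incr_sq[OF st] sq_integrable_def real_norm_def power2_abs)
  then show ?thesis
    using indep_var_lebesgue_integral[OF ind z(2) i] by (simp add: mult.commute)
qed simp

text \<open>Products of two increments of one process are what appears, grouped by process, when the
  square of the covariation along a partition is expanded.\<close>

lemma incr_indep_processes:
  assumes "k \<noteq> l" "0 \<le> a" "0 \<le> b" "0 \<le> c" "0 \<le> d"
  shows "indep_var borel (\<lambda>\<omega>. incr k a b \<omega> * incr k c d \<omega>) borel (\<lambda>\<omega>. incr l a b \<omega> * incr l c d \<omega>)"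
proof -
  let ?P = "PiM {0..} (\<lambda>_. borel) :: (real \<Rightarrow> real) measure"
  have "indep_vars (\<lambda>_. ?P) (\<lambda>k \<omega>. \<lambda>t\<in>{0..}. W k t \<omega>) UNIV"
    using wiener by (simp add: independent_wiener_processes_def)
  then have I: "indep_var (PiM {k} (\<lambda>_. ?P)) (\<lambda>\<omega>. restrict (\<lambda>i. \<lambda>t\<in>{0..}. W i t \<omega>) {k})
      (PiM {l} (\<lambda>_. ?P)) (\<lambda>\<omega>. restrict (\<lambda>i. \<lambda>t\<in>{0..}. W i t \<omega>) {l})"
    using \<open>k \<noteq> l\<close> by (intro indep_var_restrict) auto
  have m: "(\<lambda>f. (f i b - f i a) * (f i d - f i c)) \<in> borel_measurable (PiM {i} (\<lambda>_. ?P))" for i :: nat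
  proof -
    have "(\<lambda>f. f i t) \<in> borel_measurable (PiM {i} (\<lambda>_. ?P))" if "0 \<le> t" for t
      using that
      by (intro measurable_compose[OF measurable_component_singleton[of i "{i}"]
            measurable_component_singleton[of t "{0..}"]]) auto
    with assms show ?thesis
      by (intro borel_measurable_times borel_measurable_diff) auto
  qed
  from indep_var_compose[OF I m m] show ?thesis
    using assms by (simp add: comp_def incr_def)
qed

text \<open>The filtration is only required to make each single \<open>W k\<close> a Wiener process, so the joint
  independence of two increments from the past is not available. It is replaced by the fact that the
  covariation of two independent Wiener processes, computed along partitions, vanishes.\<close>

lemma integral_mult_incr_incr_same_interval:
  fixes z :: "'w \<Rightarrow> complex"
  assumes st: "0 \<le> s" "s \<le> t" and "k \<noteq> l"
    and z: "z \<in> borel_measurable (F s)" "\<And>\<omega>. \<omega> \<in> space M \<Longrightarrow> norm (z \<omega>) \<le> c"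
  shows "(\<integral>\<omega>. z \<omega> * of_real (incr k s t \<omega> * incr l s t \<omega>) \<partial>M) = 0"
proof -
  obtain \<omega>0 where "\<omega>0 \<in> space M" using not_empty by auto
  with z(2) norm_ge_zero have c0: "0 \<le> c" by (meson order_trans)
  have zM: "z \<in> borel_measurable M" by (rule F_measurable_M[OF z(1) st(1)])
  let ?I = "\<integral>\<omega>. z \<omega> * of_real (incr k s t \<omega> * incr l s t \<omega>) \<partial>M"
  \<comment> \<open>Cutting the interval into \<open>n\<close> equal pieces does not change
    \<open>?I\<close>, but it improves the estimate by the factor \<open>1 / sqrt n\<close>.\<close>
  have bound: "norm ?I \<le> c * ((t - s) / sqrt (real n))" if n: "0 < n" for n :: nat
  proof -
    define h where "h = (t - s) / real n"
    have h0: "0 \<le> h" using st n by (simp add: h_def)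
    define p where "p i = s + real i * h" for i
    have p0: "p 0 = s" and pn: "p n = t" using n by (auto simp: p_def h_def)
    have p_mono: "p i \<le> p j" if "i \<le> j" for i j
      using that h0 by (simp add: p_def mult_right_mono)
    have p_ge: "0 \<le> p i" "s \<le> p i" for i using st h0 by (auto simp: p_def)
    have p_h: "p (Suc i) - p i = h" for i by (simp add: p_def algebra_simps)
    define D where "D k i = incr k (p i) (p (Suc i))" for k i
    have D_int: "sq_integrable M (D k i)" for k i
      unfolding D_def by (intro sq_integrable_incr p_ge p_mono) simp
    have D_rv [measurable]: "D k i \<in> borel_measurable M" for k i
      using D_int by (rule sq_integrable_measurable)
    have D_mult_int: "integrable M (\<lambda>\<omega>. D k i \<omega> * D l j \<omega>)" for k l i j
      by (rule sq_integrable_bilinear[OF bounded_bilinear_mult D_int D_int])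
    have D_meas: "D k i \<in> borel_measurable (F (p j))" if "i < j" for k i j
      unfolding D_def using that p_ge[of i] p_ge[of "Suc i"] p_mono[of i "Suc i"] p_mono[of "Suc i" j]
      by (intro F_measurable_mono[OF incr_measurable]) auto
    have sum: "incr k s t \<omega> = (\<Sum>i<n. D k i \<omega>)" for k \<omega>
      using sum_lessThan_telescope[of "\<lambda>i. W k (p i) \<omega>" n] by (simp add: D_def incr_def p0 pn)
    have zDD_int: "integrable M (\<lambda>\<omega>. z \<omega> * of_real (D k i \<omega> * D l j \<omega>))" for k l i j
    proof (rule Bochner_Integration.integrable_bound)
      show "integrable M (\<lambda>\<omega>. c * norm (D k i \<omega> * D l j \<omega>))"
        by (intro integrable_mult_right integrable_norm D_mult_int)
      show "(\<lambda>\<omega>. z \<omega> * of_real (D k i \<omega> * D l j \<omega>)) \<in> borel_measurable M"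
        using zM sq_integrable_measurable[OF D_int] by simp
      show "AE \<omega> in M. norm (z \<omega> * of_real (D k i \<omega> * D l j \<omega>)) \<le> norm (c * norm (D k i \<omega> * D l j \<omega>))"
        using z(2) c0 by (intro AE_I2) (simp add: norm_mult abs_mult mult_right_mono)
    qed
    \<comment> \<open>The later increment is independent of \<open>F (p j)\<close>, where
      \<open>z\<close> and the earlier increment are measurable. This involves the independence from
      the past of one process at a time.\<close>
    have zDD_lt: "(\<integral>\<omega>. z \<omega> * of_real (D k i \<omega> * D l j \<omega>) \<partial>M) = 0" if "i < j" for k l i j
    proof -
      have m: "(\<lambda>\<omega>. z \<omega> * of_real (D k i \<omega>)) \<in> borel_measurable (F (p j))"
        using D_meas[OF that, of k] F_measurable_mono[OF z(1) st(1) p_ge(2)] by simp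
      have i: "integrable M (\<lambda>\<omega>. z \<omega> * of_real (D k i \<omega>))"
        by (rule sq_integrable_bilinear[OF bounded_bilinear_mult sq_integrable_bounded])
          (use zM z(2) D_int in \<open>auto simp: sq_integrable_def\<close>)
      show ?thesis
        using integral_mult_incr[OF p_ge(1) p_mono m i, of "Suc j" l]
        by (simp add: D_def mult.assoc)
    qed
    have zDD: "(\<integral>\<omega>. z \<omega> * of_real (D k i \<omega> * D l j \<omega>) \<partial>M) = 0" if "i \<noteq> j" for i j
      using zDD_lt[of i j k l] zDD_lt[of j i l k] that by (cases "i < j") (auto simp: mult.commute)
    \<comment> \<open>\<open>Q\<close> is the covariation of the two processes along the partition;
      only the diagonal products survive in \<open>?I\<close>.\<close>
    define Q where "Q \<omega> = (\<Sum>i<n. D k i \<omega> * D l i \<omega>)" for \<omega>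
    have "?I = (\<integral>\<omega>. (\<Sum>i<n. \<Sum>j<n. z \<omega> * of_real (D k i \<omega> * D l j \<omega>)) \<partial>M)"
      unfolding sum sum_product of_real_sum by (simp only: sum_distrib_left)
    also have "\<dots> = (\<Sum>i<n. \<Sum>j<n. \<integral>\<omega>. z \<omega> * of_real (D k i \<omega> * D l j \<omega>) \<partial>M)"
      using zDD_int by (simp add: Bochner_Integration.integral_sum Bochner_Integration.integrable_sum del: of_real_mult)
    also have "\<dots> = (\<Sum>i<n. \<Sum>j<n. if j = i then \<integral>\<omega>. z \<omega> * of_real (D k i \<omega> * D l i \<omega>) \<partial>M else 0)"
      using zDD by (intro sum.cong refl) auto
    also have "\<dots> = (\<Sum>i<n. \<integral>\<omega>. z \<omega> * of_real (D k i \<omega> * D l i \<omega>) \<partial>M)"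
      by simp
    also have "\<dots> = (\<integral>\<omega>. z \<omega> * of_real (Q \<omega>) \<partial>M)"
      using zDD_int by (simp add: Q_def Bochner_Integration.integral_sum sum_distrib_left del: of_real_mult)
    finally have I: "?I = (\<integral>\<omega>. z \<omega> * of_real (Q \<omega>) \<partial>M)" .
    \<comment> \<open>Regrouped by process, the four factors form two independent products, and each
      of these has mean zero unless \<open>i = j\<close>, when its mean is \<open>h\<close>.\<close>
    have DDDD: "integrable M (\<lambda>\<omega>. (D k i \<omega> * D k j \<omega>) * (D l i \<omega> * D l j \<omega>))"
      "(\<integral>\<omega>. (D k i \<omega> * D k j \<omega>) * (D l i \<omega> * D l j \<omega>) \<partial>M) = (if j = i then h\<^sup>2 else 0)" for i j
    proof -
      have ind: "indep_var borel (\<lambda>\<omega>. D k i \<omega> * D k j \<omega>) borel (\<lambda>\<omega>. D l i \<omega> * D l j \<omega>)"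
        unfolding D_def by (intro incr_indep_processes \<open>k \<noteq> l\<close> p_ge)
      show "integrable M (\<lambda>\<omega>. (D k i \<omega> * D k j \<omega>) * (D l i \<omega> * D l j \<omega>))"
        by (rule indep_var_integrable[OF ind D_mult_int D_mult_int])
      have lt: "(\<integral>\<omega>. D k i \<omega> * D k j \<omega> \<partial>M) = 0" if "i < j" for k i j
        using integral_mult_incr[OF p_ge(1) p_mono D_meas[OF that, of k], of "Suc j" k]
          sq_integrable_bilinear[OF bounded_bilinear_mult D_int[of k i] sq_integrable_bounded[of "\<lambda>_. 1" 1]]
        by (simp add: D_def)
      have eq: "(\<integral>\<omega>. D k i \<omega> * D k i \<omega> \<partial>M) = h" for k i
        using expectation_incr_sq[OF p_ge(1) p_mono, of i "Suc i" k] p_h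
        by (simp add: D_def power2_eq_square)
      show "(\<integral>\<omega>. (D k i \<omega> * D k j \<omega>) * (D l i \<omega> * D l j \<omega>) \<partial>M) = (if j = i then h\<^sup>2 else 0)"
        using lt[of i j] lt[of j i] indep_var_lebesgue_integral[OF ind D_mult_int D_mult_int]
        by (cases i j rule: linorder_cases) (auto simp: eq power2_eq_square mult.commute)
    qed
    have Q2: "(Q \<omega>)\<^sup>2 = (\<Sum>i<n. \<Sum>j<n. (D k i \<omega> * D k j \<omega>) * (D l i \<omega> * D l j \<omega>))" for \<omega>
      by (simp add: Q_def power2_eq_square sum_product mult_ac)
    have Q_sq: "sq_integrable M Q"
      unfolding sq_integrable_def
    proof
      show "Q \<in> borel_measurable M"
        unfolding Q_def using sq_integrable_measurable[OF D_int] by simp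
      show "integrable M (\<lambda>\<omega>. (norm (Q \<omega>))\<^sup>2)"
        using DDDD(1) by (simp add: Q2 Bochner_Integration.integrable_sum)
    qed
    have "(\<integral>\<omega>. (Q \<omega>)\<^sup>2 \<partial>M) = (\<Sum>i<n. \<Sum>j<n. if j = i then h\<^sup>2 else 0)"
      using DDDD by (simp add: Q2 Bochner_Integration.integral_sum Bochner_Integration.integrable_sum)
    also have "\<dots> = real n * h\<^sup>2" by simp
    finally have EQ2: "(\<integral>\<omega>. (Q \<omega>)\<^sup>2 \<partial>M) = real n * h\<^sup>2" .
    \<comment> \<open>\<open>z\<close> and \<open>Q\<close> may be dependent. Cauchy-Schwarz asks
      only for the second moment of \<open>Q\<close>, which is
      \<open>n * h^2 = (t - s)^2 / n\<close>.\<close>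
    have "norm ?I \<le> sqrt (\<integral>\<omega>. (norm (z \<omega>))\<^sup>2 \<partial>M) * sqrt (\<integral>\<omega>. (norm (complex_of_real (Q \<omega>)))\<^sup>2 \<partial>M) * 1"
      unfolding I
      by (rule norm_integral_bilinear_le[OF bounded_bilinear_mult])
        (use zM z(2) Q_sq in \<open>auto simp: norm_mult sq_integrable_def intro!: sq_integrable_bounded[unfolded sq_integrable_def, THEN conjunct2]\<close>)
    also have "\<dots> \<le> c * sqrt (real n * h\<^sup>2)"
    proof -
      have "(\<integral>\<omega>. (norm (z \<omega>))\<^sup>2 \<partial>M) \<le> (\<integral>\<omega>. c\<^sup>2 \<partial>M)"
        by (intro integral_mono) (use sq_integrable_bounded[OF zM z(2)] z(2) in \<open>auto simp: sq_integrable_def intro!: power_mono\<close>)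
      then have "sqrt (\<integral>\<omega>. (norm (z \<omega>))\<^sup>2 \<partial>M) \<le> c"
        using c0 by (simp add: prob_space real_le_lsqrt)
      then show ?thesis
        using EQ2 by (simp add: mult_right_mono)
    qed
    also have "sqrt (real n * h\<^sup>2) = (t - s) / sqrt (real n)"
    proof -
      have "real n * h\<^sup>2 = ((t - s) / sqrt (real n))\<^sup>2"
        using n by (simp add: h_def power_divide power2_eq_square)
      then show ?thesis using st by simp
    qed
    finally show ?thesis .
  qed
  have "(\<lambda>n. c * ((t - s) / sqrt (real n))) \<longlonglongrightarrow> c * 0"
    by (intro tendsto_mult tendsto_const tendsto_divide_0[OF tendsto_const]
        filterlim_compose[OF filterlim_at_top_imp_at_infinity[OF sqrt_at_top] filterlim_real_sequentially])
  moreover have "\<forall>\<^sub>F n in sequentially. norm ?I \<le> c * ((t - s) / sqrt (real n))"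
    using eventually_gt_at_top[of 0] by eventually_elim (rule bound)
  ultimately have "norm ?I \<le> c * 0"
    by (intro tendsto_lowerbound) auto
  then show ?thesis by simp
qed

end

section \<open>Complex Hilbert spaces and sesquilinear forms on dense subspaces\<close>

lemma cinner_add_left: "cinner (x + y) z = cinner x z + cinner y z"
  by (metis cinner_add_right cinner_commute complex_cnj_add)

lemma cinner_scaleC_left: "cinner (a *\<^sub>C x) y = cnj a * cinner x y"
  by (metis cinner_commute cinner_scaleC_right complex_cnj_mult)

lemma cinner_zero_right [simp]: "cinner x 0 = 0"
  using cinner_add_right[of x 0 0] by simp

lemma cinner_zero_left [simp]: "cinner 0 x = 0"
  using cinner_add_left[of 0 0 x] by simp

lemma cinner_minus_right: "cinner x (- y) = - cinner x y"
  using cinner_add_right[of x y "- y"] minus_unique[of "cinner x y" "cinner x (- y)"] by simp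

lemma cinner_minus_left: "cinner (- x) y = - cinner x y"
  using cinner_add_left[of x "- x" y] minus_unique[of "cinner x y" "cinner (- x) y"] by simp

lemma cinner_diff_right: "cinner x (y - z) = cinner x y - cinner x z"
  using cinner_add_right[of x y "- z"] by (simp add: cinner_minus_right)

lemma cinner_diff_left: "cinner (x - y) z = cinner x z - cinner y z"
  using cinner_add_left[of x "- y" z] by (simp add: cinner_minus_left)

lemma Re_cinner_commute: "Re (cinner x y) = Re (cinner y x)"
  by (metis cinner_commute cnj.simps(1))

lemma norm_diff_sq: "(norm (x - y))\<^sup>2 = (norm x)\<^sup>2 - 2 * Re (cinner x y) + (norm y)\<^sup>2"
proof -
  have "complex_of_real ((norm (x - y))\<^sup>2) =
      complex_of_real ((norm x)\<^sup>2) - cinner x y - cinner y x + complex_of_real ((norm y)\<^sup>2)"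
    by (simp only: cinner_self[symmetric]) (simp add: cinner_diff_left cinner_diff_right)
  from arg_cong[OF this, of Re] show ?thesis
    using Re_cinner_commute[of x y] by simp
qed

lemma norm_scaleC: "norm (a *\<^sub>C x) = cmod a * norm x"
proof -
  have "complex_of_real ((norm (a *\<^sub>C x))\<^sup>2) = cinner (a *\<^sub>C x) (a *\<^sub>C x)"
    by (rule cinner_self[symmetric])
  also have "\<dots> = a * cnj a * cinner x x"
    by (simp add: cinner_scaleC_left cinner_scaleC_right)
  also have "\<dots> = complex_of_real ((cmod a * norm x)\<^sup>2)"
    by (simp add: cinner_self complex_norm_square[symmetric] power_mult_distrib)
  finally have "complex_of_real ((norm (a *\<^sub>C x))\<^sup>2) = complex_of_real ((cmod a * norm x)\<^sup>2)" .
  then show ?thesis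
    by (simp only: of_real_eq_iff) (simp add: power2_eq_iff_nonneg)
qed

lemma norm_cinner_le: "cmod (cinner x y) \<le> norm x * norm y"
proof (cases "y = 0")
  case False
  \<comment> \<open>\<open>a *\<^sub>C y\<close> is the orthogonal projection of \<open>x\<close>
    onto the line through \<open>y\<close>.\<close>
  define a where "a = cinner y x / complex_of_real ((norm y)\<^sup>2)"
  have ny: "(norm y)\<^sup>2 \<noteq> 0" using False by simp
  have "a * cinner x y = complex_of_real ((cmod (cinner x y))\<^sup>2 / (norm y)\<^sup>2)"
    by (simp add: a_def complex_norm_square[symmetric] cinner_commute[of y x] mult.commute)
  then have 1: "Re (cinner x (a *\<^sub>C y)) = (cmod (cinner x y))\<^sup>2 / (norm y)\<^sup>2"
    by (simp only: cinner_scaleC_right Re_complex_of_real)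
  have "cmod a = cmod (cinner x y) / (norm y)\<^sup>2"
    by (simp add: a_def norm_divide cinner_commute[of y x] norm_power)
  then have 2: "(norm (a *\<^sub>C y))\<^sup>2 = (cmod (cinner x y))\<^sup>2 / (norm y)\<^sup>2"
    using False by (simp add: norm_scaleC power_mult_distrib power_divide power2_eq_square)
  have "0 \<le> (norm (x - a *\<^sub>C y))\<^sup>2" by simp
  then have "(cmod (cinner x y))\<^sup>2 / (norm y)\<^sup>2 \<le> (norm x)\<^sup>2"
    unfolding norm_diff_sq 1 2 by simp
  then have "(cmod (cinner x y))\<^sup>2 \<le> (norm x * norm y)\<^sup>2"
    using False by (simp add: divide_le_eq power_mult_distrib)
  then show ?thesis
    by (rule power2_le_imp_le) simp
qed simp

lemma bounded_bilinear_cinner: "bounded_bilinear (cinner :: 'h::complex_hilbert_space \<Rightarrow> 'h \<Rightarrow> complex)"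
proof
  fix a a' b b' :: 'h and r :: real
  show "cinner (a + a') b = cinner a b + cinner a' b" by (rule cinner_add_left)
  show "cinner a (b + b') = cinner a b + cinner a b'" by (rule cinner_add_right)
  show "cinner (r *\<^sub>R a) b = r *\<^sub>R cinner a b"
    by (simp only: scaleC_of_real[symmetric] cinner_scaleC_left scaleC_complex_def complex_cnj_complex_of_real)
  show "cinner a (r *\<^sub>R b) = r *\<^sub>R cinner a b"
    by (simp only: scaleC_of_real[symmetric] cinner_scaleC_right scaleC_complex_def)
  show "\<exists>K. \<forall>a b :: 'h. norm (cinner a b) \<le> norm a * norm b * K"
    by (intro exI[of _ 1]) (simp add: norm_cinner_le)
qed

lemmas tendsto_cinner = bounded_bilinear.tendsto[OF bounded_bilinear_cinner]

section \<open>Functionals and sesquilinear forms on subspaces\<close>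

definition csubspace :: "'h::complex_hilbert_space set \<Rightarrow> bool" where
  "csubspace D \<longleftrightarrow> 0 \<in> D \<and> (\<forall>x\<in>D. \<forall>y\<in>D. x + y \<in> D) \<and> (\<forall>a. \<forall>x\<in>D. a *\<^sub>C x \<in> D)"

lemma csubspaceD:
  assumes "csubspace D"
  shows "0 \<in> D" "x \<in> D \<Longrightarrow> y \<in> D \<Longrightarrow> x + y \<in> D" "x \<in> D \<Longrightarrow> a *\<^sub>C x \<in> D" "x \<in> D \<Longrightarrow> r *\<^sub>R x \<in> D"
  using assms unfolding csubspace_def by (auto simp: scaleC_of_real[symmetric])

lemma dense_sequence:
  fixes z :: "'a::metric_space"
  assumes "closure D = UNIV"
  obtains x where "\<And>n. x n \<in> D" "x \<longlonglongrightarrow> z"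
  using assms closure_sequential[of z D] by auto

text \<open>Approximating \<open>z\<close> itself from \<open>D\<close> turns the hypothesis into
  \<open>norm z ^ 2 <= c * norm z\<close>.\<close>

lemma norm_le_dense:
  fixes z :: "'h::complex_hilbert_space"
  assumes D: "closure D = UNIV" and b: "\<And>x. x \<in> D \<Longrightarrow> cmod (cinner x z) \<le> c * norm x"
    and "0 \<le> c"
  shows "norm z \<le> c"
proof -
  obtain x where x: "\<And>n. x n \<in> D" "x \<longlonglongrightarrow> z"
    using dense_sequence[OF D] by blast
  have "cmod (cinner z z) \<le> c * norm z"
    by (rule LIMSEQ_le[of "\<lambda>n. cmod (cinner (x n) z)" _ "\<lambda>n. c * norm (x n)"])
      (use x b in \<open>auto intro!: tendsto_intros tendsto_cinner\<close>)
  then have "norm z * norm z \<le> c * norm z"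
    by (simp add: cinner_self norm_power power2_eq_square norm_mult)
  then show ?thesis
    using \<open>0 \<le> c\<close> by (cases "z = 0") auto
qed

lemma eq_dense:
  fixes z w :: "'h::complex_hilbert_space"
  assumes "closure D = UNIV" "\<And>x. x \<in> D \<Longrightarrow> cinner x z = cinner x w"
  shows "z = w"
proof -
  have "norm (z - w) \<le> 0"
    by (rule norm_le_dense[OF assms(1)]) (simp_all add: assms(2) cinner_diff_right)
  then show ?thesis by simp
qed

text \<open>\<open>D\<close> need not be closed, so the representing vector is sought in the whole
  complete space, as the limit of a minimising sequence in \<open>D\<close> for
  \<open>norm x ^ 2 - 2 * Re (f x)\<close>. If \<open>z\<close> represents \<open>f\<close>, this
  functional equals \<open>norm (x - z) ^ 2 - norm z ^ 2\<close>. As \<open>x\<close> stands in the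
  first slot of \<open>cinner\<close>, \<open>f\<close> is conjugate linear.\<close>

lemma riesz_on_subspace:
  fixes f :: "'h::complex_hilbert_space \<Rightarrow> complex"
  assumes D: "csubspace D"
    and add: "\<And>x y. x \<in> D \<Longrightarrow> y \<in> D \<Longrightarrow> f (x + y) = f x + f y"
    and scale: "\<And>a x. x \<in> D \<Longrightarrow> f (a *\<^sub>C x) = cnj a * f x"
    and bound: "\<And>x. x \<in> D \<Longrightarrow> cmod (f x) \<le> c * norm x"
  shows "\<exists>z. \<forall>x\<in>D. cinner x z = f x"
proof -
  note D' = csubspaceD[OF D]
  have scaleR: "f (r *\<^sub>R x) = complex_of_real r * f x" if "x \<in> D" for r x
    using scale[OF that, of "complex_of_real r"] by (simp add: scaleC_of_real)
  define J where "J x = (norm x)\<^sup>2 - 2 * Re (f x)" for x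
  have J_ge: "- c\<^sup>2 \<le> J x" if "x \<in> D" for x
  proof -
    have "Re (f x) \<le> c * norm x"
      using bound[OF that] complex_Re_le_cmod[of "f x"] by linarith
    moreover have "0 \<le> (norm x - c)\<^sup>2" by simp
    ultimately show ?thesis
      by (simp add: J_def power2_diff mult.commute)
  qed
  define m where "m = Inf (J ` D)"
  have bdd: "bdd_below (J ` D)" using J_ge by (rule bdd_belowI2)
  have m_le: "m \<le> J x" if "x \<in> D" for x
    unfolding m_def by (intro cInf_lower bdd imageI that)
  have "\<exists>x\<in>D. J x < m + 1 / real (Suc n)" for n
    using cInf_lessD[of "J ` D" "m + 1 / real (Suc n)"] D'(1) by (auto simp: m_def)
  then obtain x where x: "\<And>n. x n \<in> D" and Jx: "\<And>n. J (x n) < m + 1 / real (Suc n)"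
    by metis
  \<comment> \<open>The parallelogram identity, combined with the fact that \<open>J\<close> at the
    midpoint is at least \<open>m\<close>.\<close>
  have par: "(norm (u - v))\<^sup>2 \<le> 2 * (J u - m) + 2 * (J v - m)" if "u \<in> D" "v \<in> D" for u v
  proof -
    have "Re (f ((1/2) *\<^sub>R (u + v))) = (Re (f u) + Re (f v)) / 2"
      using that D' by (simp only: scaleR add) simp
    moreover have "(norm (u + v))\<^sup>2 = 2 * (norm u)\<^sup>2 + 2 * (norm v)\<^sup>2 - (norm (u - v))\<^sup>2"
      using norm_diff_sq[of u "- v"] norm_diff_sq[of u v] by (simp add: cinner_minus_right)
    moreover have "(norm ((1/2) *\<^sub>R (u + v)))\<^sup>2 = (norm (u + v))\<^sup>2 / 4"
      by (simp only: norm_scaleR power_mult_distrib) (simp add: power_divide)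
    ultimately have "J ((1/2) *\<^sub>R (u + v)) = (J u + J v) / 2 - (norm (u - v))\<^sup>2 / 4"
      by (simp only: J_def) (simp add: field_simps)
    with m_le[OF D'(4)[OF D'(2)[OF that], of "1/2"]]
    have "m \<le> (J u + J v) / 2 - (norm (u - v))\<^sup>2 / 4" by simp
    then show ?thesis by (simp add: field_simps)
  qed
  have "Cauchy x"
  proof (rule metric_CauchyI)
    fix e :: real assume "0 < e"
    then obtain N where N: "1 / real (Suc N) < e\<^sup>2 / 4"
      by (metis nat_approx_posE zero_less_divide_iff zero_less_numeral zero_less_power)
    have "dist (x p) (x q) < e" if "N \<le> p" "N \<le> q" for p q
    proof -
      have le: "1 / real (Suc p) \<le> 1 / real (Suc N)" "1 / real (Suc q) \<le> 1 / real (Suc N)"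
        using that by (auto simp: frac_le)
      have "(norm (x p - x q))\<^sup>2 < e\<^sup>2"
        using par[OF x x, of p q] Jx[of p] Jx[of q] le N by argo
      then show ?thesis
        using \<open>0 < e\<close> by (simp add: dist_norm power2_less_imp_less)
    qed
    then show "\<exists>N. \<forall>p\<ge>N. \<forall>q\<ge>N. dist (x p) (x q) < e" by blast
  qed
  then obtain z where z: "x \<longlonglongrightarrow> z"
    using Cauchy_convergent convergent_def by blast
  \<comment> \<open>First variation: moving the minimising sequence by \<open>t *\<^sub>R h\<close>
    and passing to the limit gives a polynomial \<open>2 t A + t^2 B\<close> that is nonnegative for
    every real \<open>t\<close>, which forces \<open>A = 0\<close>.\<close>
  have Re_eq: "Re (cinner z h) = Re (f h)" if h: "h \<in> D" for h
  proof -
    define A where "A = Re (cinner z h) - Re (f h)"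
    define B where "B = (norm h)\<^sup>2"
    have quad: "0 \<le> 2 * t * A + t\<^sup>2 * B" for t
    proof -
      have "m - m \<le> 2 * t * A + t\<^sup>2 * B"
      proof (rule LIMSEQ_le)
        show "(\<lambda>n. m - (m + 1 / real (Suc n))) \<longlonglongrightarrow> m - m"
          using tendsto_minus[OF LIMSEQ_inverse_real_of_nat] by (simp add: inverse_eq_divide)
        show "(\<lambda>n. 2 * t * (Re (cinner (x n) h) - Re (f h)) + t\<^sup>2 * B) \<longlonglongrightarrow> 2 * t * A + t\<^sup>2 * B"
          unfolding A_def by (intro tendsto_intros tendsto_cinner z)
        have "m - (m + 1 / real (Suc n)) \<le> 2 * t * (Re (cinner (x n) h) - Re (f h)) + t\<^sup>2 * B" for n
        proof -
          have "(norm (x n + t *\<^sub>R h))\<^sup>2 = (norm (x n))\<^sup>2 + 2 * t * Re (cinner (x n) h) + t\<^sup>2 * B"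
            using norm_diff_sq[of "x n" "- t *\<^sub>R h"]
            by (simp add: bounded_bilinear.scaleR_right[OF bounded_bilinear_cinner] cinner_minus_right
                power_mult_distrib B_def)
          then have "J (x n + t *\<^sub>R h)
              = J (x n) + 2 * t * (Re (cinner (x n) h) - Re (f h)) + t\<^sup>2 * B"
            using x D'(4)[OF h, of t] h by (simp add: J_def add scaleR algebra_simps)
          with m_le[OF D'(2)[OF x D'(4)[OF h]], of n t] Jx[of n] show ?thesis by linarith
        qed
        then show "\<exists>N. \<forall>n\<ge>N. m - (m + 1 / real (Suc n))
            \<le> 2 * t * (Re (cinner (x n) h) - Re (f h)) + t\<^sup>2 * B" by blast
      qed
      then show ?thesis by simp
    qed
    have B: "0 \<le> B" by (simp add: B_def)
    \<comment> \<open>At \<open>t = - p\<close> the polynomial equals \<open>- p^2 (B + 2)\<close>.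
      The denominator \<open>B + 1\<close> instead of \<open>B\<close> also covers
      \<open>h = 0\<close>.\<close>
    define p where "p = A / (B + 1)"
    have A: "A = p * (B + 1)" using B by (simp add: p_def)
    have "p\<^sup>2 * (B + 2) \<le> 0"
      using quad[of "- p"] unfolding A by (simp add: algebra_simps power2_eq_square)
    then have "p = 0"
      using B by (simp add: mult_le_0_iff)
    with A have "A = 0" by simp
    then show ?thesis by (simp add: A_def)
  qed
  have "cinner h z = f h" if h: "h \<in> D" for h
  proof -
    \<comment> \<open>The imaginary part is the real part tested at
      \<open>\<i> *\<^sub>C h\<close>.\<close>
    have "Im (cinner z h) = - Im (f h)"
      using Re_eq[OF D'(3)[OF h, of \<i>]] scale[OF h, of \<i>] by (simp add: cinner_scaleC_right)
    with Re_eq[OF h] have "cinner z h = cnj (f h)"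
      by (simp add: complex_eq_iff)
    then show ?thesis
      by (metis cinner_commute complex_cnj_cnj)
  qed
  then show ?thesis by blast
qed

lemma bounded_clinearI:
  fixes B :: "'h::complex_hilbert_space \<Rightarrow> 'h"
  assumes "\<And>x y. B (x + y) = B x + B y" "\<And>a x. B (a *\<^sub>C x) = a *\<^sub>C B x"
    "\<And>x. norm (B x) \<le> c * norm x"
  shows "bounded_clinear B"
  unfolding bounded_clinear_def
proof (intro conjI allI)
  show "bounded_linear B"
    by (rule bounded_linear_intro[of _ c])
      (use assms assms(2)[of "complex_of_real _"] in \<open>auto simp: scaleC_of_real mult.commute\<close>)
qed (rule assms)

text \<open>Riesz is applied twice, which replaces an extension by continuity. For \<open>x\<close>
  in \<open>D\<close> it represents \<open>q x\<close> by a vector \<open>d x\<close>, so that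
  \<open>d\<close> plays the role of the adjoint on \<open>D\<close>. For arbitrary \<open>y\<close>
  the functional \<open>x -> cinner (d x) y\<close> is again conjugate linear and bounded on
  \<open>D\<close>, and its representing vector is \<open>B y\<close>.\<close>

lemma sesquilinear_form_operator:
  fixes q :: "'h::complex_hilbert_space \<Rightarrow> 'h \<Rightarrow> complex"
  assumes D: "csubspace D" "closure D = UNIV" and c: "0 \<le> c"
    and add_right: "\<And>x y y'. x \<in> D \<Longrightarrow> y \<in> D \<Longrightarrow> y' \<in> D \<Longrightarrow> q x (y + y') = q x y + q x y'"
    and scale_right: "\<And>a x y. x \<in> D \<Longrightarrow> y \<in> D \<Longrightarrow> q x (a *\<^sub>C y) = a * q x y"
    and add_left: "\<And>x x' y. x \<in> D \<Longrightarrow> x' \<in> D \<Longrightarrow> y \<in> D \<Longrightarrow> q (x + x') y = q x y + q x' y"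
    and scale_left: "\<And>a x y. x \<in> D \<Longrightarrow> y \<in> D \<Longrightarrow> q (a *\<^sub>C x) y = cnj a * q x y"
    and bound: "\<And>x y. x \<in> D \<Longrightarrow> y \<in> D \<Longrightarrow> cmod (q x y) \<le> c * norm x * norm y"
  shows "\<exists>B. bounded_clinear B \<and> (\<forall>x\<in>D. \<forall>y\<in>D. cinner x (B y) = q x y)"
proof -
  note D' = csubspaceD[OF D(1)]
  have "\<exists>z. \<forall>y\<in>D. cinner y z = cnj (q x y)" if "x \<in> D" for x
    by (rule riesz_on_subspace[OF D(1), where c = "c * norm x"])
      (use that add_right scale_right bound in auto)
  then obtain d where d: "\<And>x y. x \<in> D \<Longrightarrow> y \<in> D \<Longrightarrow> cinner y (d x) = cnj (q x y)"
    by metis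
  have d_norm: "norm (d x) \<le> c * norm x" if "x \<in> D" for x
    by (rule norm_le_dense[OF D(2)]) (use that d bound c in auto)
  have d_add: "d (x + x') = d x + d x'" if "x \<in> D" "x' \<in> D" for x x'
    by (rule eq_dense[OF D(2)]) (use that d D' add_left in \<open>simp add: cinner_add_right\<close>)
  have d_scale: "d (a *\<^sub>C x) = a *\<^sub>C d x" if "x \<in> D" for a x
    by (rule eq_dense[OF D(2)]) (use that d D' scale_left in \<open>simp add: cinner_scaleC_right\<close>)
  have "cmod (cinner (d x) y) \<le> c * norm y * norm x" if "x \<in> D" for x y
    using norm_cinner_le[of "d x" y] mult_right_mono[OF d_norm[OF that] norm_ge_zero[of y]]
    by (simp add: mult_ac)
  then have "\<exists>z. \<forall>x\<in>D. cinner x z = cinner (d x) y" for y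
    by (intro riesz_on_subspace[OF D(1), where c = "c * norm y"])
      (auto simp: d_add d_scale cinner_add_left cinner_scaleC_left)
  then obtain B where B: "\<And>x y. x \<in> D \<Longrightarrow> cinner x (B y) = cinner (d x) y"
    by metis
  have "bounded_clinear B"
  proof (rule bounded_clinearI)
    show "B (y + y') = B y + B y'" for y y'
      by (rule eq_dense[OF D(2)]) (simp add: B cinner_add_right)
    show "B (a *\<^sub>C y) = a *\<^sub>C B y" for a y
      by (rule eq_dense[OF D(2)]) (simp add: B cinner_scaleC_right)
    show "norm (B y) \<le> c * norm y" for y
      by (rule norm_le_dense[OF D(2)])
        (use c \<open>\<And>x y. x \<in> D \<Longrightarrow> cmod (cinner (d x) y) \<le> c * norm y * norm x\<close> in \<open>auto simp: B\<close>)
  qed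
  moreover have "cinner x (B y) = q x y" if "x \<in> D" "y \<in> D" for x y
    using B[OF that(1), of y] d[OF that] by (metis cinner_commute complex_cnj_cnj)
  ultimately show ?thesis by blast
qed

lemma bounded_clinear_eq_dense:
  fixes B B' :: "'h::complex_hilbert_space \<Rightarrow> 'h"
  assumes D: "closure D = UNIV" and B: "bounded_clinear B" "bounded_clinear B'"
    and eq: "\<And>x y. x \<in> D \<Longrightarrow> y \<in> D \<Longrightarrow> cinner x (B y) = cinner x (B' y)"
  shows "B = B'"
proof
  fix y
  obtain u where u: "\<And>n. u n \<in> D" "u \<longlonglongrightarrow> y"
    using dense_sequence[OF D] by blast
  have "B (u n) = B' (u n)" for n
    by (rule eq_dense[OF D]) (use eq u in auto)
  moreover have "(\<lambda>n. B (u n)) \<longlonglongrightarrow> B y" "(\<lambda>n. B' (u n)) \<longlonglongrightarrow> B' y"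
    using B u(2) by (auto simp: bounded_clinear_def intro: bounded_linear.tendsto)
  ultimately show "B y = B' y"
    using LIMSEQ_unique by simp
qed

lemma bounded_clinear_norm_le_dense:
  fixes B :: "'h::complex_hilbert_space \<Rightarrow> 'h"
  assumes D: "closure D = UNIV" and B: "bounded_clinear B" and c: "0 \<le> c"
    and bound: "\<And>x y. x \<in> D \<Longrightarrow> y \<in> D \<Longrightarrow> cmod (cinner x (B y)) \<le> c * norm x * norm y"
  shows "norm (B y) \<le> c * norm y"
proof -
  obtain u where u: "\<And>n. u n \<in> D" "u \<longlonglongrightarrow> y"
    using dense_sequence[OF D] by blast
  have "norm (B (u n)) \<le> c * norm (u n)" for n
    by (rule norm_le_dense[OF D]) (use c bound[OF _ u(1)] in \<open>auto simp: mult_ac\<close>)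
  moreover have "(\<lambda>n. B (u n)) \<longlonglongrightarrow> B y"
    using B u(2) by (auto simp: bounded_clinear_def intro: bounded_linear.tendsto)
  ultimately show ?thesis
    by (intro LIMSEQ_le[of "\<lambda>n. norm (B (u n))" _ "\<lambda>n. c * norm (u n)"])
      (auto intro!: tendsto_intros u)
qed

section \<open>Elementary processes\<close>

text \<open>Lebesgue measure on [0, t] as a space of its own: processes up to time \<open>t\<close>
  become functions on a finite product with \<open>M\<close>, to which Fubini and the mean square
  lemmas apply.\<close>

definition leb :: "real \<Rightarrow> real measure" where
  "leb t = restrict_space lborel {0..t}"

lemma space_leb [simp]: "space (leb t) = {0..t}"
  by (simp add: leb_def space_restrict_space)

lemma sets_leb: "sets (leb t) = sets (restrict_space borel {0..t})"
  unfolding leb_def by (rule sets_restrict_space_cong) simp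

lemma measurable_leb: "f \<in> measurable borel N \<Longrightarrow> f \<in> measurable (leb t) N"
  unfolding leb_def by (rule measurable_restrict_space1) simp

lemma measurable_leb_id [measurable]: "(\<lambda>x. x) \<in> borel_measurable (leb t)"
  by (rule measurable_leb) simp

lemma finite_measure_leb: "finite_measure (leb t)"
  by (rule finite_measureI) (simp add: leb_def emeasure_restrict_space emeasure_lborel_Icc_eq)

lemma integral_leb:
  fixes f :: "real \<Rightarrow> 'b::{banach, second_countable_topology}"
  shows "integral\<^sup>L (leb t) f = (LINT r:{0..t}|lborel. f r)"
  by (simp add: leb_def integral_restrict_space set_lebesgue_integral_def)

lemma integrable_leb:
  fixes f :: "real \<Rightarrow> 'b::{banach, second_countable_topology}"
  shows "integrable (leb t) f \<longleftrightarrow> set_integrable lborel {0..t} f"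
  by (simp add: leb_def integrable_restrict_space set_integrable_def)

lemma nn_integral_leb: "nn_integral (leb t) f = (\<integral>\<^sup>+r\<in>{0..t}. f r \<partial>lborel)"
  by (simp add: leb_def nn_integral_restrict_space)

lemma integral_double_sum:
  fixes f :: "'i \<Rightarrow> 'j \<Rightarrow> 'a \<Rightarrow> 'b::{banach, second_countable_topology}"
  assumes "\<And>i j. i \<in> I \<Longrightarrow> j \<in> J \<Longrightarrow> integrable N (f i j)"
    and "\<And>i j. i \<in> I \<Longrightarrow> j \<in> J \<Longrightarrow> (\<integral>x. f i j x \<partial>N) = c i j"
  shows "(\<integral>x. (\<Sum>i\<in>I. \<Sum>j\<in>J. f i j x) \<partial>N) = (\<Sum>i\<in>I. \<Sum>j\<in>J. c i j)"
proof -
  have "(\<integral>x. (\<Sum>i\<in>I. \<Sum>j\<in>J. f i j x) \<partial>N) = (\<Sum>i\<in>I. \<integral>x. (\<Sum>j\<in>J. f i j x) \<partial>N)"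
    by (intro Bochner_Integration.integral_sum Bochner_Integration.integrable_sum assms(1))
  also have "\<dots> = (\<Sum>i\<in>I. \<Sum>j\<in>J. \<integral>x. f i j x \<partial>N)"
    by (intro sum.cong refl Bochner_Integration.integral_sum assms(1))
  also have "\<dots> = (\<Sum>i\<in>I. \<Sum>j\<in>J. c i j)"
    by (intro sum.cong refl assms(2))
  finally show ?thesis .
qed

lemma bilinear_sum_scaleR:
  fixes b :: "'a::real_normed_vector \<Rightarrow> 'b::real_normed_vector \<Rightarrow> complex"
  assumes "bounded_bilinear b"
  shows "b (\<Sum>i\<in>I. f i *\<^sub>R x i) (\<Sum>j\<in>J. g j *\<^sub>R y j)
    = (\<Sum>i\<in>I. \<Sum>j\<in>J. of_real (f i * g j) * b (x i) (y j))"
proof -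
  interpret b: bounded_bilinear b by fact
  have "b (f i *\<^sub>R x i) (g j *\<^sub>R y j) = of_real (f i * g j) * b (x i) (y j)" for i j
    by (simp add: b.scaleR_left b.scaleR_right scaleR_conv_of_real mult_ac)
  then show ?thesis
    by (simp only: b.sum_left) (simp only: b.sum_right)
qed

lemma elementary_integral_sum:
  "elementary_integral B t H \<omega> = (\<Sum>i<length H. (B (min (fst (snd (H ! i))) t) \<omega>
     - B (min (fst (H ! i)) t) \<omega>) *\<^sub>R snd (snd (H ! i)) \<omega>)"
  by (simp add: elementary_integral_def sum_list_sum_nth atLeast0LessThan case_prod_beta)

lemma elementary_value_sum:
  "elementary_value H r \<omega> = (\<Sum>i<length H.
     indicat_real {fst (H ! i)<..fst (snd (H ! i))} r *\<^sub>R snd (snd (H ! i)) \<omega>)"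
  by (simp add: elementary_value_def sum_list_sum_nth atLeast0LessThan case_prod_beta)

context wiener_setting
begin

lemma pair_leb: "pair_sigma_finite (leb t) M"
  by (intro pair_sigma_finite.intro finite_measure.axioms finite_measure_leb sigma_finite_measure_axioms)

lemma finite_measure_leb_M: "finite_measure (leb t \<Otimes>\<^sub>M M)"
  by (intro finite_measure_pair_measure finite_measure_leb finite_measure_axioms)

lemma elementary_processD:
  fixes H :: "('w, 'h::real_normed_vector) elementary"
  assumes H: "elementary_process F H" and i: "i < length H"
  shows "0 \<le> fst (H ! i)" "fst (H ! i) \<le> fst (snd (H ! i))"
    "snd (snd (H ! i)) \<in> borel_measurable (F (fst (H ! i)))"
    "snd (snd (H ! i)) \<in> borel_measurable M"
    "\<exists>c. \<forall>\<omega>\<in>space M. norm (snd (snd (H ! i)) \<omega>) \<le> c"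
proof -
  have "H ! i \<in> set H" using i by simp
  with H have *: "0 \<le> fst (H ! i) \<and> fst (H ! i) \<le> fst (snd (H ! i)) \<and>
    snd (snd (H ! i)) \<in> borel_measurable (F (fst (H ! i))) \<and>
    bounded (snd (snd (H ! i)) ` space (F (fst (H ! i))))"
    by (auto simp: elementary_process_def case_prod_beta)
  then show "0 \<le> fst (H ! i)" "fst (H ! i) \<le> fst (snd (H ! i))"
    "snd (snd (H ! i)) \<in> borel_measurable (F (fst (H ! i)))"
    by auto
  with * show "snd (snd (H ! i)) \<in> borel_measurable M"
    "\<exists>c. \<forall>\<omega>\<in>space M. norm (snd (snd (H ! i)) \<omega>) \<le> c"
    by (auto simp: F_measurable_M bounded_iff space_F)
qed

lemma integrable_bounded_mult:
  fixes z :: "'w \<Rightarrow> complex"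
  assumes z: "z \<in> borel_measurable M" "\<And>\<omega>. \<omega> \<in> space M \<Longrightarrow> norm (z \<omega>) \<le> c"
    and fg: "sq_integrable M f" "sq_integrable M g"
  shows "integrable M (\<lambda>\<omega>. z \<omega> * of_real (f \<omega> * g \<omega> :: real))"
proof (rule Bochner_Integration.integrable_bound)
  show "integrable M (\<lambda>\<omega>. c * (f \<omega> * g \<omega>))"
    by (intro integrable_mult_right sq_integrable_bilinear[OF bounded_bilinear_mult] fg)
  show "(\<lambda>\<omega>. z \<omega> * of_real (f \<omega> * g \<omega>)) \<in> borel_measurable M"
    using z(1) fg[THEN sq_integrable_measurable] by simp
  show "AE \<omega> in M. norm (z \<omega> * of_real (f \<omega> * g \<omega>)) \<le> norm (c * (f \<omega> * g \<omega>))"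
    using z(2) by (intro AE_I2) (auto simp: norm_mult abs_mult intro!: mult_right_mono order_trans[OF _ abs_ge_self])
qed

lemma sq_integrable_scaleR_bounded:
  fixes \<eta> :: "'w \<Rightarrow> 'h::{real_normed_vector, second_countable_topology}"
  assumes f: "sq_integrable M (f :: 'w \<Rightarrow> real)" and \<eta>: "\<eta> \<in> borel_measurable M"
    and c: "\<And>\<omega>. \<omega> \<in> space M \<Longrightarrow> norm (\<eta> \<omega>) \<le> c"
  shows "sq_integrable M (\<lambda>\<omega>. f \<omega> *\<^sub>R \<eta> \<omega>)"
  by (rule sq_integrable_bound[where g = "\<lambda>\<omega>. (f \<omega>)\<^sup>2 * c\<^sup>2"])
    (use assms in \<open>auto simp: sq_integrable_def power_mult_distrib intro!: mult_left_mono power_mono\<close>)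

text \<open>The real factor is the length of the overlap of the two intervals. Cutting both at the
  later left endpoint and at the earlier right endpoint leaves one product over the common part; the
  products over disjoint parts have mean zero, and one of the pieces beyond the common part is
  degenerate.\<close>

lemma integral_incr_incr:
  fixes z :: "'w \<Rightarrow> complex"
  assumes ab: "0 \<le> a" "a \<le> b" "0 \<le> a'" "a' \<le> b'"
    and z: "z \<in> borel_measurable (F (max a a'))" "\<And>\<omega>. \<omega> \<in> space M \<Longrightarrow> norm (z \<omega>) \<le> c"
  shows "(\<integral>\<omega>. z \<omega> * of_real (incr k a b \<omega> * incr l a' b' \<omega>) \<partial>M) =
    (if k = l then of_real (max 0 (min b b' - max a a')) * (\<integral>\<omega>. z \<omega> \<partial>M) else 0)"
proof -
  \<comment> \<open>\<open>z\<close> has to be known only at the start of the later interval: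
    together with the earlier increment it forms one \<open>F a'\<close>-measurable
    coefficient.\<close>
  have disjoint: "(\<integral>\<omega>. z \<omega> * of_real (incr k a b \<omega> * incr l a' b' \<omega>) \<partial>M) = 0"
    if "0 \<le> a" "a \<le> b" "b \<le> a'" "a' \<le> b'" and z: "z \<in> borel_measurable (F a')"
      "\<And>\<omega>. \<omega> \<in> space M \<Longrightarrow> norm (z \<omega>) \<le> c" for a b a' b' k l
  proof -
    have m: "(\<lambda>\<omega>. z \<omega> * of_real (incr k a b \<omega>)) \<in> borel_measurable (F a')"
      using that z F_measurable_mono[OF incr_measurable, of a b a' k] by simp
    have zM: "z \<in> borel_measurable M"
      by (rule F_measurable_M[OF z(1)]) (use that in auto)
    have i: "integrable M (\<lambda>\<omega>. z \<omega> * of_real (incr k a b \<omega>))"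
      using integrable_bounded_mult[OF zM z(2) sq_integrable_incr[of a b k] sq_integrable_bounded[of "\<lambda>_. 1" 1]]
        that by simp
    show ?thesis
      using integral_mult_incr[OF _ _ m i, of b' l] that by (simp add: mult.assoc)
  qed
  have main: "(\<integral>\<omega>. z \<omega> * of_real (incr k a b \<omega> * incr l a' b' \<omega>) \<partial>M) =
      (if k = l then of_real (max 0 (min b b' - max a a')) * (\<integral>\<omega>. z \<omega> \<partial>M) else 0)"
    if ab: "0 \<le> a" "a \<le> b" "a \<le> a'" "a' \<le> b'" and z: "z \<in> borel_measurable (F a')" for a b a' b' k l
  proof (cases "b \<le> a'")
    case True
    with disjoint[OF ab(1,2) True ab(4) z assms(6)] show ?thesis
      using that by (auto simp: max_def min_def)
  next
    case False
    define m where "m = min b b'"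
    have m: "a' \<le> m" "m \<le> b" "m \<le> b'" "m = b \<or> m = b'"
      using ab False by (auto simp: m_def)
    have zm: "z \<in> borel_measurable (F m)"
      using F_measurable_mono[OF z _ m(1)] ab by auto
    have zM: "z \<in> borel_measurable M"
      by (rule F_measurable_M[OF z(1)]) (use that in auto)
    let ?p = "incr k a a'" and ?q = "incr k a' m" and ?q' = "incr k m b"
      and ?r = "incr l a' m" and ?r' = "incr l m b'" and ?L = "incr l a' b'"
    note I = integrable_bounded_mult[OF zM assms(6) sq_integrable_incr sq_integrable_incr]
    have "z \<omega> * of_real (incr k a b \<omega> * ?L \<omega>) =
        z \<omega> * of_real (?p \<omega> * ?L \<omega>) + z \<omega> * of_real (?q \<omega> * ?r \<omega>)
        + z \<omega> * of_real (?q \<omega> * ?r' \<omega>) + z \<omega> * of_real (?r \<omega> * ?q' \<omega>)" for \<omega>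
    proof -
      \<comment> \<open>As \<open>m\<close> is one of the two right endpoints, one of
        \<open>?q'\<close> and \<open>?r'\<close> is an increment over a single point.\<close>
      have "incr k a b \<omega> = ?p \<omega> + ?q \<omega> + ?q' \<omega>" "?L \<omega> = ?r \<omega> + ?r' \<omega>" "?q' \<omega> * ?r' \<omega> = 0"
        using m(4) by (auto simp: incr_def)
      then have "incr k a b \<omega> * ?L \<omega> = ?p \<omega> * ?L \<omega> + ?q \<omega> * ?r \<omega> + ?q \<omega> * ?r' \<omega> + ?r \<omega> * ?q' \<omega>"
        by algebra
      then show ?thesis
        by (simp only: of_real_add distrib_left)
    qed
    then have "(\<integral>\<omega>. z \<omega> * of_real (incr k a b \<omega> * ?L \<omega>) \<partial>M) =
       (\<integral>\<omega>. z \<omega> * of_real (?p \<omega> * ?L \<omega>) \<partial>M) + (\<integral>\<omega>. z \<omega> * of_real (?q \<omega> * ?r \<omega>) \<partial>M)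
        + (\<integral>\<omega>. z \<omega> * of_real (?q \<omega> * ?r' \<omega>) \<partial>M) + (\<integral>\<omega>. z \<omega> * of_real (?r \<omega> * ?q' \<omega>) \<partial>M)"
      using I ab m by (simp del: of_real_mult)
    also have "(\<integral>\<omega>. z \<omega> * of_real (?p \<omega> * ?L \<omega>) \<partial>M) = 0"
      by (rule disjoint) (use ab m z assms(6) in auto)
    also have "(\<integral>\<omega>. z \<omega> * of_real (?q \<omega> * ?r' \<omega>) \<partial>M) = 0"
      by (rule disjoint) (use ab m zm assms(6) in auto)
    also have "(\<integral>\<omega>. z \<omega> * of_real (?r \<omega> * ?q' \<omega>) \<partial>M) = 0"
      by (rule disjoint) (use ab m zm assms(6) in auto)
    also have "(\<integral>\<omega>. z \<omega> * of_real (?q \<omega> * ?r \<omega>) \<partial>M) =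
      (if k = l then of_real (m - a') * (\<integral>\<omega>. z \<omega> \<partial>M) else 0)"
    proof (cases "k = l")
      case True
      have "integrable M z"
        by (rule integrable_const_bound[of _ c]) (use zM assms(6) in auto)
      with True show ?thesis
        using integral_mult_incr_sq[OF _ m(1) z, of k] ab by (simp add: power2_eq_square)
    next
      case False
      then show ?thesis
        using integral_mult_incr_incr_same_interval[OF _ m(1) False z assms(6)] ab by simp
    qed
    also have "m - a' = max 0 (min b b' - max a a')"
      using ab m by (simp add: m_def max_def)
    finally show ?thesis by simp
  qed
  show ?thesis
  proof (cases "a \<le> a'")
    case True
    then show ?thesis using main[of a b a' b' k l] ab z by (simp add: max_def)
  next
    case False
    then show ?thesis using main[of a' b' a b l k] ab z by (simp add: max_def min.commute mult.commute)
  qed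
qed

lemma sq_integrable_elementary_integral:
  fixes H :: "('w, 'h::{real_normed_vector, second_countable_topology}) elementary"
  assumes H: "elementary_process F H" and t: "0 \<le> t"
  shows "sq_integrable M (elementary_integral (W k) t H)"
proof -
  have "sq_integrable M (\<lambda>\<omega>. (W k (min (fst (snd (H ! i))) t) \<omega>
      - W k (min (fst (H ! i)) t) \<omega>) *\<^sub>R snd (snd (H ! i)) \<omega>)" if i: "i < length H" for i
  proof -
    note D = elementary_processD[OF H i]
    obtain c where "\<forall>\<omega>\<in>space M. norm (snd (snd (H ! i)) \<omega>) \<le> c" using D(5) by blast
    then show ?thesis
      using sq_integrable_scaleR_bounded[OF sq_integrable_incr D(4), of "min (fst (H ! i)) t"
          "min (fst (snd (H ! i))) t" c k] D(1,2) t
      by (simp add: incr_def min_le_iff_disj)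
  qed
  then have "sq_integrable M (\<lambda>\<omega>. \<Sum>i<length H. (W k (min (fst (snd (H ! i))) t) \<omega>
      - W k (min (fst (H ! i)) t) \<omega>) *\<^sub>R snd (snd (H ! i)) \<omega>)"
    by (intro sq_integrable_sum) auto
  then show ?thesis by (simp add: elementary_integral_sum[abs_def])
qed

lemma sq_integrable_elementary_value:
  fixes H :: "('w, 'h::{real_normed_vector, second_countable_topology}) elementary"
  assumes H: "elementary_process F H"
  shows "sq_integrable (leb t \<Otimes>\<^sub>M M) (\<lambda>p. elementary_value H (fst p) (snd p))"
proof -
  interpret P: finite_measure "leb t \<Otimes>\<^sub>M M" by (rule finite_measure_leb_M)
  have "sq_integrable (leb t \<Otimes>\<^sub>M M) (\<lambda>p. indicat_real {fst (H ! i)<..fst (snd (H ! i))} (fst p)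
     *\<^sub>R snd (snd (H ! i)) (snd p))" if i: "i < length H" for i
  proof -
    note D = elementary_processD[OF H i]
    obtain c where c: "\<forall>\<omega>\<in>space M. norm (snd (snd (H ! i)) \<omega>) \<le> c" using D(5) by blast
    have [measurable]: "snd (snd (H ! i)) \<in> borel_measurable M" by (rule D)
    have [measurable]: "indicat_real {fst (H ! i)<..fst (snd (H ! i))} \<in> borel_measurable (leb t)"
      by (rule measurable_leb) measurable
    show ?thesis
    proof (rule P.sq_integrable_bounded[where c = "max 0 c"])
      show "norm (indicat_real {fst (H ! i)<..fst (snd (H ! i))} (fst p) *\<^sub>R snd (snd (H ! i)) (snd p))
        \<le> max 0 c" if "p \<in> space (leb t \<Otimes>\<^sub>M M)" for p
        using c that by (auto simp: space_pair_measure indicator_def le_max_iff_disj)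
    qed measurable
  qed
  then have "sq_integrable (leb t \<Otimes>\<^sub>M M) (\<lambda>p. \<Sum>i<length H.
      indicat_real {fst (H ! i)<..fst (snd (H ! i))} (fst p) *\<^sub>R snd (snd (H ! i)) (snd p))"
    by (intro sq_integrable_sum) auto
  then show ?thesis by (simp add: elementary_value_sum)
qed

text \<open>Every endpoint is cut at \<open>t\<close> because \<open>integral_incr_incr\<close>,
  applied to the cut increments, produces the overlap length in this shape.\<close>

lemma integral_indicator_leb:
  assumes "0 \<le> a" "0 \<le> a'" "0 \<le> t" "a \<le> b" "a' \<le> b'"
  shows "(\<integral>r. indicat_real {a<..b} r * indicat_real {a'<..b'} r \<partial>leb t)
    = max 0 (min (min b t) (min b' t) - max (min a t) (min a' t))"
proof -
  have "(\<integral>r. indicat_real {a<..b} r * indicat_real {a'<..b'} r \<partial>leb t)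
    = (\<integral>r. indicat_real {max a a'<..min (min b b') t} r \<partial>lborel)"
    unfolding integral_leb set_lebesgue_integral_def
    by (intro Bochner_Integration.integral_cong) (use assms in \<open>auto simp: indicator_def\<close>)
  also have "\<dots> = max 0 (min (min b b') t - max a a')"
  proof (cases "max a a' \<le> min (min b b') t")
    case False
    then have "{max a a'<..min (min b b') t} = {}" "min (min b b') t - max a a' \<le> 0"
      by auto
    then show ?thesis by simp
  qed simp
  also have "\<dots> = max 0 (min (min b t) (min b' t) - max (min a t) (min a' t))"
    using assms by (auto simp: max_def min_def)
  finally show ?thesis .
qed

text \<open>Both sides expand into a double sum over pairs of summands. The form enters only through
  the coefficients \<open>z i j\<close>, known at the later of the two left endpoints, so on either
  side a pair contributes the overlap length times the mean of \<open>z i j\<close> if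
  \<open>k = l\<close>; different Wiener processes contribute nothing.\<close>

theorem elementary_isometry:
  fixes b :: "'h::{real_normed_vector, second_countable_topology} \<Rightarrow> 'h \<Rightarrow> complex"
  assumes b: "bounded_bilinear b" and t: "0 \<le> t"
    and H: "elementary_process F H" and H': "elementary_process F H'"
  shows "(\<integral>\<omega>. b (elementary_integral (W k) t H \<omega>) (elementary_integral (W l) t H' \<omega>) \<partial>M) =
    (if k = l then \<integral>p. b (elementary_value H (fst p) (snd p)) (elementary_value H' (fst p) (snd p)) \<partial>(leb t \<Otimes>\<^sub>M M)
     else 0)"
proof -
  interpret b: bounded_bilinear b by (rule b)
  interpret PP: pair_sigma_finite "leb t" M by (rule pair_leb)
  interpret P: finite_measure "leb t \<Otimes>\<^sub>M M" by (rule finite_measure_leb_M)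
  obtain K where K: "\<And>x y. norm (b x y) \<le> norm x * norm y * K" "0 \<le> K"
    using b.nonneg_bounded by blast
  note D = elementary_processD[OF H] and D' = elementary_processD[OF H']
  define lo where "lo i = fst (H ! i)" for i
  define hi where "hi i = fst (snd (H ! i))" for i
  define co where "co i = snd (snd (H ! i))" for i
  define lo' where "lo' i = fst (H' ! i)" for i
  define hi' where "hi' i = fst (snd (H' ! i))" for i
  define co' where "co' i = snd (snd (H' ! i))" for i
  define z where "z i j \<omega> = b (co i \<omega>) (co' j \<omega>)" for i j \<omega>
  let ?I = "{..<length H}" and ?J = "{..<length H'}"
  define len where "len i j = max 0 (min (min (hi i) t) (min (hi' j) t) - max (min (lo i) t) (min (lo' j) t))" for i j
  have lohi: "0 \<le> min (lo i) t" "min (lo i) t \<le> min (hi i) t" "0 \<le> lo i" "lo i \<le> hi i" if "i \<in> ?I" for i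
    using D(1,2)[of i] that t by (auto simp: lo_def hi_def)
  have lohi': "0 \<le> min (lo' i) t" "min (lo' i) t \<le> min (hi' i) t" "0 \<le> lo' i" "lo' i \<le> hi' i" if "i \<in> ?J" for i
    using D'(1,2)[of i] that t by (auto simp: lo'_def hi'_def)
  have zb: "\<exists>c. \<forall>\<omega>\<in>space M. cmod (z i j \<omega>) \<le> c" if ij: "i \<in> ?I" "j \<in> ?J" for i j
  proof -
    obtain c c' where c: "\<forall>\<omega>\<in>space M. norm (co i \<omega>) \<le> c" "\<forall>\<omega>\<in>space M. norm (co' j \<omega>) \<le> c'"
      using D(5) D'(5) ij by (metis co_def co'_def lessThan_iff)
    have "cmod (z i j \<omega>) \<le> c * c' * K" if "\<omega> \<in> space M" for \<omega>
      unfolding z_def using c that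
      by (intro order_trans[OF K(1)] mult_right_mono mult_mono K(2))
        (auto intro: order_trans[OF norm_ge_zero])
    then show ?thesis by blast
  qed
  have zM: "z i j \<in> borel_measurable M" if "i \<in> ?I" "j \<in> ?J" for i j
    unfolding z_def co_def co'_def using that by (intro borel_measurable_bilinear[OF b] D D') auto
  have zF: "z i j \<in> borel_measurable (F (max (lo i) (lo' j)))" if "i \<in> ?I" "j \<in> ?J" for i j
    unfolding z_def co_def co'_def lo_def lo'_def using that D(1) D'(1)
    by (intro borel_measurable_bilinear[OF b] F_measurable_mono[OF D(3)] F_measurable_mono[OF D'(3)]) auto
  have I1: "integrable M (\<lambda>\<omega>. z i j \<omega> * of_real (incr k (min (lo i) t) (min (hi i) t) \<omega>
      * incr l (min (lo' j) t) (min (hi' j) t) \<omega>))" if ij: "i \<in> ?I" "j \<in> ?J" for i j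
  proof -
    obtain c where "\<forall>\<omega>\<in>space M. cmod (z i j \<omega>) \<le> c" using zb ij by blast
    then show ?thesis
      using ij by (intro integrable_bounded_mult[OF zM] sq_integrable_incr lohi lohi') auto
  qed
  have E1: "(\<integral>\<omega>. z i j \<omega> * of_real (incr k (min (lo i) t) (min (hi i) t) \<omega>
      * incr l (min (lo' j) t) (min (hi' j) t) \<omega>) \<partial>M)
      = (if k = l then of_real (len i j) * (\<integral>\<omega>. z i j \<omega> \<partial>M) else 0)" if ij: "i \<in> ?I" "j \<in> ?J" for i j
  proof -
    obtain c where c: "\<forall>\<omega>\<in>space M. cmod (z i j \<omega>) \<le> c" using zb ij by blast
    show ?thesis
    \<comment> \<open>If an interval starts after \<open>t\<close>, then \<open>z i j\<close> need
      not be measurable at the cut endpoint \<open>t\<close>. In that case a cut increment and the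
      overlap length are both zero.\<close>
    proof (cases "lo i \<le> t \<and> lo' j \<le> t")
      case True
      then have "z i j \<in> borel_measurable (F (max (min (lo i) t) (min (lo' j) t)))"
        using zF[OF ij] by (simp add: min_absorb1)
      then show ?thesis
        unfolding len_def using c ij by (intro integral_incr_incr lohi lohi') auto
    next
      case False
      then have "incr k (min (lo i) t) (min (hi i) t) \<omega> * incr l (min (lo' j) t) (min (hi' j) t) \<omega> = 0" for \<omega>
        using lohi[OF ij(1)] lohi'[OF ij(2)] by (auto simp: min_absorb2)
      moreover have "len i j = 0"
      proof -
        have "t \<le> max (min (lo i) t) (min (lo' j) t)"
          using False by (auto simp: le_max_iff_disj)
        moreover have "min (min (hi i) t) (min (hi' j) t) \<le> t"
          by (simp add: min_le_iff_disj)
        ultimately show ?thesis by (simp add: len_def)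
      qed
      ultimately show ?thesis by (simp only: of_real_0 mult_zero_left mult_zero_right) simp
    qed
  qed
  have "(\<integral>\<omega>. b (elementary_integral (W k) t H \<omega>) (elementary_integral (W l) t H' \<omega>) \<partial>M)
    = (\<integral>\<omega>. (\<Sum>i\<in>?I. \<Sum>j\<in>?J. z i j \<omega> * of_real (incr k (min (lo i) t) (min (hi i) t) \<omega>
      * incr l (min (lo' j) t) (min (hi' j) t) \<omega>)) \<partial>M)"
    by (simp only: elementary_integral_sum bilinear_sum_scaleR[OF b] z_def
        lo_def hi_def co_def lo'_def hi'_def co'_def incr_def mult.commute)
  also have "\<dots> = (\<Sum>i\<in>?I. \<Sum>j\<in>?J. if k = l then of_real (len i j) * (\<integral>\<omega>. z i j \<omega> \<partial>M) else 0)"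
    by (rule integral_double_sum[OF I1 E1])
  finally have LHS: "(\<integral>\<omega>. b (elementary_integral (W k) t H \<omega>) (elementary_integral (W l) t H' \<omega>) \<partial>M)
    = (if k = l then (\<Sum>i\<in>?I. \<Sum>j\<in>?J. of_real (len i j) * (\<integral>\<omega>. z i j \<omega> \<partial>M)) else 0)"
    by simp
  let ?ind = "\<lambda>i j r. indicat_real {lo i<..hi i} r * indicat_real {lo' j<..hi' j} r"
  have ind_m: "?ind i j \<in> borel_measurable (leb t)" for i j
    by (rule measurable_leb) measurable
  have I2: "integrable (leb t \<Otimes>\<^sub>M M) (\<lambda>p. of_real (?ind i j (fst p)) * z i j (snd p))"
    if ij: "i \<in> ?I" "j \<in> ?J" for i j
  proof -
    obtain c where c: "\<forall>\<omega>\<in>space M. cmod (z i j \<omega>) \<le> c" using zb ij by blast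
    note [measurable] = zM[OF ij] ind_m[of i j]
    show ?thesis
    proof (rule P.integrable_const_bound[of _ "max 0 c"])
      show "AE p in leb t \<Otimes>\<^sub>M M. norm (of_real (?ind i j (fst p)) * z i j (snd p)) \<le> max 0 c"
        using c by (intro AE_I2) (auto simp: space_pair_measure indicator_def le_max_iff_disj)
    qed measurable
  qed
  have E2: "(\<integral>p. of_real (?ind i j (fst p)) * z i j (snd p) \<partial>(leb t \<Otimes>\<^sub>M M)) =
      of_real (len i j) * (\<integral>\<omega>. z i j \<omega> \<partial>M)" if ij: "i \<in> ?I" "j \<in> ?J" for i j
  proof -
    have "(\<integral>p. of_real (?ind i j (fst p)) * z i j (snd p) \<partial>(leb t \<Otimes>\<^sub>M M)) =
      (\<integral>r. (\<integral>\<omega>. of_real (?ind i j r) * z i j \<omega> \<partial>M) \<partial>leb t)"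
      using PP.integral_fst'[OF I2[OF ij]] by simp
    also have "\<dots> = (\<integral>r. of_real (?ind i j r) * (\<integral>\<omega>. z i j \<omega> \<partial>M) \<partial>leb t)"
      by (simp only: integral_mult_right_zero)
    also have "\<dots> = (\<integral>r. of_real (?ind i j r) \<partial>leb t) * (\<integral>\<omega>. z i j \<omega> \<partial>M)"
      by (simp only: integral_mult_left_zero)
    also have "(\<integral>r. complex_of_real (?ind i j r) \<partial>leb t) = of_real (\<integral>r. ?ind i j r \<partial>leb t)"
    proof (rule integral_of_real)
      show "integrable (leb t) (?ind i j)"
        by (rule finite_measure.integrable_const_bound[OF finite_measure_leb, of _ 1])
          (auto simp: indicator_def ind_m[unfolded indicator_def])
    qed
    also have "(\<integral>r. ?ind i j r \<partial>leb t) = len i j"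
      unfolding len_def by (rule integral_indicator_leb) (use lohi[OF ij(1)] lohi'[OF ij(2)] t in auto)
    finally show ?thesis .
  qed
  have "(\<integral>p. b (elementary_value H (fst p) (snd p)) (elementary_value H' (fst p) (snd p)) \<partial>(leb t \<Otimes>\<^sub>M M))
    = (\<integral>p. (\<Sum>i\<in>?I. \<Sum>j\<in>?J. of_real (?ind i j (fst p)) * z i j (snd p)) \<partial>(leb t \<Otimes>\<^sub>M M))"
    by (simp only: elementary_value_sum bilinear_sum_scaleR[OF b] z_def
        lo_def hi_def co_def lo'_def hi'_def co'_def)
  also have "\<dots> = (\<Sum>i\<in>?I. \<Sum>j\<in>?J. of_real (len i j) * (\<integral>\<omega>. z i j \<omega> \<partial>M))"
    by (rule integral_double_sum[OF I2 E2])
  finally show ?thesis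
    by (simp add: LHS)
qed

text \<open>The difference of the two integrals is a sum of increments that start no earlier than
  \<open>r\<close>. Their coefficients paired with \<xi> are known at that start, so every summand
  has mean zero.\<close>

theorem elementary_martingale:
  fixes b :: "'a::{real_normed_vector, second_countable_topology}
    \<Rightarrow> 'h::{real_normed_vector, second_countable_topology} \<Rightarrow> complex"
  assumes b: "bounded_bilinear b" and rt: "0 \<le> r" "r \<le> t"
    and H: "elementary_process F H"
    and \<xi>: "\<xi> \<in> borel_measurable (F r)" "sq_integrable M \<xi>"
  shows "(\<integral>\<omega>. b (\<xi> \<omega>) (elementary_integral (W k) t H \<omega>) \<partial>M) =
    (\<integral>\<omega>. b (\<xi> \<omega>) (elementary_integral (W k) r H \<omega>) \<partial>M)"
proof -
  interpret b: bounded_bilinear b by (rule b)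
  note D = elementary_processD[OF H]
  define lo where "lo i = fst (H ! i)" for i
  define hi where "hi i = fst (snd (H ! i))" for i
  define co where "co i = snd (snd (H ! i))" for i
  let ?I = "{..<length H}"
  \<comment> \<open>The part of the interval inside ]r, t], collapsed to a point when it is
    empty.\<close>
  define dI where "dI i = incr k (max r (min (lo i) t)) (max r (min (hi i) t))" for i
  have lohi: "0 \<le> lo i" "lo i \<le> hi i" if "i \<in> ?I" for i
    using D(1,2)[of i] that by (auto simp: lo_def hi_def)
  have zero: "integrable M (\<lambda>\<omega>. b (\<xi> \<omega>) (co i \<omega>) * of_real (dI i \<omega>)) \<and>
    (\<integral>\<omega>. b (\<xi> \<omega>) (co i \<omega>) * of_real (dI i \<omega>) \<partial>M) = 0" if i: "i \<in> ?I" for i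
  proof (cases "lo i \<le> t")
    case True
    let ?a = "max r (min (lo i) t)"
    obtain c where c: "\<forall>\<omega>\<in>space M. norm (co i \<omega>) \<le> c"
      using D(5) i by (metis co_def lessThan_iff)
    have "co i \<in> borel_measurable (F ?a)"
      unfolding co_def
      by (rule F_measurable_mono[OF D(3)]) (use i True lohi[OF i] in \<open>auto simp: lo_def\<close>)
    moreover have "\<xi> \<in> borel_measurable (F ?a)"
      by (rule F_measurable_mono[OF \<xi>(1)]) (use rt in auto)
    ultimately have m: "(\<lambda>\<omega>. b (\<xi> \<omega>) (co i \<omega>)) \<in> borel_measurable (F ?a)"
      by (intro borel_measurable_bilinear[OF b])
    have "sq_integrable M (co i)"
      by (rule sq_integrable_bounded) (use D(4) i c in \<open>auto simp: co_def\<close>)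
    then have i: "integrable M (\<lambda>\<omega>. b (\<xi> \<omega>) (co i \<omega>))"
      by (rule sq_integrable_bilinear[OF b \<xi>(2)])
    have "0 \<le> ?a" "?a \<le> max r (min (hi i) t)"
      using rt lohi[OF \<open>i \<in> ?I\<close>] by (auto simp: le_max_iff_disj min_le_iff_disj)
    then show ?thesis
      unfolding dI_def using integrable_mult_incr[OF _ _ m i] integral_mult_incr[OF _ _ m i] by blast
  next
    case False
    then have "dI i \<omega> = 0" for \<omega>
      using lohi[OF i] by (simp add: dI_def min_absorb2)
    then show ?thesis by simp
  qed
  have diff: "elementary_integral (W k) t H \<omega> - elementary_integral (W k) r H \<omega> = (\<Sum>i\<in>?I. dI i \<omega> *\<^sub>R co i \<omega>)" for \<omega>
  proof -
    have "(W k (min (hi i) t) \<omega> - W k (min (lo i) t) \<omega>) - (W k (min (hi i) r) \<omega> - W k (min (lo i) r) \<omega>) = dI i \<omega>"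
      if "i \<in> ?I" for i
      using lohi[OF that] rt by (auto simp: dI_def incr_def min_def max_def)
    then show ?thesis
      unfolding elementary_integral_sum sum_subtractf[symmetric] lo_def[symmetric] hi_def[symmetric] co_def[symmetric]
        scaleR_left_diff_distrib[symmetric]
      by (intro sum.cong) auto
  qed
  note sq = sq_integrable_elementary_integral[OF H]
  have "(\<integral>\<omega>. b (\<xi> \<omega>) (elementary_integral (W k) t H \<omega>) \<partial>M) - (\<integral>\<omega>. b (\<xi> \<omega>) (elementary_integral (W k) r H \<omega>) \<partial>M)
    = (\<integral>\<omega>. b (\<xi> \<omega>) (elementary_integral (W k) t H \<omega>) - b (\<xi> \<omega>) (elementary_integral (W k) r H \<omega>) \<partial>M)"
    using rt by (intro Bochner_Integration.integral_diff[symmetric] sq_integrable_bilinear[OF b \<xi>(2)] sq) auto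
  also have "\<dots> = (\<integral>\<omega>. (\<Sum>i\<in>?I. b (\<xi> \<omega>) (co i \<omega>) * of_real (dI i \<omega>)) \<partial>M)"
    unfolding b.diff_right[symmetric] diff
    by (simp add: b.sum_right b.scaleR_right scaleR_conv_of_real mult.commute)
  also have "\<dots> = 0"
    using zero by (simp add: Bochner_Integration.integral_sum)
  finally show ?thesis by simp
qed

text \<open>Since intervals may overlap, appending the list with negated coefficients represents the
  difference; no common refinement has to be formed.\<close>

lemma elementary_diff:
  fixes H H' :: "('w, 'h::{real_normed_vector, second_countable_topology}) elementary"
  assumes "elementary_process F H" "elementary_process F H'"
  obtains K where "elementary_process F K"
    "\<And>B t \<omega>. elementary_integral B t K \<omega> = elementary_integral B t H \<omega> - elementary_integral B t H' \<omega>"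
    "\<And>r \<omega>. elementary_value K r \<omega> = elementary_value H r \<omega> - elementary_value H' r \<omega>"
proof
  let ?N = "map (\<lambda>(s, u, \<eta>). (s, u, \<lambda>\<omega>. - \<eta> \<omega>)) H'"
  have "bounded ((\<lambda>\<omega>. - \<eta> \<omega>) ` A) \<longleftrightarrow> bounded (\<eta> ` A)" for \<eta> :: "'w \<Rightarrow> 'h" and A
    by (simp add: bounded_iff)
  then have "elementary_process F ?N"
    using assms(2) unfolding elementary_process_def set_map by (auto simp: case_prod_beta intro!: borel_measurable_uminus)
  with assms(1) show "elementary_process F (H @ ?N)"
    by (simp add: elementary_process_def ball_Un)
  have "elementary_integral B t ?N \<omega> = - elementary_integral B t H' \<omega>" for B t \<omega>
    by (induction H') (auto simp: elementary_integral_def)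
  then show "elementary_integral B t (H @ ?N) \<omega> = elementary_integral B t H \<omega> - elementary_integral B t H' \<omega>" for B t \<omega>
    by (simp add: elementary_integral_def)
  have "elementary_value ?N r \<omega> = - elementary_value H' r \<omega>" for r \<omega>
    by (induction H') (auto simp: elementary_value_def)
  then show "elementary_value (H @ ?N) r \<omega> = elementary_value H r \<omega> - elementary_value H' r \<omega>" for r \<omega>
    by (simp add: elementary_value_def)
qed

end

section \<open>Ito integrals and their sums\<close>

lemma L2_tendsto_uminus:
  fixes f :: "nat \<Rightarrow> 'a \<Rightarrow> 'b::{real_normed_vector, second_countable_topology}"
  assumes "L2_tendsto N f g"
  shows "L2_tendsto N (\<lambda>n x. - f n x) (\<lambda>x. - g x)"
proof -
  have "norm (- f n x - (- g x)) = norm (f n x - g x)" for n x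
    by (metis minus_diff_eq minus_diff_minus norm_minus_cancel)
  then show ?thesis
    using assms sq_integrable_scaleR[of N "f _" "-1"] sq_integrable_scaleR[of N g "-1"]
    by (simp add: L2_tendsto_def)
qed

lemma L2_tendsto_diff:
  fixes f :: "nat \<Rightarrow> 'a \<Rightarrow> 'b::{real_normed_vector, second_countable_topology}"
  assumes "L2_tendsto N f f'" "L2_tendsto N g g'"
  shows "L2_tendsto N (\<lambda>n x. f n x - g n x) (\<lambda>x. f' x - g' x)"
  using L2_tendsto_add[OF assms(1) L2_tendsto_uminus[OF assms(2)]] by simp

context wiener_setting
begin

lemma measurable_F_pair:
  assumes "f \<in> measurable (restrict_space borel {0..t} \<Otimes>\<^sub>M F t) N" "0 \<le> t"
  shows "f \<in> measurable (leb t \<Otimes>\<^sub>M M) N"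
proof -
  have 1: "(\<lambda>p. fst p) \<in> measurable (leb t \<Otimes>\<^sub>M M) (restrict_space borel {0..t})"
    by (rule measurable_compose[OF measurable_fst]) (simp add: measurable_ident_sets sets_leb)
  have 2: "(\<lambda>p. snd p) \<in> measurable (leb t \<Otimes>\<^sub>M M) (F t)"
    by (rule measurable_compose[OF measurable_snd]) (rule F_measurable_M[OF measurable_ident assms(2), unfolded id_def])
  from measurable_compose[OF measurable_Pair[OF 1 2] assms(1)] show ?thesis by simp
qed

text \<open>One sequence \<open>H\<close> serves all shorter horizons too, because shortening the
  time interval can only decrease the error. \<open>ito_martingale\<close> depends on this.\<close>

lemma has_ito_integral_approx:
  fixes \<phi> :: "real \<Rightarrow> 'w \<Rightarrow> 'h::{real_normed_vector, second_countable_topology}"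
  assumes "has_ito_integral M F (W k) t \<phi> J" "0 \<le> t"
  obtains H where "\<And>n. elementary_process F (H n)"
    "\<And>r. 0 \<le> r \<Longrightarrow> r \<le> t \<Longrightarrow>
      L2_tendsto (leb r \<Otimes>\<^sub>M M) (\<lambda>n p. elementary_value (H n) (fst p) (snd p)) (\<lambda>p. \<phi> (fst p) (snd p))"
    "L2_tendsto M (\<lambda>n. elementary_integral (W k) t (H n)) J"
proof -
  obtain H where H: "\<And>n. elementary_process F (H n)"
    and v: "(\<lambda>n. \<integral>\<^sup>+\<omega>. (\<integral>\<^sup>+r\<in>{0..t}. ennreal ((norm (\<phi> r \<omega> - elementary_value (H n) r \<omega>))\<^sup>2) \<partial>lborel) \<partial>M) \<longlonglongrightarrow> 0"
    and i: "(\<lambda>n. \<integral>\<^sup>+\<omega>. ennreal ((norm (J \<omega> - elementary_integral (W k) t (H n) \<omega>))\<^sup>2) \<partial>M) \<longlonglongrightarrow> 0"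
    using assms(1) unfolding has_ito_integral_def by blast
  have J: "J \<in> borel_measurable M" and prog: "progressively_measurable F t \<phi>"
    using assms(1) by (auto simp: has_ito_integral_def)
  show ?thesis
  proof (rule that[OF H])
    show "L2_tendsto M (\<lambda>n. elementary_integral (W k) t (H n)) J"
      by (rule L2_tendstoI_nn[OF sq_integrable_elementary_integral[OF H assms(2)] J i])
    fix r assume r: "0 \<le> r" "r \<le> t"
    interpret P: pair_sigma_finite "leb r" M by (rule pair_leb)
    have "(\<lambda>(r, \<omega>). \<phi> r \<omega>) \<in> borel_measurable (restrict_space borel {0..r} \<Otimes>\<^sub>M F r)"
      using prog r by (auto simp: progressively_measurable_def)
    from measurable_F_pair[OF this r(1)]
    have \<phi>: "(\<lambda>p. \<phi> (fst p) (snd p)) \<in> borel_measurable (leb r \<Otimes>\<^sub>M M)"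
      by (simp add: case_prod_beta)
    have "(\<lambda>n. \<integral>\<^sup>+p. ennreal ((norm (\<phi> (fst p) (snd p) - elementary_value (H n) (fst p) (snd p)))\<^sup>2) \<partial>(leb r \<Otimes>\<^sub>M M)) \<longlonglongrightarrow> 0"
    proof (rule tendsto_sandwich[OF _ _ tendsto_const v])
      have "(\<integral>\<^sup>+p. ennreal ((norm (\<phi> (fst p) (snd p) - elementary_value (H n) (fst p) (snd p)))\<^sup>2) \<partial>(leb r \<Otimes>\<^sub>M M))
        = (\<integral>\<^sup>+\<omega>. (\<integral>\<^sup>+q\<in>{0..r}. ennreal ((norm (\<phi> q \<omega> - elementary_value (H n) q \<omega>))\<^sup>2) \<partial>lborel) \<partial>M)" for n
        using P.nn_integral_snd[of "\<lambda>p. ennreal ((norm (\<phi> (fst p) (snd p) - elementary_value (H n) (fst p) (snd p)))\<^sup>2)"]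
          \<phi> sq_integrable_measurable[OF sq_integrable_elementary_value[OF H]]
        by (simp add: nn_integral_leb)
      also have "\<dots> n \<le> (\<integral>\<^sup>+\<omega>. (\<integral>\<^sup>+q\<in>{0..t}. ennreal ((norm (\<phi> q \<omega> - elementary_value (H n) q \<omega>))\<^sup>2) \<partial>lborel) \<partial>M)" for n
        by (intro nn_integral_mono) (use r in \<open>auto simp: indicator_def\<close>)
      finally show "\<forall>\<^sub>F n in sequentially. (\<integral>\<^sup>+p. ennreal ((norm (\<phi> (fst p) (snd p) - elementary_value (H n) (fst p) (snd p)))\<^sup>2) \<partial>(leb r \<Otimes>\<^sub>M M))
        \<le> (\<integral>\<^sup>+\<omega>. (\<integral>\<^sup>+r\<in>{0..t}. ennreal ((norm (\<phi> r \<omega> - elementary_value (H n) r \<omega>))\<^sup>2) \<partial>lborel) \<partial>M)"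
        by simp
    qed simp
    then show "L2_tendsto (leb r \<Otimes>\<^sub>M M) (\<lambda>n p. elementary_value (H n) (fst p) (snd p)) (\<lambda>p. \<phi> (fst p) (snd p))"
      by (intro L2_tendstoI_nn[OF sq_integrable_elementary_value[OF H] \<phi>])
  qed
qed

lemma has_ito_integral_sq_integrable:
  fixes \<phi> :: "real \<Rightarrow> 'w \<Rightarrow> 'h::{real_normed_vector, second_countable_topology}"
  assumes "has_ito_integral M F (W k) t \<phi> J" "0 \<le> t"
  shows "sq_integrable M J" "sq_integrable (leb t \<Otimes>\<^sub>M M) (\<lambda>p. \<phi> (fst p) (snd p))"
proof -
  obtain H where H: "\<And>n. elementary_process F (H n)"
    "\<And>q. 0 \<le> q \<Longrightarrow> q \<le> t \<Longrightarrow>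
      L2_tendsto (leb q \<Otimes>\<^sub>M M) (\<lambda>n p. elementary_value (H n) (fst p) (snd p)) (\<lambda>p. \<phi> (fst p) (snd p))"
    "L2_tendsto M (\<lambda>n. elementary_integral (W k) t (H n)) J"
    by (rule has_ito_integral_approx[OF assms]) (rule that)
  show "sq_integrable M J" "sq_integrable (leb t \<Otimes>\<^sub>M M) (\<lambda>p. \<phi> (fst p) (snd p))"
    using L2_tendstoD(2)[OF H(3)] L2_tendstoD(2)[OF H(2)[OF assms(2) order_refl]] by auto
qed

lemma ito_isometry:
  fixes b :: "'h::{real_normed_vector, second_countable_topology} \<Rightarrow> 'h \<Rightarrow> complex"
  assumes b: "bounded_bilinear b" and t: "0 \<le> t"
    and J: "has_ito_integral M F (W k) t \<phi> J" and J': "has_ito_integral M F (W l) t \<psi> J'"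
  shows "(\<integral>\<omega>. b (J \<omega>) (J' \<omega>) \<partial>M) =
    (if k = l then \<integral>p. b (\<phi> (fst p) (snd p)) (\<psi> (fst p) (snd p)) \<partial>(leb t \<Otimes>\<^sub>M M) else 0)"
proof -
  obtain H where H: "\<And>n. elementary_process F (H n)"
    "\<And>q. 0 \<le> q \<Longrightarrow> q \<le> t \<Longrightarrow>
      L2_tendsto (leb q \<Otimes>\<^sub>M M) (\<lambda>n p. elementary_value (H n) (fst p) (snd p)) (\<lambda>p. \<phi> (fst p) (snd p))"
    "L2_tendsto M (\<lambda>n. elementary_integral (W k) t (H n)) J"
    by (rule has_ito_integral_approx[OF J t]) (rule that)
  obtain H' where H': "\<And>n. elementary_process F (H' n)"
    "\<And>q. 0 \<le> q \<Longrightarrow> q \<le> t \<Longrightarrow>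
      L2_tendsto (leb q \<Otimes>\<^sub>M M) (\<lambda>n p. elementary_value (H' n) (fst p) (snd p)) (\<lambda>p. \<psi> (fst p) (snd p))"
    "L2_tendsto M (\<lambda>n. elementary_integral (W l) t (H' n)) J'"
    by (rule has_ito_integral_approx[OF J' t]) (rule that)
  have "(\<lambda>n. \<integral>\<omega>. b (elementary_integral (W k) t (H n) \<omega>) (elementary_integral (W l) t (H' n) \<omega>) \<partial>M)
    \<longlonglongrightarrow> (\<integral>\<omega>. b (J \<omega>) (J' \<omega>) \<partial>M)"
    by (rule tendsto_integral_bilinear[OF b H(3) H'(3)])
  moreover have "(\<lambda>n. \<integral>\<omega>. b (elementary_integral (W k) t (H n) \<omega>) (elementary_integral (W l) t (H' n) \<omega>) \<partial>M)
    \<longlonglongrightarrow> (if k = l then \<integral>p. b (\<phi> (fst p) (snd p)) (\<psi> (fst p) (snd p)) \<partial>(leb t \<Otimes>\<^sub>M M) else 0)"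
    unfolding elementary_isometry[OF b t H(1) H'(1)]
    using tendsto_integral_bilinear[OF b H(2)[OF t order_refl] H'(2)[OF t order_refl]] by (cases "k = l") simp_all
  ultimately show ?thesis
    by (rule LIMSEQ_unique)
qed

text \<open>This is the polarised isometry for the inner product; it is the place where the values
  have to lie in a Hilbert space.\<close>

lemma elementary_isometry_norm:
  fixes H :: "('w, 'h::{complex_hilbert_space, second_countable_topology}) elementary"
  assumes H: "elementary_process F H" and t: "0 \<le> t"
  shows "(\<integral>\<omega>. (norm (elementary_integral (W k) t H \<omega>))\<^sup>2 \<partial>M) =
    (\<integral>p. (norm (elementary_value H (fst p) (snd p)))\<^sup>2 \<partial>(leb t \<Otimes>\<^sub>M M))"
proof -
  have "complex_of_real (\<integral>\<omega>. (norm (elementary_integral (W k) t H \<omega>))\<^sup>2 \<partial>M) =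
    complex_of_real (\<integral>p. (norm (elementary_value H (fst p) (snd p)))\<^sup>2 \<partial>(leb t \<Otimes>\<^sub>M M))"
    using elementary_isometry[OF bounded_bilinear_cinner t H H, of k k]
      sq_integrable_elementary_integral[OF H t, of k] sq_integrable_elementary_value[OF H, of t]
    by (simp add: cinner_self sq_integrable_def integral_of_real del: of_real_power)
  then show ?thesis by (simp only: of_real_eq_iff)
qed

text \<open>\<open>J\<close> and \<open>J'\<close> come with unrelated approximations
  \<open>H\<close> and \<open>H'\<close>. Both approximate \<phi> on [0, r], so their difference
  tends to zero there, and by the isometry so do the integrals of the difference up to
  \<open>r\<close>. Hence \<open>J'\<close> is also the limit of the integrals of \<open>H\<close>
  up to \<open>r\<close>, and the elementary martingale property of the single sequence
  \<open>H\<close> can be passed to the limit.\<close>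

lemma ito_martingale:
  fixes b :: "'a::{real_normed_vector, second_countable_topology}
    \<Rightarrow> 'h::{complex_hilbert_space, second_countable_topology} \<Rightarrow> complex"
  assumes b: "bounded_bilinear b" and rt: "0 \<le> r" "r \<le> t"
    and J: "has_ito_integral M F (W k) t \<phi> J" and J': "has_ito_integral M F (W k) r \<phi> J'"
    and \<xi>: "\<xi> \<in> borel_measurable (F r)" "sq_integrable M \<xi>"
  shows "(\<integral>\<omega>. b (\<xi> \<omega>) (J \<omega>) \<partial>M) = (\<integral>\<omega>. b (\<xi> \<omega>) (J' \<omega>) \<partial>M)"
proof -
  have t: "0 \<le> t" using rt by simp
  obtain H where H: "\<And>n. elementary_process F (H n)"
    "\<And>q. 0 \<le> q \<Longrightarrow> q \<le> t \<Longrightarrow>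
      L2_tendsto (leb q \<Otimes>\<^sub>M M) (\<lambda>n p. elementary_value (H n) (fst p) (snd p)) (\<lambda>p. \<phi> (fst p) (snd p))"
    "L2_tendsto M (\<lambda>n. elementary_integral (W k) t (H n)) J"
    by (rule has_ito_integral_approx[OF J t]) (rule that)
  obtain H' where H': "\<And>n. elementary_process F (H' n)"
    "\<And>q. 0 \<le> q \<Longrightarrow> q \<le> r \<Longrightarrow>
      L2_tendsto (leb q \<Otimes>\<^sub>M M) (\<lambda>n p. elementary_value (H' n) (fst p) (snd p)) (\<lambda>p. \<phi> (fst p) (snd p))"
    "L2_tendsto M (\<lambda>n. elementary_integral (W k) r (H' n)) J'"
    by (rule has_ito_integral_approx[OF J' rt(1)]) (rule that)
  have "\<exists>K. elementary_process F K
    \<and> (\<forall>\<omega>. elementary_integral (W k) r K \<omega> = elementary_integral (W k) r (H n) \<omega> - elementary_integral (W k) r (H' n) \<omega>)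
    \<and> (\<forall>q \<omega>. elementary_value K q \<omega> = elementary_value (H n) q \<omega> - elementary_value (H' n) q \<omega>)" for n
    using elementary_diff[OF H(1)[of n] H'(1)[of n]] by metis
  then obtain K where K: "\<And>n. elementary_process F (K n)"
    "\<And>n \<omega>. elementary_integral (W k) r (K n) \<omega> = elementary_integral (W k) r (H n) \<omega> - elementary_integral (W k) r (H' n) \<omega>"
    "\<And>n q \<omega>. elementary_value (K n) q \<omega> = elementary_value (H n) q \<omega> - elementary_value (H' n) q \<omega>"
    by metis
  have "(\<lambda>n. \<integral>p. (norm (elementary_value (K n) (fst p) (snd p)))\<^sup>2 \<partial>(leb r \<Otimes>\<^sub>M M)) \<longlonglongrightarrow> 0"
    using L2_tendstoD(3)[OF L2_tendsto_diff[OF H(2)[OF rt] H'(2)[OF rt(1) order_refl]]] by (simp add: K(3))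
  then have "L2_tendsto M (\<lambda>n. elementary_integral (W k) r (K n)) (\<lambda>_. 0)"
    by (simp add: L2_tendsto_def sq_integrable_elementary_integral[OF K(1) rt(1)] elementary_isometry_norm[OF K(1) rt(1)] sq_integrable_zero)
  from L2_tendsto_add[OF this H'(3)]
  have Hr: "L2_tendsto M (\<lambda>n. elementary_integral (W k) r (H n)) J'"
    by (simp add: K(2))
  have "(\<lambda>n. \<integral>\<omega>. b (\<xi> \<omega>) (elementary_integral (W k) t (H n) \<omega>) \<partial>M) \<longlonglongrightarrow> (\<integral>\<omega>. b (\<xi> \<omega>) (J \<omega>) \<partial>M)"
    by (rule tendsto_integral_bilinear[OF b L2_tendsto_const[OF \<xi>(2)] H(3)])
  moreover have "(\<lambda>n. \<integral>\<omega>. b (\<xi> \<omega>) (elementary_integral (W k) t (H n) \<omega>) \<partial>M) \<longlonglongrightarrow> (\<integral>\<omega>. b (\<xi> \<omega>) (J' \<omega>) \<partial>M)"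
    unfolding elementary_martingale[OF b rt H(1) \<xi>]
    by (rule tendsto_integral_bilinear[OF b L2_tendsto_const[OF \<xi>(2)] Hr])
  ultimately show ?thesis
    by (rule LIMSEQ_unique)
qed

text \<open>The martingale property from time 0, where elementary integrals vanish because no
  interval begins before 0.\<close>

lemma ito_integral_orthogonal_F0:
  fixes b :: "'a::{real_normed_vector, second_countable_topology}
    \<Rightarrow> 'h::{real_normed_vector, second_countable_topology} \<Rightarrow> complex"
  assumes b: "bounded_bilinear b" and t: "0 \<le> t"
    and J: "has_ito_integral M F (W k) t \<phi> J"
    and \<xi>: "\<xi> \<in> borel_measurable (F 0)" "sq_integrable M \<xi>"
  shows "(\<integral>\<omega>. b (\<xi> \<omega>) (J \<omega>) \<partial>M) = 0"
proof -
  obtain H where H: "\<And>n. elementary_process F (H n)"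
    "\<And>q. 0 \<le> q \<Longrightarrow> q \<le> t \<Longrightarrow>
      L2_tendsto (leb q \<Otimes>\<^sub>M M) (\<lambda>n p. elementary_value (H n) (fst p) (snd p)) (\<lambda>p. \<phi> (fst p) (snd p))"
    "L2_tendsto M (\<lambda>n. elementary_integral (W k) t (H n)) J"
    by (rule has_ito_integral_approx[OF J t]) (rule that)
  have "elementary_integral (W k) 0 (H n) \<omega> = 0" for n \<omega>
    unfolding elementary_integral_sum
    using elementary_processD(1,2)[OF H(1)] by (intro sum.neutral) (force simp: min_absorb2)
  then have "(\<integral>\<omega>. b (\<xi> \<omega>) (elementary_integral (W k) t (H n) \<omega>) \<partial>M) = 0" for n
    using elementary_martingale[OF b order_refl t H(1) \<xi>]
    by (simp add: bounded_bilinear.zero_right[OF b])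
  with tendsto_integral_bilinear[OF b L2_tendsto_const[OF \<xi>(2)] H(3)] show ?thesis
    by (simp add: LIMSEQ_const_iff)
qed

section \<open>Series of Ito integrals against the independent Wiener processes\<close>

definition ito_sum ::
  "real \<Rightarrow> (nat \<Rightarrow> real \<Rightarrow> 'w \<Rightarrow> 'h::{complex_hilbert_space, second_countable_topology}) \<Rightarrow> ('w \<Rightarrow> 'h) \<Rightarrow> bool"
  where "ito_sum t \<Phi> S \<longleftrightarrow>
    (\<exists>J. (\<forall>k. has_ito_integral M F (W k) t (\<Phi> k) (J k)) \<and> L2_tendsto M (\<lambda>n \<omega>. \<Sum>k<n. J k \<omega>) S)"

lemma ito_sum_sq_integrable: "ito_sum t \<Phi> S \<Longrightarrow> sq_integrable M S"
  by (auto simp: ito_sum_def dest: L2_tendstoD(2))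

lemma ito_sum_integrand_sq_integrable:
  "ito_sum t \<Phi> S \<Longrightarrow> 0 \<le> t \<Longrightarrow> sq_integrable (leb t \<Otimes>\<^sub>M M) (\<lambda>p. \<Phi> k (fst p) (snd p))"
  unfolding ito_sum_def using has_ito_integral_sq_integrable(2) by blast

lemma tendsto_integral_bilinear_sum:
  fixes b :: "'a::{real_normed_vector, second_countable_topology}
    \<Rightarrow> 'h::{real_normed_vector, second_countable_topology} \<Rightarrow> complex"
  assumes b: "bounded_bilinear b" and \<xi>: "sq_integrable M \<xi>"
    and J: "\<And>k. sq_integrable M (J k)" "L2_tendsto M (\<lambda>n \<omega>. \<Sum>k<n. J k \<omega>) S"
  shows "(\<lambda>n. \<Sum>k<n. \<integral>\<omega>. b (\<xi> \<omega>) (J k \<omega>) \<partial>M) \<longlonglongrightarrow> (\<integral>\<omega>. b (\<xi> \<omega>) (S \<omega>) \<partial>M)"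
proof -
  interpret b: bounded_bilinear b by (rule b)
  have "(\<integral>\<omega>. b (\<xi> \<omega>) (\<Sum>k<n. J k \<omega>) \<partial>M) = (\<Sum>k<n. \<integral>\<omega>. b (\<xi> \<omega>) (J k \<omega>) \<partial>M)" for n
    unfolding b.sum_right by (intro Bochner_Integration.integral_sum sq_integrable_bilinear[OF b \<xi> J(1)])
  with tendsto_integral_bilinear[OF b L2_tendsto_const[OF \<xi>] J(2)] show ?thesis
    by simp
qed

lemma ito_sum_martingale:
  fixes b :: "'a::{real_normed_vector, second_countable_topology}
    \<Rightarrow> 'h::{complex_hilbert_space, second_countable_topology} \<Rightarrow> complex"
  assumes b: "bounded_bilinear b" and rt: "0 \<le> r" "r \<le> t"
    and S: "ito_sum t \<Phi> S" and S': "ito_sum r \<Phi> S'"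
    and \<xi>: "\<xi> \<in> borel_measurable (F r)" "sq_integrable M \<xi>"
  shows "(\<integral>\<omega>. b (\<xi> \<omega>) (S \<omega>) \<partial>M) = (\<integral>\<omega>. b (\<xi> \<omega>) (S' \<omega>) \<partial>M)"
proof -
  have t: "0 \<le> t" using rt by simp
  obtain J J' where J: "\<And>k. has_ito_integral M F (W k) t (\<Phi> k) (J k)" "L2_tendsto M (\<lambda>n \<omega>. \<Sum>k<n. J k \<omega>) S"
    and J': "\<And>k. has_ito_integral M F (W k) r (\<Phi> k) (J' k)" "L2_tendsto M (\<lambda>n \<omega>. \<Sum>k<n. J' k \<omega>) S'"
    using S S' by (auto simp: ito_sum_def)
  show ?thesis
    using tendsto_integral_bilinear_sum[OF b \<xi>(2) has_ito_integral_sq_integrable(1)[OF J(1) t] J(2)]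
      tendsto_integral_bilinear_sum[OF b \<xi>(2) has_ito_integral_sq_integrable(1)[OF J'(1) rt(1)] J'(2)]
    unfolding ito_martingale[OF b rt J(1) J'(1) \<xi>] by (rule LIMSEQ_unique)
qed

lemma ito_sum_orthogonal_F0:
  fixes b :: "'a::{real_normed_vector, second_countable_topology}
    \<Rightarrow> 'h::{complex_hilbert_space, second_countable_topology} \<Rightarrow> complex"
  assumes b: "bounded_bilinear b" and t: "0 \<le> t" and S: "ito_sum t \<Phi> S"
    and \<xi>: "\<xi> \<in> borel_measurable (F 0)" "sq_integrable M \<xi>"
  shows "(\<integral>\<omega>. b (\<xi> \<omega>) (S \<omega>) \<partial>M) = 0"
proof -
  obtain J where J: "\<And>k. has_ito_integral M F (W k) t (\<Phi> k) (J k)" "L2_tendsto M (\<lambda>n \<omega>. \<Sum>k<n. J k \<omega>) S"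
    using S by (auto simp: ito_sum_def)
  show ?thesis
    using tendsto_integral_bilinear_sum[OF b \<xi>(2) has_ito_integral_sq_integrable(1)[OF J(1) t] J(2)]
    by (simp add: ito_integral_orthogonal_F0[OF b t J(1) \<xi>] LIMSEQ_const_iff)
qed

text \<open>Orthogonality of integrals against different processes leaves the diagonal of the double
  sum. The conclusion stays a limit of partial sums so that \<open>solution_ito_formula\<close> can
  identify it with a limit obtained by dominated convergence.\<close>

lemma ito_sum_isometry:
  fixes b :: "'h::{complex_hilbert_space, second_countable_topology} \<Rightarrow> 'h \<Rightarrow> complex"
  assumes b: "bounded_bilinear b" and t: "0 \<le> t" and S: "ito_sum t \<Phi> S" and S': "ito_sum t \<Psi> S'"
  shows "(\<lambda>n. \<Sum>k<n. \<integral>p. b (\<Phi> k (fst p) (snd p)) (\<Psi> k (fst p) (snd p)) \<partial>(leb t \<Otimes>\<^sub>M M))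
    \<longlonglongrightarrow> (\<integral>\<omega>. b (S \<omega>) (S' \<omega>) \<partial>M)"
proof -
  interpret b: bounded_bilinear b by (rule b)
  obtain J J' where J: "\<And>k. has_ito_integral M F (W k) t (\<Phi> k) (J k)" "L2_tendsto M (\<lambda>n \<omega>. \<Sum>k<n. J k \<omega>) S"
    and J': "\<And>k. has_ito_integral M F (W k) t (\<Psi> k) (J' k)" "L2_tendsto M (\<lambda>n \<omega>. \<Sum>k<n. J' k \<omega>) S'"
    using S S' by (auto simp: ito_sum_def)
  have "(\<integral>\<omega>. b (\<Sum>k<n. J k \<omega>) (\<Sum>k<n. J' k \<omega>) \<partial>M)
    = (\<Sum>k<n. \<integral>p. b (\<Phi> k (fst p) (snd p)) (\<Psi> k (fst p) (snd p)) \<partial>(leb t \<Otimes>\<^sub>M M))" for n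
  proof -
    have "(\<integral>\<omega>. b (\<Sum>k<n. J k \<omega>) (\<Sum>k<n. J' k \<omega>) \<partial>M) = (\<integral>\<omega>. (\<Sum>k<n. \<Sum>l<n. b (J k \<omega>) (J' l \<omega>)) \<partial>M)"
      by (simp only: b.sum_left) (simp only: b.sum_right)
    also have "\<dots> = (\<Sum>k<n. \<Sum>l<n. if k = l then
        \<integral>p. b (\<Phi> k (fst p) (snd p)) (\<Psi> l (fst p) (snd p)) \<partial>(leb t \<Otimes>\<^sub>M M) else 0)"
      by (intro integral_double_sum sq_integrable_bilinear[OF b] ito_isometry[OF b t J(1) J'(1)]
          has_ito_integral_sq_integrable(1)[OF J(1) t] has_ito_integral_sq_integrable(1)[OF J'(1) t])
    finally show ?thesis by simp
  qed
  with tendsto_integral_bilinear[OF b J(2) J'(2)] show ?thesis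
    by simp
qed

end

section \<open>The Ito formula in expectation\<close>

lemma sigma_finite_leb: "sigma_finite_measure (leb t)"
  by (intro finite_measure.axioms finite_measure_leb)

lemma pair_leb_leb: "pair_sigma_finite (leb s) (leb t)"
  by (intro pair_sigma_finite.intro sigma_finite_leb)

text \<open>The square is cut along its diagonal. Both triangles are written with the inner variable
  below the outer one, the shape in which a drift at time \<open>r\<close> meets the other drift
  accumulated up to \<open>r\<close>.\<close>

lemma integral_triangle:
  fixes c :: "real \<Rightarrow> real \<Rightarrow> 'b::{banach, second_countable_topology}"
  assumes c: "integrable (leb t \<Otimes>\<^sub>M leb t) (\<lambda>p. c (fst p) (snd p))"
  shows "integrable (leb t) (\<lambda>r. \<integral>q. c r q \<partial>leb r)"
    and "integrable (leb t) (\<lambda>r. \<integral>q. c q r \<partial>leb r)"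
    and "(\<integral>r. (\<integral>q. c r q \<partial>leb t) \<partial>leb t) =
      (\<integral>r. (\<integral>q. c r q \<partial>leb r) \<partial>leb t) + (\<integral>r. (\<integral>q. c q r \<partial>leb r) \<partial>leb t)"
proof -
  interpret P: pair_sigma_finite "leb t" "leb t" by (rule pair_leb_leb)
  have [measurable]: "(\<lambda>p. c (fst p) (snd p)) \<in> borel_measurable (leb t \<Otimes>\<^sub>M leb t)"
    using c by (rule borel_measurable_integrable)
  have [measurable]: "fst \<in> borel_measurable (leb t \<Otimes>\<^sub>M leb t)" "snd \<in> borel_measurable (leb t \<Otimes>\<^sub>M leb t)"
    by (rule measurable_compose[OF measurable_fst measurable_leb_id]
        measurable_compose[OF measurable_snd measurable_leb_id])+
  let ?f = "\<lambda>r q. if q \<le> r then c r q else 0" and ?g = "\<lambda>r q. if r < q then c r q else 0"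
  have f: "integrable (leb t \<Otimes>\<^sub>M leb t) (\<lambda>p. ?f (fst p) (snd p))"
    by (rule Bochner_Integration.integrable_bound[OF c]) auto
  have g: "integrable (leb t \<Otimes>\<^sub>M leb t) (\<lambda>p. ?g (fst p) (snd p))"
    by (rule Bochner_Integration.integrable_bound[OF c]) auto
  have g': "integrable (leb t \<Otimes>\<^sub>M leb t) (\<lambda>p. ?g (snd p) (fst p))"
    using P.integrable_product_swap[OF g] by (simp only: case_prod_unfold fst_conv snd_conv)
  have f_eq: "(\<integral>q. ?f r q \<partial>leb t) = (\<integral>q. c r q \<partial>leb r)" if "r \<in> space (leb t)" for r
    using that unfolding integral_leb set_lebesgue_integral_def
    by (intro Bochner_Integration.integral_cong) (auto simp: indicator_def)
  \<comment> \<open>The strict inequality yields [0, r[, which differs from [0, r] by a null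
    point.\<close>
  have g_eq: "(\<integral>q. ?g q r \<partial>leb t) = (\<integral>q. c q r \<partial>leb r)" if r: "r \<in> space (leb t)" for r
  proof -
    have "(\<integral>q. ?g q r \<partial>leb t) = (\<integral>q. indicat_real {0..<r} q *\<^sub>R c q r \<partial>lborel)"
      using that unfolding integral_leb set_lebesgue_integral_def
      by (intro Bochner_Integration.integral_cong) (auto simp: indicator_def)
    also have "\<dots> = (\<integral>q. c q r \<partial>leb r)"
      unfolding integral_leb set_lebesgue_integral_def
      by (rule integral_discrete_difference[of "{r}"]) (auto simp: indicator_def)
    finally show ?thesis .
  qed
  have "integrable (leb t) (\<lambda>r. \<integral>q. ?f r q \<partial>leb t)"
    using P.integrable_fst'[OF f] by (simp only: fst_conv snd_conv)
  then show "integrable (leb t) (\<lambda>r. \<integral>q. c r q \<partial>leb r)"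
    by (simp only: f_eq cong: Bochner_Integration.integrable_cong)
  have "integrable (leb t) (\<lambda>r. \<integral>q. ?g q r \<partial>leb t)"
    using P.integrable_fst'[OF g'] by (simp only: fst_conv snd_conv)
  then show "integrable (leb t) (\<lambda>r. \<integral>q. c q r \<partial>leb r)"
    by (simp only: g_eq cong: Bochner_Integration.integrable_cong)
  have "(\<integral>r. (\<integral>q. c r q \<partial>leb t) \<partial>leb t) = (\<integral>p. c (fst p) (snd p) \<partial>(leb t \<Otimes>\<^sub>M leb t))"
    using P.integral_fst'[OF c] by simp
  also have "\<dots> = (\<integral>p. ?f (fst p) (snd p) + ?g (fst p) (snd p) \<partial>(leb t \<Otimes>\<^sub>M leb t))"
    by (intro Bochner_Integration.integral_cong) auto
  also have "\<dots> = (\<integral>p. ?f (fst p) (snd p) \<partial>(leb t \<Otimes>\<^sub>M leb t)) + (\<integral>p. ?g (fst p) (snd p) \<partial>(leb t \<Otimes>\<^sub>M leb t))"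
    by (rule Bochner_Integration.integral_add[OF f g])
  also have "(\<integral>p. ?f (fst p) (snd p) \<partial>(leb t \<Otimes>\<^sub>M leb t)) = (\<integral>r. (\<integral>q. c r q \<partial>leb r) \<partial>leb t)"
    using P.integral_fst'[OF f] unfolding fst_conv snd_conv
    by (simp only: f_eq cong: Bochner_Integration.integral_cong)
  also have "(\<integral>p. ?g (fst p) (snd p) \<partial>(leb t \<Otimes>\<^sub>M leb t)) = (\<integral>p. ?g (snd p) (fst p) \<partial>(leb t \<Otimes>\<^sub>M leb t))"
    using P.integral_product_swap[OF borel_measurable_integrable[OF g]]
    by (simp only: case_prod_unfold fst_conv snd_conv)
  also have "\<dots> = (\<integral>r. (\<integral>q. c q r \<partial>leb r) \<partial>leb t)"
    using P.integral_fst'[OF g'] unfolding fst_conv snd_conv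
    by (simp only: g_eq cong: Bochner_Integration.integral_cong)
  finally show "(\<integral>r. (\<integral>q. c r q \<partial>leb t) \<partial>leb t) =
      (\<integral>r. (\<integral>q. c r q \<partial>leb r) \<partial>leb t) + (\<integral>r. (\<integral>q. c q r \<partial>leb r) \<partial>leb t)" .
qed

context wiener_setting
begin

lemma sq_integrable_snd:
  fixes \<xi> :: "'w \<Rightarrow> 'b::{real_normed_vector, second_countable_topology}"
  assumes "sq_integrable M \<xi>"
  shows "sq_integrable (leb t \<Otimes>\<^sub>M M) (\<lambda>p. \<xi> (snd p))"
  unfolding sq_integrable_iff_nn
proof
  have [measurable]: "\<xi> \<in> borel_measurable M" using assms by auto
  show "(\<lambda>p. \<xi> (snd p)) \<in> borel_measurable (leb t \<Otimes>\<^sub>M M)" by measurable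
  have "(\<integral>\<^sup>+p. ennreal ((norm (\<xi> (snd p)))\<^sup>2) \<partial>(leb t \<Otimes>\<^sub>M M))
    = (\<integral>\<^sup>+r. (\<integral>\<^sup>+\<omega>. ennreal ((norm (\<xi> \<omega>))\<^sup>2) \<partial>M) \<partial>leb t)"
    by (subst nn_integral_fst[symmetric]) simp_all
  also have "\<dots> < \<infinity>"
    using assms finite_measure.emeasure_finite[OF finite_measure_leb, of t "{0..t}"]
    by (simp add: sq_integrable_iff_nn ennreal_mult_less_top less_top)
  finally show "(\<integral>\<^sup>+p. ennreal ((norm (\<xi> (snd p)))\<^sup>2) \<partial>(leb t \<Otimes>\<^sub>M M)) < \<infinity>" .
qed

lemma sq_integrable_pairI:
  fixes g :: "real \<Rightarrow> 'w \<Rightarrow> 'b::{real_normed_vector, second_countable_topology}"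
  assumes m: "(\<lambda>p. g (fst p) (snd p)) \<in> borel_measurable (leb t \<Otimes>\<^sub>M M)"
    and g: "\<And>r. 0 \<le> r \<Longrightarrow> r \<le> t \<Longrightarrow> sq_integrable M (g r)"
    and K: "\<And>r. 0 \<le> r \<Longrightarrow> r \<le> t \<Longrightarrow> (\<integral>\<omega>. (norm (g r \<omega>))\<^sup>2 \<partial>M) \<le> K"
  shows "sq_integrable (leb t \<Otimes>\<^sub>M M) (\<lambda>p. g (fst p) (snd p))"
  unfolding sq_integrable_iff_nn
proof
  have "(\<integral>\<^sup>+p. ennreal ((norm (g (fst p) (snd p)))\<^sup>2) \<partial>(leb t \<Otimes>\<^sub>M M))
    = (\<integral>\<^sup>+r. (\<integral>\<^sup>+\<omega>. ennreal ((norm (g r \<omega>))\<^sup>2) \<partial>M) \<partial>leb t)"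
    using m by (subst nn_integral_fst[symmetric]) simp_all
  also have "\<dots> \<le> (\<integral>\<^sup>+r. ennreal K \<partial>leb t)"
  proof (rule nn_integral_mono)
    fix r assume "r \<in> space (leb t)"
    then show "(\<integral>\<^sup>+\<omega>. ennreal ((norm (g r \<omega>))\<^sup>2) \<partial>M) \<le> ennreal K"
      using g[of r] K[of r] by (subst nn_integral_eq_integral) (auto simp: sq_integrable_def ennreal_leI)
  qed
  also have "\<dots> < \<infinity>"
    using finite_measure.emeasure_finite[OF finite_measure_leb, of t "{0..t}"]
    by (simp add: ennreal_mult_less_top less_top)
  finally show "(\<integral>\<^sup>+p. ennreal ((norm (g (fst p) (snd p)))\<^sup>2) \<partial>(leb t \<Otimes>\<^sub>M M)) < \<infinity>" .
qed fact

lemma measurable_integral_leb: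
  fixes g :: "real \<Rightarrow> 'w \<Rightarrow> 'b::{banach, second_countable_topology}"
  assumes "(\<lambda>p. g (fst p) (snd p)) \<in> borel_measurable (leb t \<Otimes>\<^sub>M M)"
  shows "(\<lambda>\<omega>. \<integral>r. g r \<omega> \<partial>leb t) \<in> borel_measurable M"
proof -
  have "(\<lambda>(\<omega>, r). g r \<omega>) \<in> borel_measurable (M \<Otimes>\<^sub>M leb t)"
    using measurable_compose[OF measurable_pair_swap' assms] by (simp add: case_prod_unfold)
  then show ?thesis
    by (rule sigma_finite_measure.borel_measurable_lebesgue_integral[OF sigma_finite_leb])
qed

lemma expectation_bilinear_integral:
  fixes b :: "'a::{real_normed_vector, second_countable_topology}
    \<Rightarrow> 'h::{banach, second_countable_topology} \<Rightarrow> 'c::{banach, second_countable_topology}"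
  assumes b: "bounded_bilinear b" and \<xi>: "sq_integrable M \<xi>"
    and g: "sq_integrable (leb t \<Otimes>\<^sub>M M) (\<lambda>p. g (fst p) (snd p))"
  shows "integrable (leb t) (\<lambda>r. \<integral>\<omega>. b (\<xi> \<omega>) (g r \<omega>) \<partial>M)"
    and "(\<integral>\<omega>. b (\<xi> \<omega>) (\<integral>r. g r \<omega> \<partial>leb t) \<partial>M) = (\<integral>r. (\<integral>\<omega>. b (\<xi> \<omega>) (g r \<omega>) \<partial>M) \<partial>leb t)"
proof -
  interpret b: bounded_bilinear b by (rule b)
  interpret P: pair_sigma_finite "leb t" M by (rule pair_leb)
  interpret Q: pair_sigma_finite M "leb t" ..
  have int: "integrable (leb t \<Otimes>\<^sub>M M) (\<lambda>p. b (\<xi> (snd p)) (g (fst p) (snd p)))"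
    by (rule sq_integrable_bilinear[OF b sq_integrable_snd[OF \<xi>] g])
  from P.integrable_fst'[OF this] show "integrable (leb t) (\<lambda>r. \<integral>\<omega>. b (\<xi> \<omega>) (g r \<omega>) \<partial>M)"
    by simp
  have one: "sq_integrable (leb t \<Otimes>\<^sub>M M) (\<lambda>_. 1 :: real)"
    using sq_integrable_snd[OF sq_integrable_bounded[of "\<lambda>_. 1 :: real" 1]] by simp
  have "integrable (leb t \<Otimes>\<^sub>M M) (\<lambda>p. g (fst p) (snd p))"
    using sq_integrable_bilinear[OF bounded_bilinear_scaleR one g] by simp
  \<comment> \<open>The form can be moved inside the time integral only on paths along which
    \<open>g\<close> is integrable. On the remaining null set the Bochner integral takes its default
    value.\<close>
  from Q.AE_integrable_fst'[OF P.integrable_product_swap[OF this]]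
  have ae: "AE \<omega> in M. integrable (leb t) (\<lambda>r. g r \<omega>)"
    by simp
  have m: "(\<lambda>p. g (fst p) (snd p)) \<in> borel_measurable (leb t \<Otimes>\<^sub>M M)"
    using g by (rule sq_integrable_measurable)
  have "(\<integral>\<omega>. b (\<xi> \<omega>) (\<integral>r. g r \<omega> \<partial>leb t) \<partial>M) = (\<integral>\<omega>. (\<integral>r. b (\<xi> \<omega>) (g r \<omega>) \<partial>leb t) \<partial>M)"
  proof (rule integral_cong_AE)
    show "(\<lambda>\<omega>. b (\<xi> \<omega>) (\<integral>r. g r \<omega> \<partial>leb t)) \<in> borel_measurable M"
      by (intro borel_measurable_bilinear[OF b] sq_integrable_measurable[OF \<xi>] measurable_integral_leb m)
    show "(\<lambda>\<omega>. \<integral>r. b (\<xi> \<omega>) (g r \<omega>) \<partial>leb t) \<in> borel_measurable M"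
      using measurable_integral_leb[where g = "\<lambda>r \<omega>. b (\<xi> \<omega>) (g r \<omega>)", OF borel_measurable_integrable[OF int]] .
    show "AE \<omega> in M. b (\<xi> \<omega>) (\<integral>r. g r \<omega> \<partial>leb t) = (\<integral>r. b (\<xi> \<omega>) (g r \<omega>) \<partial>leb t)"
      using ae by eventually_elim (rule integral_bounded_linear[OF b.bounded_linear_right, symmetric])
  qed
  also have "\<dots> = (\<integral>r. (\<integral>\<omega>. b (\<xi> \<omega>) (g r \<omega>) \<partial>M) \<partial>leb t)"
    by (rule P.Fubini_integral) (use int in \<open>simp add: case_prod_unfold\<close>)
  finally show "(\<integral>\<omega>. b (\<xi> \<omega>) (\<integral>r. g r \<omega> \<partial>leb t) \<partial>M) = (\<integral>r. (\<integral>\<omega>. b (\<xi> \<omega>) (g r \<omega>) \<partial>M) \<partial>leb t)" .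
qed

text \<open>Only identities at fixed times are recorded, with a null set and a noise term chosen
  separately for each \<open>t\<close>; this is enough for expectations. The uniform constant
  \<open>K\<close> makes the drift square integrable jointly in time and chance.\<close>

definition ito_process ::
  "real \<Rightarrow> 'h \<Rightarrow> (real \<Rightarrow> 'w \<Rightarrow> 'h) \<Rightarrow> (nat \<Rightarrow> real \<Rightarrow> 'w \<Rightarrow> 'h) \<Rightarrow>
   (real \<Rightarrow> 'w \<Rightarrow> 'h::{complex_hilbert_space, second_countable_topology}) \<Rightarrow> bool" where
  "ito_process T x g \<Phi> X \<longleftrightarrow>
    (\<exists>K. \<forall>t\<in>{0..T}. X t \<in> borel_measurable (F t) \<and> sq_integrable M (X t) \<and>
      g t \<in> borel_measurable (F t) \<and> sq_integrable M (g t) \<and> (\<integral>\<omega>. (norm (g t \<omega>))\<^sup>2 \<partial>M) \<le> K \<and>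
      (\<lambda>p. g (fst p) (snd p)) \<in> borel_measurable (leb t \<Otimes>\<^sub>M M) \<and>
      (\<exists>S. ito_sum t \<Phi> S \<and> (AE \<omega> in M. X t \<omega> = x + (\<integral>r. g r \<omega> \<partial>leb t) + S \<omega>)))"

abbreviation ito_data ::
  "'h \<Rightarrow> (real \<Rightarrow> 'w \<Rightarrow> 'h) \<Rightarrow> (nat \<Rightarrow> real \<Rightarrow> 'w \<Rightarrow> 'h) \<Rightarrow> (real \<Rightarrow> 'w \<Rightarrow> 'h) \<Rightarrow>
   real \<Rightarrow> real \<Rightarrow> ('w \<Rightarrow> 'h::{complex_hilbert_space, second_countable_topology}) \<Rightarrow> bool" where
  "ito_data x g \<Phi> X K t S \<equiv>
      X t \<in> borel_measurable (F t) \<and> sq_integrable M (X t) \<and>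
      g t \<in> borel_measurable (F t) \<and> sq_integrable M (g t) \<and> (\<integral>\<omega>. (norm (g t \<omega>))\<^sup>2 \<partial>M) \<le> K \<and>
      sq_integrable (leb t \<Otimes>\<^sub>M M) (\<lambda>p. g (fst p) (snd p)) \<and>
      sq_integrable M (\<lambda>\<omega>. \<integral>r. g r \<omega> \<partial>leb t) \<and>
      ito_sum t \<Phi> S \<and> sq_integrable M S \<and>
      (AE \<omega> in M. X t \<omega> = x + (\<integral>r. g r \<omega> \<partial>leb t) + S \<omega>)"

lemma ito_processE:
  assumes "ito_process T x g \<Phi> X"
  obtains K S where
    "\<And>t. 0 \<le> t \<Longrightarrow> t \<le> T \<Longrightarrow> ito_data x g \<Phi> X K t (S t)"
proof -
  obtain K where K: "\<And>t. t \<in> {0..T} \<Longrightarrow> X t \<in> borel_measurable (F t) \<and> sq_integrable M (X t) \<and>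
      g t \<in> borel_measurable (F t) \<and> sq_integrable M (g t) \<and> (\<integral>\<omega>. (norm (g t \<omega>))\<^sup>2 \<partial>M) \<le> K \<and>
      (\<lambda>p. g (fst p) (snd p)) \<in> borel_measurable (leb t \<Otimes>\<^sub>M M) \<and>
      (\<exists>S. ito_sum t \<Phi> S \<and> (AE \<omega> in M. X t \<omega> = x + (\<integral>r. g r \<omega> \<partial>leb t) + S \<omega>))"
    using assms unfolding ito_process_def by blast
  then have "\<forall>t\<in>{0..T}. \<exists>S. ito_sum t \<Phi> S \<and> (AE \<omega> in M. X t \<omega> = x + (\<integral>r. g r \<omega> \<partial>leb t) + S \<omega>)"
    by blast
  then obtain S where S: "\<And>t. t \<in> {0..T} \<Longrightarrow>
      ito_sum t \<Phi> (S t) \<and> (AE \<omega> in M. X t \<omega> = x + (\<integral>r. g r \<omega> \<partial>leb t) + S t \<omega>)"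
    by metis
  show ?thesis
  proof (rule that[of K S])
    fix t assume t: "0 \<le> t" "t \<le> T"
    then have t': "t \<in> {0..T}" by simp
    note K' = K[OF t'] and S' = S[OF t']
    have sqS: "sq_integrable M (S t)" using S' by (auto intro: ito_sum_sq_integrable)
    have "sq_integrable (leb t \<Otimes>\<^sub>M M) (\<lambda>p. g (fst p) (snd p))"
      by (rule sq_integrable_pairI[of g t K]) (use K K' t in auto)
    \<comment> \<open>The accumulated drift is almost surely what remains of \<open>X t\<close>
      after removing the initial value and the noise, so it inherits their square
      integrability.\<close>
    moreover have "sq_integrable M (\<lambda>\<omega>. \<integral>r. g r \<omega> \<partial>leb t)"
    proof (rule sq_integrable_cong_AE)
      show "sq_integrable M (\<lambda>\<omega>. X t \<omega> - x - S t \<omega>)"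
        using K' sqS by (intro sq_integrable_diff sq_integrable_bounded[of "\<lambda>_. x" "norm x"]) auto
      show "(\<lambda>\<omega>. \<integral>r. g r \<omega> \<partial>leb t) \<in> borel_measurable M"
        using K' by (intro measurable_integral_leb) auto
      have "AE \<omega> in M. X t \<omega> = x + (\<integral>r. g r \<omega> \<partial>leb t) + S t \<omega>" using S' by blast
      then show "AE \<omega> in M. X t \<omega> - x - S t \<omega> = (\<integral>r. g r \<omega> \<partial>leb t)"
        by eventually_elim simp
    qed
    ultimately show "ito_data x g \<Phi> X K t (S t)"
      using K' S' sqS by blast
  qed
qed

text \<open>Write \<open>X = x + G + S\<close> and \<open>Y = y + H + N\<close> with accumulated
  drifts \<open>G\<close>, \<open>H\<close> and noises \<open>S\<close>, \<open>N\<close>. Expanding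
  \<open>b (X t) (Y t)\<close> leaves products of initial values and drifts, drift against noise,
  and noise against noise. The last is the isometry term of the conclusion. The others are recovered
  from the time integral by expanding \<open>Y r\<close> against \<open>g r\<close> and
  \<open>X r\<close> against \<open>h r\<close> in the same way. Everything happens in expectation,
  so no quadratic variation of paths is involved.\<close>

theorem ito_formula:
  fixes b :: "'h::{complex_hilbert_space, second_countable_topology} \<Rightarrow> 'h \<Rightarrow> complex"
  assumes b: "bounded_bilinear b"
    and X: "ito_process T x g \<Phi> X" and Y: "ito_process T' y h \<Psi> Y"
    and t: "0 \<le> t" "t \<le> T" "t \<le> T'"
  shows "integrable (leb t) (\<lambda>r. (\<integral>\<omega>. b (g r \<omega>) (Y r \<omega>) \<partial>M) + (\<integral>\<omega>. b (X r \<omega>) (h r \<omega>) \<partial>M))"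
    and "(\<lambda>n. \<Sum>k<n. \<integral>p. b (\<Phi> k (fst p) (snd p)) (\<Psi> k (fst p) (snd p)) \<partial>(leb t \<Otimes>\<^sub>M M)) \<longlonglongrightarrow>
      (\<integral>\<omega>. b (X t \<omega>) (Y t \<omega>) \<partial>M) - b x y
        - (\<integral>r. (\<integral>\<omega>. b (g r \<omega>) (Y r \<omega>) \<partial>M) + (\<integral>\<omega>. b (X r \<omega>) (h r \<omega>) \<partial>M) \<partial>leb t)"
proof -
  interpret b: bounded_bilinear b by (rule b)
  interpret P: pair_sigma_finite "leb t" "leb t" by (rule pair_leb_leb)
  note b' = b.flip
  obtain K S where X':
    "\<And>t. 0 \<le> t \<Longrightarrow> t \<le> T \<Longrightarrow> ito_data x g \<Phi> X K t (S t)"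
    by (rule ito_processE[OF X]) (rule that)
  obtain L N where Y':
    "\<And>t. 0 \<le> t \<Longrightarrow> t \<le> T' \<Longrightarrow> ito_data y h \<Psi> Y L t (N t)"
    by (rule ito_processE[OF Y]) (rule that)
  define G where "G t \<omega> = (\<integral>r. g r \<omega> \<partial>leb t)" for t \<omega>
  define H where "H t \<omega> = (\<integral>r. h r \<omega> \<partial>leb t)" for t \<omega>
  have sq_const: "sq_integrable M (\<lambda>_. z)" for z :: 'h
    by (rule sq_integrable_bounded[of _ "norm z"]) auto
  have sq: "sq_integrable M (X r)" "sq_integrable M (g r)" "sq_integrable M (G r)" "sq_integrable M (S r)"
      "sq_integrable M (Y r)" "sq_integrable M (h r)" "sq_integrable M (H r)" "sq_integrable M (N r)"
    and mF: "g r \<in> borel_measurable (F r)" "h r \<in> borel_measurable (F r)"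
    and ito: "ito_sum r \<Phi> (S r)" "ito_sum r \<Psi> (N r)"
    and pair: "sq_integrable (leb r \<Otimes>\<^sub>M M) (\<lambda>p. g (fst p) (snd p))"
      "sq_integrable (leb r \<Otimes>\<^sub>M M) (\<lambda>p. h (fst p) (snd p))"
    and eqX: "AE \<omega> in M. X r \<omega> = x + G r \<omega> + S r \<omega>" and eqY: "AE \<omega> in M. Y r \<omega> = y + H r \<omega> + N r \<omega>"
    if "0 \<le> r" "r \<le> t" for r
    using X'[of r] Y'[of r] that t unfolding G_def[abs_def] H_def[abs_def] by auto
  have int: "integrable M (\<lambda>\<omega>. b (u \<omega>) (v \<omega>))" if "sq_integrable M u" "sq_integrable M v" for u v
    using sq_integrable_bilinear[OF b that] .
  have expand_Y: "(\<integral>\<omega>. b (u \<omega>) (Y r \<omega>) \<partial>M) = (\<integral>\<omega>. b (u \<omega>) y \<partial>M) + (\<integral>\<omega>. b (u \<omega>) (H r \<omega>) \<partial>M) + (\<integral>\<omega>. b (u \<omega>) (N r \<omega>) \<partial>M)"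
    if r: "0 \<le> r" "r \<le> t" and u: "sq_integrable M u" for u r
  proof -
    have "(\<integral>\<omega>. b (u \<omega>) (Y r \<omega>) \<partial>M) = (\<integral>\<omega>. b (u \<omega>) (y + H r \<omega> + N r \<omega>) \<partial>M)"
    proof (rule integral_cong_AE)
      show "AE \<omega> in M. b (u \<omega>) (Y r \<omega>) = b (u \<omega>) (y + H r \<omega> + N r \<omega>)"
        using eqY[OF r] by eventually_elim simp
    qed (intro borel_measurable_integrable int u sq r sq_integrable_add sq_const)+
    also have "\<dots> = (\<integral>\<omega>. b (u \<omega>) y \<partial>M) + (\<integral>\<omega>. b (u \<omega>) (H r \<omega>) \<partial>M) + (\<integral>\<omega>. b (u \<omega>) (N r \<omega>) \<partial>M)"
      using int[OF u sq_const[of y]] int[OF u sq(7)[OF r]] int[OF u sq(8)[OF r]]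
      by (simp add: b.add_right)
    finally show ?thesis .
  qed
  have expand_X: "(\<integral>\<omega>. b (X r \<omega>) (v \<omega>) \<partial>M) = (\<integral>\<omega>. b x (v \<omega>) \<partial>M) + (\<integral>\<omega>. b (G r \<omega>) (v \<omega>) \<partial>M) + (\<integral>\<omega>. b (S r \<omega>) (v \<omega>) \<partial>M)"
    if r: "0 \<le> r" "r \<le> t" and v: "sq_integrable M v" for v r
  proof -
    have "(\<integral>\<omega>. b (X r \<omega>) (v \<omega>) \<partial>M) = (\<integral>\<omega>. b (x + G r \<omega> + S r \<omega>) (v \<omega>) \<partial>M)"
    proof (rule integral_cong_AE)
      show "AE \<omega> in M. b (X r \<omega>) (v \<omega>) = b (x + G r \<omega> + S r \<omega>) (v \<omega>)"
        using eqX[OF r] by eventually_elim simp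
    qed (intro borel_measurable_integrable int v sq r sq_integrable_add sq_const)+
    also have "\<dots> = (\<integral>\<omega>. b x (v \<omega>) \<partial>M) + (\<integral>\<omega>. b (G r \<omega>) (v \<omega>) \<partial>M) + (\<integral>\<omega>. b (S r \<omega>) (v \<omega>) \<partial>M)"
      using int[OF sq_const[of x] v] int[OF sq(3)[OF r] v] int[OF sq(4)[OF r] v]
      by (simp add: b.add_left)
    finally show ?thesis .
  qed
  have t0: "0 \<le> t" "t \<le> t" using t by auto
  \<comment> \<open>The coupling of the two drifts at different times; it is bounded because
    \<open>K\<close> and \<open>L\<close> bound their second moments uniformly in time.\<close>
  define c where "c r q = (\<integral>\<omega>. b (g r \<omega>) (h q \<omega>) \<partial>M)" for r q
  have c_int: "integrable (leb t \<Otimes>\<^sub>M leb t) (\<lambda>p. c (fst p) (snd p))"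
  proof -
    obtain B where B: "\<And>x y. norm (b x y) \<le> norm x * norm y * B" "0 \<le> B"
      using b.nonneg_bounded by blast
    have "norm (c r q) \<le> sqrt K * sqrt L * B" if "r \<in> {0..t}" "q \<in> {0..t}" for r q
    proof -
      have "norm (c r q) \<le> sqrt (\<integral>\<omega>. (norm (g r \<omega>))\<^sup>2 \<partial>M) * sqrt (\<integral>\<omega>. (norm (h q \<omega>))\<^sup>2 \<partial>M) * B"
        unfolding c_def using that by (intro norm_integral_bilinear_le[OF b B] sq) auto
      also have "\<dots> \<le> sqrt K * sqrt L * B"
      proof -
        have KL: "(\<integral>\<omega>. (norm (g r \<omega>))\<^sup>2 \<partial>M) \<le> K" "(\<integral>\<omega>. (norm (h q \<omega>))\<^sup>2 \<partial>M) \<le> L"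
          using X'[of r] Y'[of q] that t by auto
        have "0 \<le> K" "0 \<le> L"
          by (rule order_trans[OF _ KL(1)] order_trans[OF _ KL(2)]; simp)+
        with KL B(2) show ?thesis
          by (intro mult_mono real_sqrt_le_mono mult_nonneg_nonneg real_sqrt_ge_zero) auto
      qed
      finally show ?thesis .
    qed
    moreover have "(\<lambda>p. c (fst p) (snd p)) \<in> borel_measurable (leb t \<Otimes>\<^sub>M leb t)"
      unfolding c_def
    proof (rule borel_measurable_lebesgue_integral)
      note m = pair[OF t0, THEN sq_integrable_measurable]
      have 1: "(\<lambda>z. (fst (fst z), snd z)) \<in> measurable ((leb t \<Otimes>\<^sub>M leb t) \<Otimes>\<^sub>M M) (leb t \<Otimes>\<^sub>M M)"
        and 2: "(\<lambda>z. (snd (fst z), snd z)) \<in> measurable ((leb t \<Otimes>\<^sub>M leb t) \<Otimes>\<^sub>M M) (leb t \<Otimes>\<^sub>M M)"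
        by measurable
      show "(\<lambda>(p, \<omega>). b (g (fst p) \<omega>) (h (snd p) \<omega>)) \<in> borel_measurable ((leb t \<Otimes>\<^sub>M leb t) \<Otimes>\<^sub>M M)"
        using borel_measurable_bilinear[OF b measurable_compose[OF 1 m(1)] measurable_compose[OF 2 m(2)]]
        by (simp add: case_prod_unfold)
    qed
    ultimately show ?thesis
      by (intro finite_measure.integrable_const_bound[OF finite_measure_pair_measure[OF finite_measure_leb finite_measure_leb], of _ "sqrt K * sqrt L * B"])
        (auto simp: space_pair_measure intro!: AE_I2)
  qed
  note tri = integral_triangle[OF c_int]
  \<comment> \<open>The integrand of the claim after expansion, with the noises \<open>N r\<close>
    and \<open>S r\<close> replaced by their values at the final time. The martingale property
    permits this since \<open>g r\<close> and \<open>h r\<close> are known at \<open>r\<close>.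
    Afterwards the noise no longer depends on \<open>r\<close> and Fubini applies.\<close>
  define R where "R r = (\<integral>\<omega>. b (g r \<omega>) y \<partial>M) + (\<integral>q. c r q \<partial>leb r) + (\<integral>\<omega>. b (g r \<omega>) (N t \<omega>) \<partial>M)
    + ((\<integral>\<omega>. b x (h r \<omega>) \<partial>M) + (\<integral>q. c q r \<partial>leb r) + (\<integral>\<omega>. b (S t \<omega>) (h r \<omega>) \<partial>M))" for r
  have R: "(\<integral>\<omega>. b (g r \<omega>) (Y r \<omega>) \<partial>M) + (\<integral>\<omega>. b (X r \<omega>) (h r \<omega>) \<partial>M) = R r" if "r \<in> space (leb t)" for r
  proof -
    have r: "0 \<le> r" "r \<le> t" using that by auto
    have "(\<integral>\<omega>. b (g r \<omega>) (H r \<omega>) \<partial>M) = (\<integral>q. c r q \<partial>leb r)"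
      unfolding H_def c_def by (rule expectation_bilinear_integral(2)[OF b sq(2)[OF r] pair(2)[OF r]])
    moreover have "(\<integral>\<omega>. b (G r \<omega>) (h r \<omega>) \<partial>M) = (\<integral>q. c q r \<partial>leb r)"
      unfolding G_def c_def by (rule expectation_bilinear_integral(2)[OF b' sq(6)[OF r] pair(1)[OF r]])
    moreover have "(\<integral>\<omega>. b (g r \<omega>) (N r \<omega>) \<partial>M) = (\<integral>\<omega>. b (g r \<omega>) (N t \<omega>) \<partial>M)"
      by (rule ito_sum_martingale[OF b r ito(2)[OF t0] ito(2)[OF r] mF(1)[OF r] sq(2)[OF r], symmetric])
    moreover have "(\<integral>\<omega>. b (S r \<omega>) (h r \<omega>) \<partial>M) = (\<integral>\<omega>. b (S t \<omega>) (h r \<omega>) \<partial>M)"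
      by (rule ito_sum_martingale[OF b' r ito(1)[OF t0] ito(1)[OF r] mF(2)[OF r] sq(6)[OF r], symmetric])
    ultimately show ?thesis
      unfolding R_def expand_Y[OF r sq(2)[OF r]] expand_X[OF r sq(6)[OF r]] by simp
  qed
  note i1 = expectation_bilinear_integral[OF b' sq_const[of y] pair(1)[OF t0]]
    and i2 = expectation_bilinear_integral[OF b' sq(8)[OF t0] pair(1)[OF t0]]
    and i3 = expectation_bilinear_integral[OF b sq_const[of x] pair(2)[OF t0]]
    and i4 = expectation_bilinear_integral[OF b sq(4)[OF t0] pair(2)[OF t0]]
  have R_int: "integrable (leb t) R"
    unfolding R_def[abs_def] by (intro Bochner_Integration.integrable_add i1 i2 i3 i4 tri)
  then show "integrable (leb t) (\<lambda>r. (\<integral>\<omega>. b (g r \<omega>) (Y r \<omega>) \<partial>M) + (\<integral>\<omega>. b (X r \<omega>) (h r \<omega>) \<partial>M))"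
    by (simp only: R cong: Bochner_Integration.integrable_cong)
  have "(\<integral>\<omega>. b (G t \<omega>) (H t \<omega>) \<partial>M) = (\<integral>r. (\<integral>q. c r q \<partial>leb t) \<partial>leb t)"
  proof -
    have "(\<integral>\<omega>. b (G t \<omega>) (H t \<omega>) \<partial>M) = (\<integral>r. (\<integral>\<omega>. b (g r \<omega>) (H t \<omega>) \<partial>M) \<partial>leb t)"
      unfolding G_def by (rule expectation_bilinear_integral(2)[OF b' sq(7)[OF t0] pair(1)[OF t0]])
    also have "\<dots> = (\<integral>r. (\<integral>q. c r q \<partial>leb t) \<partial>leb t)"
    proof (rule Bochner_Integration.integral_cong[OF refl])
      fix r assume "r \<in> space (leb t)"
      then have r: "0 \<le> r" "r \<le> t" by auto
      show "(\<integral>\<omega>. b (g r \<omega>) (H t \<omega>) \<partial>M) = (\<integral>q. c r q \<partial>leb t)"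
        unfolding H_def c_def by (rule expectation_bilinear_integral(2)[OF b sq(2)[OF r] pair(2)[OF t0]])
    qed
    finally show ?thesis .
  qed
  \<comment> \<open>The product of the accumulated drifts is an integral over the square; cut along
    the diagonal it matches the two inner integrals in \<open>R\<close>.\<close>
  note GH = this[unfolded tri(3)]
  have F0: "(\<lambda>_. z) \<in> borel_measurable (F 0)" for z :: 'h by simp
  \<comment> \<open>Of the nine products, \<open>b x (N t)\<close> and \<open>b (S t) y\<close> have
    mean zero, as the constants are known at time 0.\<close>
  have "(\<integral>\<omega>. b (X t \<omega>) (Y t \<omega>) \<partial>M) =
      b x y + (\<integral>\<omega>. b x (H t \<omega>) \<partial>M) + ((\<integral>\<omega>. b (G t \<omega>) y \<partial>M) + (\<integral>\<omega>. b (G t \<omega>) (H t \<omega>) \<partial>M) + (\<integral>\<omega>. b (G t \<omega>) (N t \<omega>) \<partial>M))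
      + ((\<integral>\<omega>. b (S t \<omega>) (H t \<omega>) \<partial>M) + (\<integral>\<omega>. b (S t \<omega>) (N t \<omega>) \<partial>M))"
    unfolding expand_X[OF t0 sq(5)[OF t0]] expand_Y[OF t0 sq_const] expand_Y[OF t0 sq(3)[OF t0]] expand_Y[OF t0 sq(4)[OF t0]]
    using ito_sum_orthogonal_F0[OF b t(1) ito(2)[OF t0] F0 sq_const, of x]
      ito_sum_orthogonal_F0[OF b' t(1) ito(1)[OF t0] F0 sq_const, of y]
    by (simp add: prob_space)
  also have "\<dots> = b x y + (\<integral>r. R r \<partial>leb t) + (\<integral>\<omega>. b (S t \<omega>) (N t \<omega>) \<partial>M)"
  proof -
    have "(\<integral>r. R r \<partial>leb t) = (\<integral>r. (\<integral>\<omega>. b (g r \<omega>) y \<partial>M) \<partial>leb t) + (\<integral>r. (\<integral>q. c r q \<partial>leb r) \<partial>leb t)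
      + (\<integral>r. (\<integral>\<omega>. b (g r \<omega>) (N t \<omega>) \<partial>M) \<partial>leb t) + ((\<integral>r. (\<integral>\<omega>. b x (h r \<omega>) \<partial>M) \<partial>leb t)
      + (\<integral>r. (\<integral>q. c q r \<partial>leb r) \<partial>leb t) + (\<integral>r. (\<integral>\<omega>. b (S t \<omega>) (h r \<omega>) \<partial>M) \<partial>leb t))"
      unfolding R_def using i1(1) i2(1) i3(1) i4(1) tri(1,2) by simp
    then show ?thesis
      unfolding GH using i1(2) i2(2) i3(2) i4(2) by (simp add: G_def H_def)
  qed
  finally have eq: "(\<integral>\<omega>. b (X t \<omega>) (Y t \<omega>) \<partial>M) = b x y + (\<integral>r. R r \<partial>leb t) + (\<integral>\<omega>. b (S t \<omega>) (N t \<omega>) \<partial>M)" .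
  have "(\<integral>r. (\<integral>\<omega>. b (g r \<omega>) (Y r \<omega>) \<partial>M) + (\<integral>\<omega>. b (X r \<omega>) (h r \<omega>) \<partial>M) \<partial>leb t) = (\<integral>r. R r \<partial>leb t)"
    by (rule Bochner_Integration.integral_cong[OF refl R])
  with eq ito_sum_isometry[OF b t(1) ito(1)[OF t0] ito(2)[OF t0]]
  show "(\<lambda>n. \<Sum>k<n. \<integral>p. b (\<Phi> k (fst p) (snd p)) (\<Psi> k (fst p) (snd p)) \<partial>(leb t \<Otimes>\<^sub>M M)) \<longlonglongrightarrow>
      (\<integral>\<omega>. b (X t \<omega>) (Y t \<omega>) \<partial>M) - b x y
        - (\<integral>r. (\<integral>\<omega>. b (g r \<omega>) (Y r \<omega>) \<partial>M) + (\<integral>\<omega>. b (X r \<omega>) (h r \<omega>) \<partial>M) \<partial>leb t)"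
    by simp
qed

end

section \<open>Strong solutions as Ito processes\<close>

text \<open>Time is rounded down to a multiple of \<open>1 / (n + 1)\<close>. The sampled function
  is glued from countably many measurable pieces, and continuity in time gives convergence.\<close>

lemma caratheodory_measurable:
  fixes f :: "real \<Rightarrow> 'a \<Rightarrow> 'b::metric_space"
  assumes t: "0 \<le> t" and m: "\<And>r. 0 \<le> r \<Longrightarrow> r \<le> t \<Longrightarrow> f r \<in> borel_measurable N"
    and cont: "\<And>\<omega>. \<omega> \<in> space N \<Longrightarrow> continuous_on {0..t} (\<lambda>r. f r \<omega>)"
  shows "(\<lambda>p. f (fst p) (snd p)) \<in> borel_measurable (leb t \<Otimes>\<^sub>M N)"
proof -
  define q where "q n r = real (nat \<lfloor>real (Suc n) * r\<rfloor>) / real (Suc n)" for n :: nat and r :: real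
  have q: "0 \<le> q n r" "q n r \<le> r" "r - inverse (real (Suc n)) \<le> q n r" if "0 \<le> r" for n r
  proof -
    have eq: "real (nat \<lfloor>real (Suc n) * r\<rfloor>) = of_int \<lfloor>real (Suc n) * r\<rfloor>"
      using that by simp
    show "0 \<le> q n r" by (simp add: q_def)
    have "of_int \<lfloor>real (Suc n) * r\<rfloor> \<le> real (Suc n) * r" by (rule of_int_floor_le)
    then show "q n r \<le> r"
      unfolding q_def eq by (simp add: divide_le_eq mult.commute)
    have "real (Suc n) * r - 1 \<le> of_int \<lfloor>real (Suc n) * r\<rfloor>" by linarith
    then have "(real (Suc n) * r - 1) / real (Suc n) \<le> q n r"
      unfolding q_def eq by (intro divide_right_mono) auto
    then show "r - inverse (real (Suc n)) \<le> q n r"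
      by (simp add: diff_divide_distrib inverse_eq_divide)
  qed
  show ?thesis
  proof (rule borel_measurable_LIMSEQ_metric)
    fix n
    have fst_m: "fst \<in> borel_measurable (leb t \<Otimes>\<^sub>M N)"
      by (rule measurable_compose[OF measurable_fst measurable_leb_id])
    \<comment> \<open>Grid points beyond \<open>t\<close> are moved to \<open>t\<close>, since
      measurability is known on [0, t] only. Rounding down keeps the points actually sampled within
      [0, t], so their values are unaffected.\<close>
    have "(\<lambda>p. f (min t (real i / real (Suc n))) (snd p)) \<in> borel_measurable (leb t \<Otimes>\<^sub>M N)" for i :: nat
      using t by (intro measurable_compose[OF measurable_snd m]) auto
    moreover have "(\<lambda>p. nat \<lfloor>real (Suc n) * fst p\<rfloor>) \<in> measurable (leb t \<Otimes>\<^sub>M N) (count_space UNIV)"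
      using fst_m by measurable
    ultimately show "(\<lambda>p. f (min t (q n (fst p))) (snd p)) \<in> borel_measurable (leb t \<Otimes>\<^sub>M N)"
      unfolding q_def by (rule measurable_compose_countable)
  next
    fix p assume "p \<in> space (leb t \<Otimes>\<^sub>M N)"
    then have p: "0 \<le> fst p" "fst p \<le> t" "snd p \<in> space N"
      by (auto simp: space_pair_measure)
    have "(\<lambda>n. q n (fst p)) \<longlonglongrightarrow> fst p"
    proof (rule tendsto_sandwich[OF _ _ _ tendsto_const])
      show "(\<lambda>n. fst p - inverse (real (Suc n))) \<longlonglongrightarrow> fst p"
        using tendsto_diff[OF tendsto_const LIMSEQ_inverse_real_of_nat] by simp
    qed (use q p in auto)
    moreover have "min t (q n (fst p)) = q n (fst p)" for n
      using q[OF p(1), of n] p by simp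
    ultimately show "(\<lambda>n. f (min t (q n (fst p))) (snd p)) \<longlonglongrightarrow> f (fst p) (snd p)"
      using p q(1)[OF p(1)] order_trans[OF q(2)[OF p(1)] p(2)]
      by (intro continuous_on_tendsto_compose[OF cont[OF p(3)]]) (auto intro!: always_eventually)
  qed
qed

lemma linear_operator_zero:
  assumes "linear_operator T" shows "T \<odot> 0 = 0"
proof -
  have "T \<odot> (0 + 0) = T \<odot> 0 + T \<odot> 0"
    using assms unfolding linear_operator_def by blast
  then show ?thesis by simp
qed

section \<open>Setting of the linear equation and estimates of its coefficients\<close>

locale linear_sse = wiener_setting M F W
  for M :: "'w measure" and F :: "real \<Rightarrow> 'w measure" and W :: "nat \<Rightarrow> real \<Rightarrow> 'w \<Rightarrow> real" +
  fixes G C :: "'h::{complex_hilbert_space, second_countable_topology} \<rightharpoonup> 'h"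
    and L :: "nat \<Rightarrow> 'h \<rightharpoonup> 'h"
  assumes G: "linear_operator G" and L: "\<And>k. linear_operator (L k)"
    and C: "self_adjoint C" and hyp: "hypothesis_A M F W G L C"
begin

abbreviation solution :: "real \<Rightarrow> 'h \<Rightarrow> (real \<Rightarrow> 'w \<Rightarrow> 'h) \<Rightarrow> bool" where
  "solution T x X \<equiv> strong_C_solution M F W G L C {0..T} (\<lambda>_. x) X"

text \<open>Written exactly as the integrand of a strong solution: a total Borel function, equal to
  zero outside \<open>dom C\<close>.\<close>

definition Gp :: "'h \<Rightarrow> 'h" where "Gp x = G \<odot> \<pi> C x"

definition Lp :: "nat \<Rightarrow> 'h \<Rightarrow> 'h" where "Lp k x = L k \<odot> \<pi> C x"

text \<open>The majorant for all coefficients. It takes the place of the squared graph norm of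
  \<open>C\<close> and is Borel by construction, so its integrals are additive; by conservativity it
  also dominates the sum of the squared norms of the noise coefficients.\<close>

definition energy :: "'h \<Rightarrow> real" where "energy x = (norm x)\<^sup>2 + (norm (Gp x))\<^sup>2"

lemma dom_C: "csubspace (dom C)" "closure (dom C) = UNIV"
  using C by (auto simp: self_adjoint_def linear_operator_def csubspace_def)

lemma dom_sub: "x \<in> dom C \<Longrightarrow> x \<in> dom G" "x \<in> dom C \<Longrightarrow> x \<in> dom (L k)"
  using hyp unfolding hypothesis_A_def by blast+

lemma Gp_dom: "x \<in> dom C \<Longrightarrow> Gp x = G \<odot> x"
  and Lp_dom: "x \<in> dom C \<Longrightarrow> Lp k x = L k \<odot> x"
  by (simp_all add: Gp_def Lp_def domain_proj_def)

lemma Gp_outside: "x \<notin> dom C \<Longrightarrow> Gp x = 0"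
  and Lp_outside: "x \<notin> dom C \<Longrightarrow> Lp k x = 0"
  by (simp_all add: Gp_def Lp_def domain_proj_def linear_operator_zero[OF G] linear_operator_zero[OF L])

lemma Gp_add: "x \<in> dom C \<Longrightarrow> y \<in> dom C \<Longrightarrow> Gp (x + y) = Gp x + Gp y"
  and Lp_add: "x \<in> dom C \<Longrightarrow> y \<in> dom C \<Longrightarrow> Lp k (x + y) = Lp k x + Lp k y"
  and Gp_scaleC: "x \<in> dom C \<Longrightarrow> Gp (a *\<^sub>C x) = a *\<^sub>C Gp x"
  and Lp_scaleC: "x \<in> dom C \<Longrightarrow> Lp k (a *\<^sub>C x) = a *\<^sub>C Lp k x"
  using G L[of k] csubspaceD[OF dom_C(1)] dom_sub(1)[of x] dom_sub(1)[of y] dom_sub(2)[of x k] dom_sub(2)[of y k]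
  by (simp_all add: Gp_dom Lp_dom linear_operator_def)

lemma Gp_measurable [measurable]: "Gp \<in> borel_measurable borel"
  and Lp_measurable [measurable]: "Lp k \<in> borel_measurable borel"
  using hyp unfolding hypothesis_A_def Gp_def[abs_def] Lp_def[abs_def] by blast+

lemma energy_measurable [measurable]: "energy \<in> borel_measurable borel"
  unfolding energy_def[abs_def] by measurable

lemma energy_nonneg: "0 \<le> energy x"
  by (simp add: energy_def)

lemma energy_identity:
  shows summable_Lp: "summable (\<lambda>k. (norm (Lp k x))\<^sup>2)"
    and suminf_Lp: "(\<Sum>k. (norm (Lp k x))\<^sup>2) = - 2 * Re (cinner x (Gp x))"
proof -
  have "summable (\<lambda>k. (norm (Lp k x))\<^sup>2) \<and> (\<Sum>k. (norm (Lp k x))\<^sup>2) = - 2 * Re (cinner x (Gp x))"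
  proof (cases "x \<in> dom C")
    case True
    then have "summable (\<lambda>k. (norm (L k \<odot> x))\<^sup>2) \<and>
        2 * Re (cinner x (G \<odot> x)) + (\<Sum>k. (norm (L k \<odot> x))\<^sup>2) = 0"
      using hyp unfolding hypothesis_A_def by blast
    then show ?thesis
      by (simp add: Gp_dom[OF True] Lp_dom[OF True])
  qed (simp add: Gp_outside Lp_outside)
  then show "summable (\<lambda>k. (norm (Lp k x))\<^sup>2)" "(\<Sum>k. (norm (Lp k x))\<^sup>2) = - 2 * Re (cinner x (Gp x))"
    by auto
qed

lemma mult_le_half_squares: "(a::real) * b \<le> (a\<^sup>2 + b\<^sup>2) / 2"
  using sum_squares_bound[of a b] by simp

lemma suminf_Lp_le: "(\<Sum>k. (norm (Lp k x))\<^sup>2) \<le> energy x"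
proof -
  have "- 2 * Re (cinner x (Gp x)) \<le> 2 * cmod (cinner x (Gp x))"
    using abs_Re_le_cmod[of "cinner x (Gp x)"] by linarith
  also have "\<dots> \<le> 2 * (norm x * norm (Gp x))"
    using norm_cinner_le[of x "Gp x"] by simp
  also have "\<dots> \<le> energy x"
    using mult_le_half_squares[of "norm x" "norm (Gp x)"] by (simp add: energy_def)
  finally show ?thesis by (simp add: suminf_Lp)
qed

lemma sum_Lp_le: "(\<Sum>k<n. (norm (Lp k x))\<^sup>2) \<le> energy x"
  using sum_le_suminf[OF summable_Lp, of "{..<n}" x] suminf_Lp_le[of x] by simp

text \<open>For \<open>b x y = cinner x (B y)\<close> this is the right-hand side of the adjoint
  equation with \<open>B\<close> in place of the solution, so the drift in the Ito formula and the
  derivative in the adjoint equation are the same expression.\<close>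

definition Phi :: "('h \<Rightarrow> 'h \<Rightarrow> complex) \<Rightarrow> 'h \<Rightarrow> 'h \<Rightarrow> complex" where
  "Phi b x y = b (Gp x) y + b x (Gp y) + (\<Sum>k. b (Lp k x) (Lp k y))"

context
  fixes b :: "'h \<Rightarrow> 'h \<Rightarrow> complex" and K :: real
  assumes b: "bounded_bilinear b" and K: "\<And>x y. norm (b x y) \<le> norm x * norm y * K" "0 \<le> K"
begin

lemma norm_bilinear_le: "norm (b x y) \<le> K * (((norm x)\<^sup>2 + (norm y)\<^sup>2) / 2)"
  using order_trans[OF K(1)[of x y] mult_right_mono[OF mult_le_half_squares K(2)]]
  by (simp add: mult.commute)

lemma norm_sum_bilinear_Lp_le:
  "norm (\<Sum>k<n. b (Lp k x) (Lp k y)) \<le> K * ((energy x + energy y) / 2)"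
  "(\<Sum>k<n. norm (b (Lp k x) (Lp k y))) \<le> K * ((energy x + energy y) / 2)"
proof -
  have "(\<Sum>k<n. norm (b (Lp k x) (Lp k y))) \<le> (\<Sum>k<n. K * (((norm (Lp k x))\<^sup>2 + (norm (Lp k y))\<^sup>2) / 2))"
    by (intro sum_mono norm_bilinear_le)
  also have "\<dots> = K * (((\<Sum>k<n. (norm (Lp k x))\<^sup>2) + (\<Sum>k<n. (norm (Lp k y))\<^sup>2)) / 2)"
    by (simp only: sum_distrib_left[symmetric] sum_divide_distrib[symmetric] sum.distrib)
  also have "\<dots> \<le> K * ((energy x + energy y) / 2)"
    using sum_Lp_le[where x = x and n = n] sum_Lp_le[where x = y and n = n] K(2) by (intro mult_left_mono) auto
  finally show le: "(\<Sum>k<n. norm (b (Lp k x) (Lp k y))) \<le> K * ((energy x + energy y) / 2)" .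
  then show "norm (\<Sum>k<n. b (Lp k x) (Lp k y)) \<le> K * ((energy x + energy y) / 2)"
    by (rule order_trans[OF norm_sum])
qed

lemma summable_bilinear_Lp: "summable (\<lambda>k. b (Lp k x) (Lp k y))"
  by (rule summable_norm_cancel, rule summableI_nonneg_bounded[OF _ norm_sum_bilinear_Lp_le(2)]) simp

lemma norm_suminf_bilinear_Lp_le: "norm (\<Sum>k. b (Lp k x) (Lp k y)) \<le> K * ((energy x + energy y) / 2)"
  by (rule LIMSEQ_le_const2[OF tendsto_norm[OF summable_LIMSEQ[OF summable_bilinear_Lp]]])
    (use norm_sum_bilinear_Lp_le(1) in blast)

lemma norm_Phi_le: "norm (Phi b x y) \<le> K * (energy x + energy y)"
proof -
  have "norm (Phi b x y) \<le> norm (b (Gp x) y) + norm (b x (Gp y)) + norm (\<Sum>k. b (Lp k x) (Lp k y))"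
    unfolding Phi_def by (intro norm_triangle_mono order_refl)
  also have "\<dots> \<le> K * (((norm (Gp x))\<^sup>2 + (norm y)\<^sup>2) / 2) + K * (((norm x)\<^sup>2 + (norm (Gp y))\<^sup>2) / 2)
      + K * ((energy x + energy y) / 2)"
    by (intro add_mono norm_bilinear_le norm_suminf_bilinear_Lp_le)
  also have "\<dots> = K * (energy x + energy y)"
    by (simp add: energy_def field_simps)
  finally show ?thesis .
qed

end

text \<open>Relative boundedness of \<open>G\<close> bounds the energy by the graph norm, whose
  second moments the solution controls. The care is needed because the controlled integrand contains
  \<open>C\<close> and is not known to be measurable, so integrals involving it cannot simply be
  added.\<close>

lemma energy_bound:
  assumes X: "solution T x X" and T: "0 < T"
  obtains E where "\<And>r. 0 \<le> r \<Longrightarrow> r \<le> T \<Longrightarrow>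
    integrable M (\<lambda>\<omega>. energy (X r \<omega>)) \<and> (\<integral>\<omega>. energy (X r \<omega>) \<partial>M) \<le> E"
proof -
  have "\<exists>K. \<forall>x\<in>dom C. norm (G \<odot> x) \<le> K * graph_norm C x"
    using hyp unfolding hypothesis_A_def by (elim conjE)
  then obtain K0 where K0: "\<And>x. x \<in> dom C \<Longrightarrow> norm (G \<odot> x) \<le> K0 * graph_norm C x"
    by blast
  \<comment> \<open>Positivity of \<open>K\<close> is wanted for dividing by \<open>K^2\<close>
    below.\<close>
  define K where "K = max K0 1"
  have K1: "1 \<le> K" by (simp add: K_def)
  have GK: "(norm (Gp z))\<^sup>2 \<le> K\<^sup>2 * ((norm z)\<^sup>2 + (norm (C \<odot> \<pi> C z))\<^sup>2)" if "z \<in> dom C" for z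
  proof -
    have "norm (Gp z) \<le> K0 * graph_norm C z" using K0[OF that] by (simp add: Gp_dom[OF that])
    also have "\<dots> \<le> K * graph_norm C z"
      by (intro mult_right_mono) (auto simp: K_def graph_norm_def)
    finally have "(norm (Gp z))\<^sup>2 \<le> (K * graph_norm C z)\<^sup>2" by (intro power_mono) auto
    then show ?thesis
      using that by (simp add: power_mult_distrib graph_norm_def domain_proj_def)
  qed
  define c where "c = (SUP s\<in>{0..T}. \<integral>\<^sup>+\<omega>. ennreal ((norm (C \<odot> \<pi> C (X s \<omega>)))\<^sup>2) \<partial>M)"
  define e where "e = ennreal ((norm x)\<^sup>2) + ennreal (K\<^sup>2) * (ennreal ((norm x)\<^sup>2) + c)"
  have sol: "X r \<in> borel_measurable (F r)"
      "(\<integral>\<^sup>+\<omega>. ennreal ((norm (X r \<omega>))\<^sup>2) \<partial>M) \<le> ennreal ((norm x)\<^sup>2)"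
      "AE \<omega> in M. X r \<omega> \<in> dom C"
    if "0 \<le> r" "r \<le> T" for r
    using X that unfolding strong_C_solution_def by (auto simp: emeasure_space_1)
  have c_fin: "c < \<infinity>"
    using X T unfolding strong_C_solution_def c_def by auto
  have e_fin: "e < \<infinity>"
    using c_fin by (simp add: e_def ennreal_mult_less_top)
  have main: "(\<integral>\<^sup>+\<omega>. ennreal (energy (X r \<omega>)) \<partial>M) \<le> e" if r: "0 \<le> r" "r \<le> T" for r
  proof -
    have [measurable]: "X r \<in> borel_measurable M"
      by (rule F_measurable_M[OF sol(1)[OF r] r(1)])
    \<comment> \<open>A measurable minorant: almost surely \<open>v\<close> lies below the squared
      norm of \<open>C\<close> at \<open>X r\<close>, so its integral is at most \<open>c\<close> by
      monotonicity alone, while \<open>norm (Gp (X r)) ^ 2 <= K^2 * (norm (X r) ^ 2 + v)\<close>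
      holds everywhere.\<close>
    define v where "v \<omega> = max 0 ((norm (Gp (X r \<omega>)))\<^sup>2 / K\<^sup>2 - (norm (X r \<omega>))\<^sup>2)" for \<omega>
    have [measurable]: "v \<in> borel_measurable M" unfolding v_def[abs_def] by measurable
    have "(\<integral>\<^sup>+\<omega>. ennreal (v \<omega>) \<partial>M) \<le> (\<integral>\<^sup>+\<omega>. ennreal ((norm (C \<odot> \<pi> C (X r \<omega>)))\<^sup>2) \<partial>M)"
    proof (rule nn_integral_mono_AE)
      show "AE \<omega> in M. ennreal (v \<omega>) \<le> ennreal ((norm (C \<odot> \<pi> C (X r \<omega>)))\<^sup>2)"
        using sol(3)[OF r]
      proof eventually_elim
        case (elim \<omega>)
        have "(norm (Gp (X r \<omega>)))\<^sup>2 / K\<^sup>2 \<le> (norm (X r \<omega>))\<^sup>2 + (norm (C \<odot> \<pi> C (X r \<omega>)))\<^sup>2"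
          using GK[OF elim] K1 by (simp add: divide_le_eq mult.commute)
        then show ?case by (intro ennreal_leI) (simp add: v_def)
      qed
    qed
    also have "\<dots> \<le> c"
      unfolding c_def using r by (intro SUP_upper) auto
    finally have v: "(\<integral>\<^sup>+\<omega>. ennreal (v \<omega>) \<partial>M) \<le> c" .
    have "(\<integral>\<^sup>+\<omega>. ennreal (energy (X r \<omega>)) \<partial>M) \<le> (\<integral>\<^sup>+\<omega>. ennreal ((norm (X r \<omega>))\<^sup>2)
        + ennreal (K\<^sup>2) * (ennreal ((norm (X r \<omega>))\<^sup>2) + ennreal (v \<omega>)) \<partial>M)"
    proof (rule nn_integral_mono)
      fix \<omega>
      have "(norm (Gp (X r \<omega>)))\<^sup>2 / K\<^sup>2 \<le> (norm (X r \<omega>))\<^sup>2 + v \<omega>"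
        by (simp add: v_def)
      then have "(norm (Gp (X r \<omega>)))\<^sup>2 \<le> K\<^sup>2 * ((norm (X r \<omega>))\<^sup>2 + v \<omega>)"
        using K1 by (simp add: divide_le_eq mult.commute)
      then have "energy (X r \<omega>) \<le> (norm (X r \<omega>))\<^sup>2 + K\<^sup>2 * ((norm (X r \<omega>))\<^sup>2 + v \<omega>)"
        by (simp add: energy_def)
      then have "ennreal (energy (X r \<omega>)) \<le> ennreal ((norm (X r \<omega>))\<^sup>2 + K\<^sup>2 * ((norm (X r \<omega>))\<^sup>2 + v \<omega>))"
        by (rule ennreal_leI)
      also have "\<dots> = ennreal ((norm (X r \<omega>))\<^sup>2)
        + ennreal (K\<^sup>2) * (ennreal ((norm (X r \<omega>))\<^sup>2) + ennreal (v \<omega>))"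
        by (simp add: v_def ennreal_plus ennreal_mult del: ennreal_max_0)
      finally show "ennreal (energy (X r \<omega>)) \<le> ennreal ((norm (X r \<omega>))\<^sup>2)
        + ennreal (K\<^sup>2) * (ennreal ((norm (X r \<omega>))\<^sup>2) + ennreal (v \<omega>))" .
    qed
    also have "\<dots> = (\<integral>\<^sup>+\<omega>. ennreal ((norm (X r \<omega>))\<^sup>2) \<partial>M)
        + ennreal (K\<^sup>2) * ((\<integral>\<^sup>+\<omega>. ennreal ((norm (X r \<omega>))\<^sup>2) \<partial>M) + (\<integral>\<^sup>+\<omega>. ennreal (v \<omega>) \<partial>M))"
      by (simp add: nn_integral_add nn_integral_cmult)
    also have "\<dots> \<le> e"
      unfolding e_def by (intro add_mono mult_left_mono sol(2) r v) auto
    finally show ?thesis .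
  qed
  show ?thesis
  proof (rule that[of "enn2real e"])
    fix r assume r: "0 \<le> r" "r \<le> T"
    have [measurable]: "X r \<in> borel_measurable M"
      by (rule F_measurable_M[OF sol(1)[OF r] r(1)])
    have int: "integrable M (\<lambda>\<omega>. energy (X r \<omega>))"
      using le_less_trans[OF main[OF r] e_fin]
      by (intro integrableI_nonneg) (auto simp: energy_nonneg)
    have le: "ennreal (\<integral>\<omega>. energy (X r \<omega>) \<partial>M) \<le> e"
      using main[OF r] nn_integral_eq_integral[OF int] by (simp add: energy_nonneg)
    have "(\<integral>\<omega>. energy (X r \<omega>) \<partial>M) \<le> enn2real e"
      using enn2real_mono[OF le] e_fin by (simp add: energy_nonneg)
    with int show "integrable M (\<lambda>\<omega>. energy (X r \<omega>)) \<and> (\<integral>\<omega>. energy (X r \<omega>) \<partial>M) \<le> enn2real e" ..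
  qed
qed

lemma solution_adapted:
  assumes X: "solution T x X" and r: "0 \<le> r" "r \<le> T"
  shows "X r \<in> borel_measurable (F r)" "X r \<in> borel_measurable M"
    "AE \<omega> in M. X r \<omega> \<in> dom C"
    "(\<lambda>p. X (fst p) (snd p)) \<in> borel_measurable (leb r \<Otimes>\<^sub>M M)"
    "sq_integrable M (X r)" "(\<integral>\<omega>. (norm (X r \<omega>))\<^sup>2 \<partial>M) \<le> (norm x)\<^sup>2"
proof -
  have F: "\<And>q. 0 \<le> q \<Longrightarrow> q \<le> T \<Longrightarrow> X q \<in> borel_measurable (F q)"
    and dom: "AE \<omega> in M. X r \<omega> \<in> dom C"
    and nn: "(\<integral>\<^sup>+\<omega>. ennreal ((norm (X r \<omega>))\<^sup>2) \<partial>M) \<le> ennreal ((norm x)\<^sup>2)"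
    and cont: "\<And>\<omega>. \<omega> \<in> space M \<Longrightarrow> continuous_on {0..T} (\<lambda>t. X t \<omega>)"
    using X r unfolding strong_C_solution_def by (auto simp: emeasure_space_1)
  have XM: "X q \<in> borel_measurable M" if "0 \<le> q" "q \<le> T" for q
    using F that by (intro F_measurable_M[OF F]) auto
  show "X r \<in> borel_measurable (F r)" "X r \<in> borel_measurable M" "AE \<omega> in M. X r \<omega> \<in> dom C"
    using F XM r dom by auto
  show "(\<lambda>p. X (fst p) (snd p)) \<in> borel_measurable (leb r \<Otimes>\<^sub>M M)"
    by (rule caratheodory_measurable[OF r(1)])
      (use XM r in \<open>auto intro: continuous_on_subset[OF cont]\<close>)
  show sq: "sq_integrable M (X r)"
    unfolding sq_integrable_iff_nn using XM[OF r] le_less_trans[OF nn] by auto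
  have "ennreal (\<integral>\<omega>. (norm (X r \<omega>))\<^sup>2 \<partial>M) \<le> ennreal ((norm x)\<^sup>2)"
    using nn sq by (subst (asm) nn_integral_eq_integral) (auto simp: sq_integrable_def)
  then show "(\<integral>\<omega>. (norm (X r \<omega>))\<^sup>2 \<partial>M) \<le> (norm x)\<^sup>2"
    by simp
qed

lemma solution_ito_process:
  assumes X: "solution T x X" and T: "0 < T"
  shows "ito_process T x (\<lambda>r \<omega>. Gp (X r \<omega>)) (\<lambda>k r \<omega>. Lp k (X r \<omega>)) X"
proof -
  obtain E where E: "\<And>r. 0 \<le> r \<Longrightarrow> r \<le> T \<Longrightarrow>
    integrable M (\<lambda>\<omega>. energy (X r \<omega>)) \<and> (\<integral>\<omega>. energy (X r \<omega>) \<partial>M) \<le> E"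
    by (rule energy_bound[OF X T]) (rule that)
  show ?thesis
    unfolding ito_process_def
  proof (intro exI[of _ E] ballI)
    fix t assume t': "t \<in> {0..T}"
    then have t: "0 \<le> t" "t \<le> T" by auto
    note A = solution_adapted[OF X t]
    have GF: "(\<lambda>\<omega>. Gp (X t \<omega>)) \<in> borel_measurable (F t)"
      by (rule measurable_compose[OF A(1) Gp_measurable])
    have Gsq: "sq_integrable M (\<lambda>\<omega>. Gp (X t \<omega>))"
      by (rule sq_integrable_bound[where g = "\<lambda>\<omega>. energy (X t \<omega>)"])
        (use A(2) E[OF t] in \<open>auto simp: energy_def\<close>)
    have "(\<integral>\<omega>. (norm (Gp (X t \<omega>)))\<^sup>2 \<partial>M) \<le> (\<integral>\<omega>. energy (X t \<omega>) \<partial>M)"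
      using Gsq E[OF t] by (intro integral_mono) (auto simp: sq_integrable_def energy_def)
    with E[OF t] have GE: "(\<integral>\<omega>. (norm (Gp (X t \<omega>)))\<^sup>2 \<partial>M) \<le> E" by linarith
    have Gm: "(\<lambda>p. Gp (X (fst p) (snd p))) \<in> borel_measurable (leb t \<Otimes>\<^sub>M M)"
      by (rule measurable_compose[OF A(4) Gp_measurable])
    obtain J S where J: "\<And>k. has_ito_integral M F (W k) t (\<lambda>s \<omega>. L k \<odot> \<pi> C (X s \<omega>)) (J k)"
      and S: "S \<in> borel_measurable M" "(\<lambda>n. \<integral>\<^sup>+\<omega>. ennreal ((norm ((\<Sum>k<n. J k \<omega>) - S \<omega>))\<^sup>2) \<partial>M) \<longlonglongrightarrow> 0"
      and eq: "AE \<omega> in M. set_integrable lborel {0..t} (\<lambda>s. G \<odot> \<pi> C (X s \<omega>)) \<and>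
              X t \<omega> = x + (LINT s:{0..t}|lborel. G \<odot> \<pi> C (X s \<omega>)) + S \<omega>"
      using X t' unfolding strong_C_solution_def by blast
    have "L2_tendsto M (\<lambda>n \<omega>. \<Sum>k<n. J k \<omega>) S"
      using S(2) by (intro L2_tendstoI_nn[OF sq_integrable_sum S(1)] has_ito_integral_sq_integrable(1)[OF J t(1)])
        (simp add: norm_minus_commute)
    with J have "ito_sum t (\<lambda>k r \<omega>. Lp k (X r \<omega>)) S"
      unfolding ito_sum_def Lp_def by blast
    moreover have "AE \<omega> in M. X t \<omega> = x + (\<integral>r. Gp (X r \<omega>) \<partial>leb t) + S \<omega>"
      using eq by eventually_elim (simp add: integral_leb Gp_def)
    ultimately have "\<exists>S. ito_sum t (\<lambda>k r \<omega>. Lp k (X r \<omega>)) S \<and> (AE \<omega> in M. X t \<omega> = x + (\<integral>r. Gp (X r \<omega>) \<partial>leb t) + S \<omega>)"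
      by blast
    with A GF Gsq GE Gm show "X t \<in> borel_measurable (F t) \<and> sq_integrable M (X t) \<and>
      (\<lambda>\<omega>. Gp (X t \<omega>)) \<in> borel_measurable (F t) \<and> sq_integrable M (\<lambda>\<omega>. Gp (X t \<omega>)) \<and>
      (\<integral>\<omega>. (norm (Gp (X t \<omega>)))\<^sup>2 \<partial>M) \<le> E \<and>
      (\<lambda>p. Gp (X (fst p) (snd p))) \<in> borel_measurable (leb t \<Otimes>\<^sub>M M) \<and>
      (\<exists>S. ito_sum t (\<lambda>k r \<omega>. Lp k (X r \<omega>)) S \<and> (AE \<omega> in M. X t \<omega> = x + (\<integral>r. Gp (X r \<omega>) \<partial>leb t) + S \<omega>))"
      by blast
  qed
qed

text \<open>\<open>ito_formula\<close> leaves the noise contribution as a limit of partial sums over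
  \<open>k\<close>. The energies of \<open>X\<close> and \<open>Y\<close> dominate all partial sums
  at once, so the sum can be moved inside both integrals, where it joins the two drift
  terms.\<close>

theorem solution_ito_formula:
  assumes b: "bounded_bilinear b"
    and X: "solution T x X" "0 < T"
    and Y: "solution T' y Y" "0 < T'"
    and t: "0 \<le> t" "t \<le> T" "t \<le> T'"
  shows "(\<lambda>p. Phi b (X (fst p) (snd p)) (Y (fst p) (snd p))) \<in> borel_measurable (leb t \<Otimes>\<^sub>M M)"
    and "(\<integral>\<omega>. b (X t \<omega>) (Y t \<omega>) \<partial>M) = b x y + (\<integral>r. (\<integral>\<omega>. Phi b (X r \<omega>) (Y r \<omega>) \<partial>M) \<partial>leb t)"
proof -
  interpret b: bounded_bilinear b by (rule b)
  interpret P: pair_sigma_finite "leb t" M by (rule pair_leb)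
  obtain K where K: "\<And>x y. norm (b x y) \<le> norm x * norm y * K" "0 \<le> K"
    using b.nonneg_bounded by blast
  obtain E where E: "\<And>r. 0 \<le> r \<Longrightarrow> r \<le> T \<Longrightarrow>
    integrable M (\<lambda>\<omega>. energy (X r \<omega>)) \<and> (\<integral>\<omega>. energy (X r \<omega>) \<partial>M) \<le> E"
    by (rule energy_bound[OF X]) (rule that)
  obtain E' where E': "\<And>r. 0 \<le> r \<Longrightarrow> r \<le> T' \<Longrightarrow>
    integrable M (\<lambda>\<omega>. energy (Y r \<omega>)) \<and> (\<integral>\<omega>. energy (Y r \<omega>) \<partial>M) \<le> E'"
    by (rule energy_bound[OF Y]) (rule that)
  note Xm [measurable] = solution_adapted(4)[OF X(1) t(1,2)]
    and Ym [measurable] = solution_adapted(4)[OF Y(1) t(1,3)]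
  have bm: "(\<lambda>p. b (f p) (g p)) \<in> borel_measurable N" if "f \<in> borel_measurable N" "g \<in> borel_measurable N" for f g and N :: "'x measure"
    by (rule borel_measurable_bilinear[OF b that])
  let ?X = "\<lambda>p. X (fst p) (snd p)" and ?Y = "\<lambda>p. Y (fst p) (snd p)"
  have Lm: "(\<lambda>p. b (Lp k (?X p)) (Lp k (?Y p))) \<in> borel_measurable (leb t \<Otimes>\<^sub>M M)" for k
    by (intro bm) measurable
  have Sm: "(\<lambda>p. \<Sum>k. b (Lp k (?X p)) (Lp k (?Y p))) \<in> borel_measurable (leb t \<Otimes>\<^sub>M M)"
    by (intro borel_measurable_suminf Lm)
  have "(\<lambda>p. b (Gp (?X p)) (?Y p)) \<in> borel_measurable (leb t \<Otimes>\<^sub>M M)"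
    "(\<lambda>p. b (?X p) (Gp (?Y p))) \<in> borel_measurable (leb t \<Otimes>\<^sub>M M)"
    by (intro bm; measurable)+
  with Sm show "(\<lambda>p. Phi b (?X p) (?Y p)) \<in> borel_measurable (leb t \<Otimes>\<^sub>M M)"
    unfolding Phi_def by (intro borel_measurable_add)
  have energy_pair: "integrable (leb t \<Otimes>\<^sub>M M) (\<lambda>p. energy (Z (fst p) (snd p)))"
    if [measurable]: "(\<lambda>p. Z (fst p) (snd p)) \<in> borel_measurable (leb t \<Otimes>\<^sub>M M)"
      and Z: "\<And>r. 0 \<le> r \<Longrightarrow> r \<le> t \<Longrightarrow> integrable M (\<lambda>\<omega>. energy (Z r \<omega>)) \<and> (\<integral>\<omega>. energy (Z r \<omega>) \<partial>M) \<le> c" for Z c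
  proof (rule P.Fubini_integrable)
    show "AE r in leb t. integrable M (\<lambda>\<omega>. energy (Z (fst (r, \<omega>)) (snd (r, \<omega>))))"
      using Z by (intro AE_I2) auto
    have m: "(\<lambda>r. \<integral>\<omega>. energy (Z r \<omega>) \<partial>M) \<in> borel_measurable (leb t)"
      by (rule borel_measurable_lebesgue_integral) (simp add: case_prod_unfold)
    then show "integrable (leb t) (\<lambda>r. \<integral>\<omega>. norm (energy (Z (fst (r, \<omega>)) (snd (r, \<omega>)))) \<partial>M)"
      using Z by (intro finite_measure.integrable_const_bound[OF finite_measure_leb, of _ c])
        (auto simp: energy_nonneg integral_nonneg intro!: AE_I2)
  qed measurable
  have dom: "integrable (leb t \<Otimes>\<^sub>M M) (\<lambda>p. K * ((energy (?X p) + energy (?Y p)) / 2))"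
    using energy_pair[OF Xm, of E] energy_pair[OF Ym, of E'] E E' t by auto
  have lim: "(\<lambda>n. \<integral>p. (\<Sum>k<n. b (Lp k (?X p)) (Lp k (?Y p))) \<partial>(leb t \<Otimes>\<^sub>M M)) \<longlonglongrightarrow>
      (\<integral>p. (\<Sum>k. b (Lp k (?X p)) (Lp k (?Y p))) \<partial>(leb t \<Otimes>\<^sub>M M))"
    by (rule integral_dominated_convergence[OF Sm _ dom])
      (intro borel_measurable_sum Lm AE_I2 summable_LIMSEQ summable_bilinear_Lp[OF b K] norm_sum_bilinear_Lp_le(1)[OF b K])+
  have Sint: "integrable (leb t \<Otimes>\<^sub>M M) (\<lambda>p. \<Sum>k. b (Lp k (?X p)) (Lp k (?Y p)))"
    by (rule Bochner_Integration.integrable_bound[OF dom Sm])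
      (unfold real_norm_def, intro AE_I2 order_trans[OF norm_suminf_bilinear_Lp_le[OF b K] abs_ge_self])
  note iX = solution_ito_process[OF X] and iY = solution_ito_process[OF Y]
  have sum_eq: "(\<Sum>k<n. \<integral>p. b (Lp k (?X p)) (Lp k (?Y p)) \<partial>(leb t \<Otimes>\<^sub>M M))
    = (\<integral>p. (\<Sum>k<n. b (Lp k (?X p)) (Lp k (?Y p))) \<partial>(leb t \<Otimes>\<^sub>M M))" for n
  proof (rule Bochner_Integration.integral_sum[symmetric])
    fix k
    obtain S S' where "ito_sum t (\<lambda>k r \<omega>. Lp k (X r \<omega>)) S" "ito_sum t (\<lambda>k r \<omega>. Lp k (Y r \<omega>)) S'"
      using iX iY t unfolding ito_process_def by (meson atLeastAtMost_iff)
    then show "integrable (leb t \<Otimes>\<^sub>M M) (\<lambda>p. b (Lp k (?X p)) (Lp k (?Y p)))"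
      by (intro sq_integrable_bilinear[OF b]) (auto dest: ito_sum_integrand_sq_integrable[OF _ t(1)])
  qed
  let ?d = "\<lambda>r. (\<integral>\<omega>. b (Gp (X r \<omega>)) (Y r \<omega>) \<partial>M) + (\<integral>\<omega>. b (X r \<omega>) (Gp (Y r \<omega>)) \<partial>M)"
  have "(\<integral>\<omega>. b (X t \<omega>) (Y t \<omega>) \<partial>M) - b x y - (\<integral>r. ?d r \<partial>leb t)
    = (\<integral>p. (\<Sum>k. b (Lp k (?X p)) (Lp k (?Y p))) \<partial>(leb t \<Otimes>\<^sub>M M))"
    using LIMSEQ_unique[OF ito_formula(2)[OF b iX iY t, unfolded sum_eq] lim] .
  also have "\<dots> = (\<integral>r. (\<integral>\<omega>. (\<Sum>k. b (Lp k (X r \<omega>)) (Lp k (Y r \<omega>))) \<partial>M) \<partial>leb t)"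
    using P.integral_fst'[OF Sint] by simp
  finally have eq: "(\<integral>\<omega>. b (X t \<omega>) (Y t \<omega>) \<partial>M) = b x y + ((\<integral>r. ?d r \<partial>leb t)
      + (\<integral>r. (\<integral>\<omega>. (\<Sum>k. b (Lp k (X r \<omega>)) (Lp k (Y r \<omega>))) \<partial>M) \<partial>leb t))"
    by (simp add: algebra_simps)
  have i2: "integrable (leb t) (\<lambda>r. \<integral>\<omega>. (\<Sum>k. b (Lp k (X r \<omega>)) (Lp k (Y r \<omega>))) \<partial>M)"
    using P.integrable_fst'[OF Sint] by simp
  have "(\<integral>r. ?d r \<partial>leb t) + (\<integral>r. (\<integral>\<omega>. (\<Sum>k. b (Lp k (X r \<omega>)) (Lp k (Y r \<omega>))) \<partial>M) \<partial>leb t)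
    = (\<integral>r. ?d r + (\<integral>\<omega>. (\<Sum>k. b (Lp k (X r \<omega>)) (Lp k (Y r \<omega>))) \<partial>M) \<partial>leb t)"
    by (rule Bochner_Integration.integral_add[OF ito_formula(1)[OF b iX iY t] i2, symmetric])
  also have "\<dots> = (\<integral>r. (\<integral>\<omega>. Phi b (X r \<omega>) (Y r \<omega>) \<partial>M) \<partial>leb t)"
  proof (rule Bochner_Integration.integral_cong[OF refl])
    fix r assume "r \<in> space (leb t)"
    then have r: "0 \<le> r" "r \<le> T" "r \<le> T'" using t by auto
    have sq: "sq_integrable M (X r)" "sq_integrable M (Y r)"
      "sq_integrable M (\<lambda>\<omega>. Gp (X r \<omega>))" "sq_integrable M (\<lambda>\<omega>. Gp (Y r \<omega>))"
      using iX iY r unfolding ito_process_def by (meson atLeastAtMost_iff)+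
    have [measurable]: "X r \<in> borel_measurable M" "Y r \<in> borel_measurable M"
      using sq by auto
    have "integrable M (\<lambda>\<omega>. \<Sum>k. b (Lp k (X r \<omega>)) (Lp k (Y r \<omega>)))"
    proof (rule Bochner_Integration.integrable_bound)
      show "integrable M (\<lambda>\<omega>. K * ((energy (X r \<omega>) + energy (Y r \<omega>)) / 2))"
        using E[of r] E'[of r] r by auto
      show "(\<lambda>\<omega>. \<Sum>k. b (Lp k (X r \<omega>)) (Lp k (Y r \<omega>))) \<in> borel_measurable M"
        by (intro borel_measurable_suminf bm) measurable
    qed (unfold real_norm_def, intro AE_I2 order_trans[OF norm_suminf_bilinear_Lp_le[OF b K] abs_ge_self])
    then show "?d r + (\<integral>\<omega>. (\<Sum>k. b (Lp k (X r \<omega>)) (Lp k (Y r \<omega>))) \<partial>M) = (\<integral>\<omega>. Phi b (X r \<omega>) (Y r \<omega>) \<partial>M)"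
      unfolding Phi_def
      using sq_integrable_bilinear[OF b sq(3) sq(2)] sq_integrable_bilinear[OF b sq(1) sq(4)] by simp
  qed
  finally show "(\<integral>\<omega>. b (X t \<omega>) (Y t \<omega>) \<partial>M) = b x y + (\<integral>r. (\<integral>\<omega>. Phi b (X r \<omega>) (Y r \<omega>) \<partial>M) \<partial>leb t)"
    unfolding eq by simp
qed

end

section \<open>Bilinear forms given by bounded operators\<close>

lemma bounded_clinear_linear: "bounded_clinear B \<Longrightarrow> bounded_linear B"
  by (simp add: bounded_clinear_def)

lemma bounded_clinear_scaleC: "bounded_clinear B \<Longrightarrow> B (a *\<^sub>C x) = a *\<^sub>C B x"
  by (simp add: bounded_clinear_def)

lemma bounded_bilinear_cinner_op:
  "bounded_clinear B \<Longrightarrow> bounded_bilinear (\<lambda>x y. cinner x (B y))"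
  using bounded_bilinear.comp[OF bounded_bilinear_cinner bounded_linear_ident bounded_clinear_linear[of B]]
  by simp

lemma norm_cinner_op_le:
  assumes "bounded_clinear B" "onorm B \<le> c"
  shows "norm (cinner x (B y)) \<le> norm x * norm y * c"
proof -
  have "norm (B y) \<le> c * norm y"
    using onorm[OF bounded_clinear_linear[OF assms(1)], of y] mult_right_mono[OF assms(2) norm_ge_zero[of y]]
    by linarith
  from mult_left_mono[OF this norm_ge_zero[of x]] norm_cinner_le[of x "B y"] show ?thesis
    by (simp add: mult_ac)
qed

context linear_sse
begin

section \<open>The evolution of observables\<close>

lemma Phi_cinner_self:
  assumes "x \<in> dom C" shows "Phi cinner x x = 0"
proof -
  have "(\<Sum>k. cinner (Lp k x) (Lp k x)) = complex_of_real (\<Sum>k. (norm (Lp k x))\<^sup>2)"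
    unfolding cinner_self by (rule suminf_of_real[OF summable_Lp, symmetric])
  moreover have "cinner (Gp x) x + cinner x (Gp x) = complex_of_real (2 * Re (cinner x (Gp x)))"
    using complex_add_cnj[of "cinner x (Gp x)"] cinner_commute[of "Gp x" x] by (simp add: add.commute)
  ultimately show ?thesis
    unfolding Phi_def suminf_Lp by simp
qed

lemma Phi_cinner_add_scale:
  assumes x: "x \<in> dom C" and y: "y \<in> dom C"
  shows "Phi cinner (x + a *\<^sub>C y) (x + a *\<^sub>C y) =
    Phi cinner x x + a * Phi cinner x y + cnj a * Phi cinner y x + a * cnj a * Phi cinner y y"
proof -
  note D = csubspaceD[OF dom_C(1)]
  have s: "(\<lambda>k. cinner (Lp k u) (Lp k v)) sums (\<Sum>k. cinner (Lp k u) (Lp k v))" for u v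
    by (rule summable_sums[OF summable_bilinear_Lp[OF bounded_bilinear_cinner, of 1]])
      (simp_all add: norm_cinner_le)
  have "cinner (Lp k (x + a *\<^sub>C y)) (Lp k (x + a *\<^sub>C y)) =
    cinner (Lp k x) (Lp k x) + a * cinner (Lp k x) (Lp k y) + cnj a * cinner (Lp k y) (Lp k x)
      + a * cnj a * cinner (Lp k y) (Lp k y)" for k
    using D(3)[OF y, of a] x y
    by (simp add: Lp_add Lp_scaleC cinner_add_left cinner_add_right cinner_scaleC_left cinner_scaleC_right algebra_simps)
  then have "(\<Sum>k. cinner (Lp k (x + a *\<^sub>C y)) (Lp k (x + a *\<^sub>C y))) =
    (\<Sum>k. cinner (Lp k x) (Lp k x)) + a * (\<Sum>k. cinner (Lp k x) (Lp k y)) + cnj a * (\<Sum>k. cinner (Lp k y) (Lp k x))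
      + a * cnj a * (\<Sum>k. cinner (Lp k y) (Lp k y))"
    using sums_unique[OF sums_add[OF sums_add[OF sums_add[OF s[of x x] sums_mult[OF s[of x y], of a]]
          sums_mult[OF s[of y x], of "cnj a"]] sums_mult[OF s[of y y], of "a * cnj a"]]]
    by simp
  then show ?thesis
    using D(3)[OF y, of a] x y unfolding Phi_def
    by (simp add: Gp_add Gp_scaleC cinner_add_left cinner_add_right cinner_scaleC_left cinner_scaleC_right algebra_simps)
qed

lemma Phi_cinner_zero:
  assumes x: "x \<in> dom C" and y: "y \<in> dom C"
  shows "Phi cinner x y = 0"
proof -
  have *: "a * Phi cinner x y + cnj a * Phi cinner y x = 0" for a
    using Phi_cinner_add_scale[OF x y, of a] Phi_cinner_self x y csubspaceD[OF dom_C(1)] by simp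
  \<comment> \<open>The values \<open>1\<close> and \<open>\<i>\<close> give the sum and the
    difference of the two mixed terms.\<close>
  from *[of 1] *[of \<i>] have "Phi cinner x y + Phi cinner y x = 0" "\<i> * (Phi cinner x y - Phi cinner y x) = 0"
    by (simp_all add: algebra_simps)
  then show ?thesis by simp
qed

lemma solution_inner:
  assumes X: "solution T x X" "0 < T"
    and Y: "solution T' y Y" "0 < T'"
    and t: "0 \<le> t" "t \<le> T" "t \<le> T'"
  shows "(\<integral>\<omega>. cinner (X t \<omega>) (Y t \<omega>) \<partial>M) = cinner x y"
proof -
  have "(\<integral>\<omega>. Phi cinner (X r \<omega>) (Y r \<omega>) \<partial>M) = 0" if "r \<in> space (leb t)" for r
  proof (rule integral_eq_zero_AE)
    have r: "0 \<le> r" "r \<le> T" "r \<le> T'" using that t by auto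
    show "AE \<omega> in M. Phi cinner (X r \<omega>) (Y r \<omega>) = 0"
      using solution_adapted(3)[OF X(1) r(1,2)] solution_adapted(3)[OF Y(1) r(1,3)]
      by eventually_elim (rule Phi_cinner_zero)
  qed
  then have "(\<integral>r. (\<integral>\<omega>. Phi cinner (X r \<omega>) (Y r \<omega>) \<partial>M) \<partial>leb t) = (\<integral>r. 0 \<partial>leb t)"
    by (rule Bochner_Integration.integral_cong[OF refl])
  then show ?thesis
    using solution_ito_formula(2)[OF bounded_bilinear_cinner X Y t] by simp
qed

text \<open>By the previous lemma the expected squared distance of \<open>Z\<^sub>t\<close> and \<open>X\<^sub>t + a Y\<^sub>t\<close> equals that of
  the initial data. For \<open>a = 0\<close> this is uniqueness of strong solutions.\<close>

lemma solution_linear: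
  assumes X: "solution T x X" "0 < T" "t \<le> T"
    and Y: "solution T' y Y" "0 < T'" "t \<le> T'"
    and Z: "solution T'' (x + a *\<^sub>C y) Z" "0 < T''" "t \<le> T''"
    and t: "0 \<le> t"
  shows "AE \<omega> in M. Z t \<omega> = X t \<omega> + a *\<^sub>C Y t \<omega>"
proof -
  note XX = solution_inner[OF X(1,2) X(1,2) t X(3) X(3)] and XY = solution_inner[OF X(1,2) Y(1,2) t X(3) Y(3)]
    and XZ = solution_inner[OF X(1,2) Z(1,2) t X(3) Z(3)] and YX = solution_inner[OF Y(1,2) X(1,2) t Y(3) X(3)]
    and YY = solution_inner[OF Y(1,2) Y(1,2) t Y(3) Y(3)] and YZ = solution_inner[OF Y(1,2) Z(1,2) t Y(3) Z(3)]
    and ZX = solution_inner[OF Z(1,2) X(1,2) t Z(3) X(3)] and ZY = solution_inner[OF Z(1,2) Y(1,2) t Z(3) Y(3)]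
    and ZZ = solution_inner[OF Z(1,2) Z(1,2) t Z(3) Z(3)]
  note sX = solution_adapted(5)[OF X(1) t X(3)] and sY = solution_adapted(5)[OF Y(1) t Y(3)]
    and sZ = solution_adapted(5)[OF Z(1) t Z(3)]
  note i = sq_integrable_bilinear[OF bounded_bilinear_cinner]
  let ?D = "\<lambda>\<omega>. Z t \<omega> - (X t \<omega> + a *\<^sub>C Y t \<omega>)"
  have Dm: "?D \<in> borel_measurable M"
  proof -
    have "continuous_on UNIV (\<lambda>v. a *\<^sub>C v :: 'h)"
      by (rule linear_continuous_on, rule bounded_linear_intro[of _ "cmod a"])
        (simp_all add: scaleC_add_right norm_scaleC mult.commute scaleC_scaleC scaleC_of_real[symmetric])
    then have [measurable]: "(\<lambda>v. a *\<^sub>C v :: 'h) \<in> borel_measurable borel"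
      by (rule borel_measurable_continuous_onI)
    have [measurable]: "X t \<in> borel_measurable M" "Y t \<in> borel_measurable M" "Z t \<in> borel_measurable M"
      using sX sY sZ by auto
    show ?thesis by measurable
  qed
  have expand: "cinner (w - (u + a *\<^sub>C v)) (w - (u + a *\<^sub>C v)) =
      cinner w w - cinner w u - a * cinner w v - cinner u w + cinner u u + a * cinner u v
      - cnj a * cinner v w + cnj a * cinner v u + cnj a * a * cinner v v" for u v w :: 'h
    by (simp add: cinner_diff_left cinner_diff_right cinner_add_left cinner_add_right cinner_scaleC_left
        cinner_scaleC_right algebra_simps)
  have int: "integrable M (\<lambda>\<omega>. cinner (?D \<omega>) (?D \<omega>))"
    unfolding expand using i[OF sX sX] i[OF sX sY] i[OF sX sZ] i[OF sY sX] i[OF sY sY] i[OF sY sZ] i[OF sZ sX] i[OF sZ sY] i[OF sZ sZ]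
    by simp
  \<comment> \<open>One algebraic expansion serves both sides; term by term the nine expectations
    are inner products of the initial data, whose combination is zero.\<close>
  have "(\<integral>\<omega>. cinner (?D \<omega>) (?D \<omega>) \<partial>M) = cinner ((x + a *\<^sub>C y) - (x + a *\<^sub>C y)) ((x + a *\<^sub>C y) - (x + a *\<^sub>C y))"
    unfolding expand using i[OF sX sX] i[OF sX sY] i[OF sX sZ] i[OF sY sX] i[OF sY sY] i[OF sY sZ] i[OF sZ sX] i[OF sZ sY] i[OF sZ sZ]
    by (simp add: XX XY XZ YX YY YZ ZX ZY ZZ)
  then have zero: "(\<integral>\<omega>. complex_of_real ((norm (?D \<omega>))\<^sup>2) \<partial>M) = 0"
    unfolding cinner_self by simp
  have "integrable M (\<lambda>\<omega>. Re (complex_of_real ((norm (?D \<omega>))\<^sup>2)))"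
    using int unfolding cinner_self by (rule integrable_Re)
  then have int': "integrable M (\<lambda>\<omega>. (norm (?D \<omega>))\<^sup>2)"
    by (simp only: Re_complex_of_real)
  have "(\<integral>\<omega>. (norm (?D \<omega>))\<^sup>2 \<partial>M) = 0"
    using zero by (simp only: integral_of_real[OF int'] of_real_eq_0_iff)
  then have "AE \<omega> in M. (norm (?D \<omega>))\<^sup>2 = 0"
    using integral_nonneg_eq_0_iff_AE[OF int'] by simp
  then show ?thesis
    by eventually_elim (simp add: right_minus_eq)
qed

lemma solution_cong:
  assumes X: "solution T x X" "0 < T" "t \<le> T"
    and X': "solution T' x X'" "0 < T'" "t \<le> T'"
    and t: "0 \<le> t"
  shows "AE \<omega> in M. X' t \<omega> = X t \<omega>"
proof -
  have 0: "0 *\<^sub>C v = 0" for v :: 'h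
    using norm_scaleC[of 0 v] by simp
  show ?thesis
    using solution_linear[OF X X _ X'(2,3) t, of 0 X'] X'(1) by (simp add: 0)
qed

text \<open>Cauchy-Schwarz together with the bound of the second moment of \<open>X t\<close> by
  that of the initial datum, a clause in the definition of a strong solution. It makes the form
  bounded and later yields the norm estimate for \<T>.\<close>

lemma solution_form_bound:
  assumes X: "solution T x X" "0 < T" "t \<le> T"
    and Y: "solution T' y Y" "0 < T'" "t \<le> T'"
    and t: "0 \<le> t" and A: "bounded_clinear A"
  shows "cmod (\<integral>\<omega>. cinner (X t \<omega>) (A (Y t \<omega>)) \<partial>M) \<le> onorm A * norm x * norm y"
proof -
  note aX = solution_adapted(5,6)[OF X(1) t X(3)] and aY = solution_adapted(5,6)[OF Y(1) t Y(3)]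
  have A0: "0 \<le> onorm A"
    by (rule onorm_pos_le[OF bounded_clinear_linear[OF A]])
  have "cmod (\<integral>\<omega>. cinner (X t \<omega>) (A (Y t \<omega>)) \<partial>M)
    \<le> sqrt (\<integral>\<omega>. (norm (X t \<omega>))\<^sup>2 \<partial>M) * sqrt (\<integral>\<omega>. (norm (Y t \<omega>))\<^sup>2 \<partial>M) * onorm A"
    by (rule norm_integral_bilinear_le[OF bounded_bilinear_cinner_op[OF A] norm_cinner_op_le[OF A order_refl] A0 aX(1) aY(1)])
  also have "\<dots> \<le> norm x * norm y * onorm A"
    using aX(2) aY(2) A0 by (intro mult_right_mono mult_mono real_le_lsqrt) auto
  finally show ?thesis by (simp add: mult_ac)
qed

context
  fixes X :: "real \<Rightarrow> 'h \<Rightarrow> real \<Rightarrow> 'w \<Rightarrow> 'h" and A :: "'h \<Rightarrow> 'h"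
  assumes X: "\<And>T x. 0 < T \<Longrightarrow> x \<in> dom C \<Longrightarrow> solution T x (X T x)"
    and A: "bounded_clinear A"
begin

lemma heisenberg_evolution_exists:
  assumes t: "0 \<le> t"
  shows "\<exists>B. heisenberg_evolution M C X A t B"
proof -
  \<comment> \<open>A horizon must be positive, also when \<open>t = 0\<close>.\<close>
  define T where "T = t + 1"
  have T: "0 < T" "t \<le> T" using t by (auto simp: T_def)
  note D = csubspaceD[OF dom_C(1)]
  let ?b = "\<lambda>u v. cinner u (A v)"
  note b = bounded_bilinear_cinner_op[OF A]
  define q where "q x y = (\<integral>\<omega>. ?b (X T x t \<omega>) (X T y t \<omega>) \<partial>M)" for x y
  have sol: "solution T x (X T x)" "0 < T" "t \<le> T" if "x \<in> dom C" for x
    using X T that by auto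
  have sq: "sq_integrable M (X T x t)" if "x \<in> dom C" for x
    by (rule solution_adapted(5)[OF sol(1)[OF that] t T(2)])
  have i: "integrable M (\<lambda>\<omega>. ?b (X T x t \<omega>) (X T y t \<omega>))" if "x \<in> dom C" "y \<in> dom C" for x y
    using that by (intro sq_integrable_bilinear[OF b] sq)
  have A_add: "A (u + a *\<^sub>C v) = A u + a *\<^sub>C A v" for u v a
    using bounded_clinear_scaleC[OF A] bounded_linear.linear[OF bounded_clinear_linear[OF A]]
    by (simp add: linear_add)
  have q_right: "q x (y + a *\<^sub>C y') = q x y + a * q x y'" if xy: "x \<in> dom C" "y \<in> dom C" "y' \<in> dom C" for a x y y'
  proof -
    have yy: "y + a *\<^sub>C y' \<in> dom C" using xy D by blast
    have "q x (y + a *\<^sub>C y') = (\<integral>\<omega>. ?b (X T x t \<omega>) (X T y t \<omega>) + a * ?b (X T x t \<omega>) (X T y' t \<omega>) \<partial>M)"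
      unfolding q_def
    proof (rule integral_cong_AE)
      show "AE \<omega> in M. ?b (X T x t \<omega>) (X T (y + a *\<^sub>C y') t \<omega>) =
        ?b (X T x t \<omega>) (X T y t \<omega>) + a * ?b (X T x t \<omega>) (X T y' t \<omega>)"
        using solution_linear[OF sol[OF xy(2)] sol[OF xy(3)] sol[OF yy] t]
        by eventually_elim (simp add: A_add cinner_add_right cinner_scaleC_right)
    qed (intro borel_measurable_integrable Bochner_Integration.integrable_add integrable_mult_right i xy yy)+
    then show ?thesis
      using i xy by (simp add: q_def)
  qed
  have q_left: "q (x + a *\<^sub>C x') y = q x y + cnj a * q x' y" if xy: "x \<in> dom C" "x' \<in> dom C" "y \<in> dom C" for a x x' y
  proof -
    have xx: "x + a *\<^sub>C x' \<in> dom C" using xy D by blast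
    have "q (x + a *\<^sub>C x') y = (\<integral>\<omega>. ?b (X T x t \<omega>) (X T y t \<omega>) + cnj a * ?b (X T x' t \<omega>) (X T y t \<omega>) \<partial>M)"
      unfolding q_def
    proof (rule integral_cong_AE)
      show "AE \<omega> in M. ?b (X T (x + a *\<^sub>C x') t \<omega>) (X T y t \<omega>) =
        ?b (X T x t \<omega>) (X T y t \<omega>) + cnj a * ?b (X T x' t \<omega>) (X T y t \<omega>)"
        using solution_linear[OF sol[OF xy(1)] sol[OF xy(2)] sol[OF xx] t]
        by eventually_elim (simp add: cinner_add_left cinner_scaleC_left)
    qed (intro borel_measurable_integrable Bochner_Integration.integrable_add integrable_mult_right i xy xx)+
    then show ?thesis
      using i xy by (simp add: q_def)
  qed
  have one: "1 *\<^sub>C v = v" for v :: 'h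
    using scaleC_of_real[of 1 v] by simp
  have zero: "q x 0 = 0" "q 0 x = 0" if "x \<in> dom C" for x
    using q_right[OF that D(1) D(1), of 1] q_left[OF D(1) D(1) that, of 1] by (simp_all add: one)
  have "\<exists>B. bounded_clinear B \<and> (\<forall>x\<in>dom C. \<forall>y\<in>dom C. cinner x (B y) = q x y)"
  proof (rule sesquilinear_form_operator[OF dom_C onorm_pos_le[OF bounded_clinear_linear[OF A]]])
    fix x x' y y' :: 'h and a
    assume xy: "x \<in> dom C" "y \<in> dom C"
    show "q x (y + y') = q x y + q x y'" if "y' \<in> dom C"
      using q_right[OF xy that, of 1] by (simp add: one)
    show "q (x + x') y = q x y + q x' y" if "x' \<in> dom C"
      using q_left[OF xy(1) that xy(2), of 1] by (simp add: one)
    show "q x (a *\<^sub>C y) = a * q x y"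
      using q_right[OF xy(1) D(1) xy(2), of a] zero(1)[OF xy(1)] by simp
    show "q (a *\<^sub>C x) y = cnj a * q x y"
      using q_left[OF D(1) xy(1) xy(2), of a] zero(2)[OF xy(2)] by simp
    show "cmod (q x y) \<le> onorm A * norm x * norm y"
      unfolding q_def by (rule solution_form_bound[OF sol[OF xy(1)] sol[OF xy(2)] t A])
  qed
  then obtain B where B: "bounded_clinear B" "\<And>x y. x \<in> dom C \<Longrightarrow> y \<in> dom C \<Longrightarrow> cinner x (B y) = q x y"
    by blast
  \<comment> \<open>\<open>q\<close> was formed with one horizon, while the definition of the
    evolution asks for all of them; solutions on different horizons agree almost surely at time
    \<open>t\<close>.\<close>
  have "q x y = (\<integral>\<omega>. cinner (X S x t \<omega>) (A (X S y t \<omega>)) \<partial>M)"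
    if xy: "x \<in> dom C" "y \<in> dom C" and S: "0 < S" "t \<le> S" for x y S
    unfolding q_def
  proof (rule integral_cong_AE)
    have solS: "solution S z (X S z)" "0 < S" "t \<le> S" if "z \<in> dom C" for z
      using X S that by auto
    show "AE \<omega> in M. ?b (X T x t \<omega>) (X T y t \<omega>) = ?b (X S x t \<omega>) (X S y t \<omega>)"
      using solution_cong[OF solS[OF xy(1)] sol[OF xy(1)] t] solution_cong[OF solS[OF xy(2)] sol[OF xy(2)] t]
      by eventually_elim simp
    show "(\<lambda>\<omega>. ?b (X S x t \<omega>) (X S y t \<omega>)) \<in> borel_measurable M"
      by (intro borel_measurable_bilinear[OF b] sq_integrable_measurable
          solution_adapted(5)[OF solS(1) t S(2)] xy)
  qed (intro borel_measurable_integrable i xy)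
  with B have "heisenberg_evolution M C X A t B"
    unfolding heisenberg_evolution_def by simp
  then show ?thesis by (rule exI[of _ B])
qed

lemma heisenberg_evolution_unique:
  assumes "0 \<le> t" "heisenberg_evolution M C X A t B" "heisenberg_evolution M C X A t B'"
  shows "B = B'"
proof (rule bounded_clinear_eq_dense[OF dom_C(2)])
  show "bounded_clinear B" "bounded_clinear B'"
    using assms by (auto simp: heisenberg_evolution_def)
  fix x y assume "x \<in> dom C" "y \<in> dom C"
  moreover have "0 < t + 1" "t \<le> t + 1" using assms by auto
  ultimately have "cinner x (B y) = (LINT \<omega>|M. cinner (X (t + 1) x t \<omega>) (A (X (t + 1) y t \<omega>)))"
    "cinner x (B' y) = (LINT \<omega>|M. cinner (X (t + 1) x t \<omega>) (A (X (t + 1) y t \<omega>)))"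
    using assms unfolding heisenberg_evolution_def by blast+
  then show "cinner x (B y) = cinner x (B' y)" by simp
qed

lemma heisenberg_evolution_onorm:
  assumes t: "0 \<le> t" and B: "heisenberg_evolution M C X A t B"
  shows "onorm B \<le> onorm A"
proof -
  have A0: "0 \<le> onorm A"
    by (rule onorm_pos_le[OF bounded_clinear_linear[OF A]])
  have B': "bounded_clinear B" using B by (simp add: heisenberg_evolution_def)
  show ?thesis
  proof (rule onorm_bound[OF A0], rule bounded_clinear_norm_le_dense[OF dom_C(2) B' A0])
  fix x y assume xy: "x \<in> dom C" "y \<in> dom C"
  have T: "0 < t + 1" "t \<le> t + 1" using t by auto
  then have "cinner x (B y) = (LINT \<omega>|M. cinner (X (t + 1) x t \<omega>) (A (X (t + 1) y t \<omega>)))"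
    using B xy unfolding heisenberg_evolution_def by blast
  then show "cmod (cinner x (B y)) \<le> onorm A * norm x * norm y"
    using solution_form_bound[OF X[OF T(1) xy(1)] T X[OF T(1) xy(2)] T t A] by simp
  qed
qed

end

end

section \<open>Uniqueness for the adjoint quantum master equation\<close>

lemma integral_leb_HK:
  fixes f :: "real \<Rightarrow> 'b::euclidean_space"
  assumes "integrable (leb t) f"
  shows "f integrable_on {0..t}" "integral\<^sup>L (leb t) f = integral {0..t} f"
  using set_borel_integral_eq_integral[of "{0..t}" f] assms
  by (simp_all add: integrable_leb integral_leb)

lemma integrable_leb_mono:
  fixes f :: "real \<Rightarrow> 'b::{banach, second_countable_topology}"
  assumes "integrable (leb t) f" "s \<le> t"
  shows "integrable (leb s) f"
  unfolding integrable_leb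
  by (rule set_integrable_subset[OF assms(1)[unfolded integrable_leb]]) (use assms(2) in auto)

lemma measurable_leb_mono: "s \<le> t \<Longrightarrow> (\<lambda>x. x) \<in> measurable (leb s) (leb t)"
  unfolding leb_def
  by (rule measurable_restrict_mono[OF measurable_ident_sets[OF refl]]) auto

lemma integral_leb_reflect:
  fixes f :: "real \<Rightarrow> 'b::{banach, second_countable_topology}"
  shows "(\<integral>r. f r \<partial>leb t) = (\<integral>r. f (t - r) \<partial>leb t)"
proof -
  have "(\<integral>r. f r \<partial>leb t) = (\<integral>r. indicat_real {0..t} r *\<^sub>R f r \<partial>lborel)"
    by (simp add: integral_leb set_lebesgue_integral_def)
  also have "\<dots> = (\<integral>r. indicat_real {0..t} (t - r) *\<^sub>R f (t - r) \<partial>lborel)"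
    by (subst lborel_integral_real_affine[of "- 1" _ t]) simp_all
  also have "\<dots> = (\<integral>r. f (t - r) \<partial>leb t)"
    unfolding integral_leb set_lebesgue_integral_def
    by (intro Bochner_Integration.integral_cong) (auto simp: indicator_def)
  finally show ?thesis .
qed

text \<open>\<open>d t\<close> is the one-sided derivative at \<open>t\<close> of a primitive that
  vanishes identically on [0, t].\<close>

lemma continuous_integral_leb_zero:
  fixes d :: "real \<Rightarrow> 'b::euclidean_space"
  assumes d: "continuous_on {0..t} d" and zero: "\<And>\<tau>. 0 \<le> \<tau> \<Longrightarrow> \<tau> \<le> t \<Longrightarrow> integral\<^sup>L (leb \<tau>) d = 0"
    and t: "0 < t"
  shows "d t = 0"
proof -
  have "integral {0..\<tau>} d = 0" if "\<tau> \<in> {0..t}" for \<tau>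
  proof -
    have "integrable (leb \<tau>) d"
      unfolding integrable_leb using that
      by (intro borel_integrable_atLeastAtMost' continuous_on_subset[OF d]) auto
    from integral_leb_HK(2)[OF this] zero that show ?thesis by simp
  qed
  moreover have "((\<lambda>u. integral {0..u} d) has_vector_derivative d t) (at t within {0..t})"
    using integral_has_vector_derivative[OF d, of t] t by simp
  ultimately have "((\<lambda>u. 0) has_vector_derivative d t) (at t within {0..t})"
    using t by (elim has_vector_derivative_transform[rotated 2]) auto
  then show ?thesis
    using t vector_derivative_unique_within[OF _ _ has_vector_derivative_const[of 0 "at t within {0..t}"]]
    by (simp add: at_within_Icc_at_left trivial_limit_at_left_real)
qed

text \<open>Integrating \<open>h\<close> over the triangle \<open>u + s \<le> \<tau>\<close> in both orders shows that the edge values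
  \<open>g(\<cdot>, 0)\<close> and \<open>g(0, \<cdot>)\<close> have the same integral over \<open>[0, \<tau>]\<close> for all \<open>\<tau>\<close>.\<close>

lemma two_parameter_exchange:
  fixes g h :: "real \<Rightarrow> real \<Rightarrow> complex"
  assumes t: "0 \<le> t"
    and hm: "(\<lambda>p. h (fst p) (snd p)) \<in> borel_measurable (leb t \<Otimes>\<^sub>M leb t)"
    and hb: "\<And>u s. u \<in> {0..t} \<Longrightarrow> s \<in> {0..t} \<Longrightarrow> cmod (h u s) \<le> c"
    and g1: "\<And>u s. u \<in> {0..t} \<Longrightarrow> s \<in> {0..t} \<Longrightarrow> g u s = g u 0 + (\<integral>r. h u r \<partial>leb s)"
    and g2: "\<And>u s. u \<in> {0..t} \<Longrightarrow> s \<in> {0..t} \<Longrightarrow> g u s = g 0 s + (\<integral>v. h v s \<partial>leb u)"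
  shows "g t 0 = g 0 t"
proof (cases "t = 0")
  case False
  with t have t0: "0 < t" by simp
  have slice: "h u \<in> borel_measurable (leb t)" "(\<lambda>u. h u s) \<in> borel_measurable (leb t)"
    if "u \<in> {0..t}" "s \<in> {0..t}" for u s
    using measurable_compose[OF measurable_Pair1'[of u "leb t" "leb t"] hm]
      measurable_compose[OF measurable_Pair2'[of s "leb t" "leb t"] hm] that by simp_all
  have slice_int: "integrable (leb t) (h u)" "integrable (leb t) (\<lambda>u. h u s)"
    if "u \<in> {0..t}" "s \<in> {0..t}" for u s
    using that slice[OF that] hb
    by (auto intro!: finite_measure.integrable_const_bound[OF finite_measure_leb, of _ c] AE_I2)
  \<comment> \<open>Equality of averages over all [0, \<tau>] becomes equality at \<open>t\<close>
    by continuity of the edges. Each edge is an indefinite integral: put \<open>s = 0\<close> in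
    \<open>g2\<close> and \<open>u = 0\<close> in \<open>g1\<close>.\<close>
  have edge_cont: "continuous_on {0..t} (\<lambda>u. g u 0)" "continuous_on {0..t} (\<lambda>s. g 0 s)"
  proof -
    have z: "0 \<in> {0..t}" using t by simp
    have "continuous_on {0..t} (\<lambda>u. g 0 0 + integral {0..u} (\<lambda>v. h v 0))"
      by (intro continuous_intros indefinite_integral_continuous_1 integral_leb_HK(1) slice_int[OF z z])
    moreover have "g 0 0 + integral {0..u} (\<lambda>v. h v 0) = g u 0" if "u \<in> {0..t}" for u
      using g2[OF that z] integral_leb_HK(2)[OF integrable_leb_mono[OF slice_int(2)[OF z z], of u]] that by simp
    ultimately show "continuous_on {0..t} (\<lambda>u. g u 0)"
      by (rule continuous_on_eq)
    have "continuous_on {0..t} (\<lambda>s. g 0 0 + integral {0..s} (h 0))"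
      by (intro continuous_intros indefinite_integral_continuous_1 integral_leb_HK(1) slice_int[OF z z])
    moreover have "g 0 0 + integral {0..s} (h 0) = g 0 s" if "s \<in> {0..t}" for s
      using g1[OF z that] integral_leb_HK(2)[OF integrable_leb_mono[OF slice_int(1)[OF z z], of s]] that by simp
    ultimately show "continuous_on {0..t} (\<lambda>s. g 0 s)"
      by (rule continuous_on_eq)
  qed
  have "integral\<^sup>L (leb \<tau>) (\<lambda>u. g u 0 - g 0 u) = 0" if \<tau>: "0 \<le> \<tau>" "\<tau> \<le> t" for \<tau>
  proof -
    interpret P: pair_sigma_finite "leb \<tau>" "leb \<tau>" by (rule pair_leb_leb)
    \<comment> \<open>Integrating \<open>?k\<close> in \<open>s\<close> first gives hypotenuse minus
      the edge \<open>s = 0\<close>; integrating in \<open>u\<close> first gives hypotenuse minus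
      the edge \<open>u = 0\<close>.\<close>
    let ?k = "\<lambda>u s. if u + s \<le> \<tau> then h u s else 0"
    have sub: "(\<lambda>x. x) \<in> measurable (leb \<tau>) (leb t)"
      by (rule measurable_leb_mono[OF \<tau>(2)])
    have "(\<lambda>p. (fst p, snd p)) \<in> measurable (leb \<tau> \<Otimes>\<^sub>M leb \<tau>) (leb t \<Otimes>\<^sub>M leb t)"
      by (intro measurable_Pair measurable_compose[OF measurable_fst sub] measurable_compose[OF measurable_snd sub])
    from measurable_compose[OF this hm]
    have [measurable]: "(\<lambda>p. h (fst p) (snd p)) \<in> borel_measurable (leb \<tau> \<Otimes>\<^sub>M leb \<tau>)" by simp
    have [measurable]: "fst \<in> borel_measurable (leb \<tau> \<Otimes>\<^sub>M leb \<tau>)" "snd \<in> borel_measurable (leb \<tau> \<Otimes>\<^sub>M leb \<tau>)"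
      by (rule measurable_compose[OF measurable_fst measurable_leb_id]
          measurable_compose[OF measurable_snd measurable_leb_id])+
    have c0: "0 \<le> c" using order_trans[OF norm_ge_zero hb[of 0 0]] t by simp
    have k: "integrable (leb \<tau> \<Otimes>\<^sub>M leb \<tau>) (\<lambda>p. ?k (fst p) (snd p))"
    proof (rule finite_measure.integrable_const_bound[OF finite_measure_pair_measure[OF finite_measure_leb finite_measure_leb], of _ c])
      show "AE p in leb \<tau> \<Otimes>\<^sub>M leb \<tau>. norm (?k (fst p) (snd p)) \<le> c"
        using hb \<tau> c0 by (intro AE_I2) (auto simp: space_pair_measure)
    qed measurable
    have k': "integrable (leb \<tau> \<Otimes>\<^sub>M leb \<tau>) (\<lambda>p. ?k (snd p) (fst p))"
      using P.integrable_product_swap[OF k] by (simp only: case_prod_unfold fst_conv snd_conv)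
    have inner: "(\<integral>s. ?k u s \<partial>leb \<tau>) = (\<integral>s. h u s \<partial>leb (\<tau> - u))"
      "(\<integral>s. ?k s u \<partial>leb \<tau>) = (\<integral>s. h s u \<partial>leb (\<tau> - u))" if "u \<in> space (leb \<tau>)" for u
      using that unfolding integral_leb set_lebesgue_integral_def
      by (intro Bochner_Integration.integral_cong; auto simp: indicator_def)+
    have 1: "(\<integral>s. ?k u s \<partial>leb \<tau>) = g u (\<tau> - u) - g u 0" if "u \<in> space (leb \<tau>)" for u
      using g1[of u "\<tau> - u"] that \<tau> by (simp add: inner)
    have 2: "(\<integral>u. ?k u s \<partial>leb \<tau>) = g (\<tau> - s) s - g 0 s" if "s \<in> space (leb \<tau>)" for s
      using g2[of "\<tau> - s" s] that \<tau> by (simp add: inner)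
    have i1: "integrable (leb \<tau>) (\<lambda>u. g u (\<tau> - u) - g u 0)"
      using P.integrable_fst'[OF k] unfolding fst_conv snd_conv
      by (simp only: 1 cong: Bochner_Integration.integrable_cong)
    have i2: "integrable (leb \<tau>) (\<lambda>s. g (\<tau> - s) s - g 0 s)"
      using P.integrable_fst'[OF k'] unfolding fst_conv snd_conv
      by (simp only: 2 cong: Bochner_Integration.integrable_cong)
    have e: "integrable (leb \<tau>) (\<lambda>u. g u 0)" "integrable (leb \<tau>) (\<lambda>u. g 0 u)"
      unfolding integrable_leb using \<tau>
      by (intro borel_integrable_atLeastAtMost' continuous_on_subset[OF edge_cont(1)] continuous_on_subset[OF edge_cont(2)]; auto)+
    have j1: "integrable (leb \<tau>) (\<lambda>u. g u (\<tau> - u))" and j2: "integrable (leb \<tau>) (\<lambda>s. g (\<tau> - s) s)"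
      using Bochner_Integration.integrable_add[OF i1 e(1)] Bochner_Integration.integrable_add[OF i2 e(2)] by simp_all
    have "(\<integral>u. g u (\<tau> - u) - g u 0 \<partial>leb \<tau>) = (\<integral>s. g (\<tau> - s) s - g 0 s \<partial>leb \<tau>)"
      using P.Fubini_integral[of ?k] k
      by (simp only: 1 2 case_prod_unfold cong: Bochner_Integration.integral_cong)
    \<comment> \<open>The reflection \<open>u -> \<tau> - u\<close> identifies the two
      parametrisations of the hypotenuse, so its contribution cancels.\<close>
    moreover have "(\<integral>u. g u (\<tau> - u) \<partial>leb \<tau>) = (\<integral>s. g (\<tau> - s) s \<partial>leb \<tau>)"
      by (subst integral_leb_reflect) simp
    ultimately show ?thesis
      using e j1 j2 by simp
  qed
  then have "g t 0 - g 0 t = 0"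
    by (intro continuous_integral_leb_zero[OF continuous_on_diff[OF edge_cont] _ t0])
  then show ?thesis by simp
qed simp

text \<open>The adjoint equation gives continuity for vectors in a dense domain only. The uniform
  bound \<open>c\<close> makes the approximation by such vectors uniform in time, and uniform limits
  of continuous functions are continuous.\<close>

lemma continuous_cinner_op_dense:
  fixes \<A> :: "real \<Rightarrow> 'h::complex_hilbert_space \<Rightarrow> 'h"
  assumes D: "closure D = UNIV"
    and cont: "\<And>x y. x \<in> D \<Longrightarrow> y \<in> D \<Longrightarrow> continuous_on S (\<lambda>v. cinner x (\<A> v y))"
    and lin: "\<And>v. v \<in> S \<Longrightarrow> bounded_clinear (\<A> v)" and c: "\<And>v. v \<in> S \<Longrightarrow> onorm (\<A> v) \<le> c"
  shows "continuous_on S (\<lambda>v. cinner z (\<A> v w))"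
proof (cases "S = {}")
  case False
  then obtain v0 where v0: "v0 \<in> S" by auto
  have c0: "0 \<le> c"
    using onorm_pos_le[OF bounded_clinear_linear[OF lin[OF v0]]] c[OF v0] by linarith
  obtain x where x: "\<And>n. x n \<in> D" "x \<longlonglongrightarrow> z" using dense_sequence[OF D] by blast
  obtain y where y: "\<And>n. y n \<in> D" "y \<longlonglongrightarrow> w" using dense_sequence[OF D] by blast
  show ?thesis
  proof (rule uniform_limit_theorem)
    show "\<forall>\<^sub>F n in sequentially. continuous_on S (\<lambda>v. cinner (x n) (\<A> v (y n)))"
      using cont x(1) y(1) by simp
    let ?e = "\<lambda>n. norm (x n - z) * norm (y n) * c + norm z * norm (y n - w) * c"
    have "?e \<longlonglongrightarrow> norm (z - z) * norm w * c + norm z * norm (w - w) * c"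
      by (intro tendsto_intros x y)
    then have e: "?e \<longlonglongrightarrow> 0" by simp
    have bound: "dist (cinner (x n) (\<A> v (y n))) (cinner z (\<A> v w)) \<le> ?e n" if v: "v \<in> S" for n v
    proof -
      have "cinner (x n) (\<A> v (y n)) - cinner z (\<A> v w)
        = cinner (x n - z) (\<A> v (y n)) + cinner z (\<A> v (y n - w))"
        using linear_diff[OF bounded_linear.linear[OF bounded_clinear_linear[OF lin[OF v]]]]
        by (simp add: cinner_diff_left cinner_diff_right)
      then show ?thesis
        unfolding dist_norm
        by (simp only:) (intro norm_triangle_mono norm_cinner_op_le lin c v)
    qed
    show "uniform_limit S (\<lambda>n v. cinner (x n) (\<A> v (y n))) (\<lambda>v. cinner z (\<A> v w)) sequentially"
    proof (rule uniform_limitI)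
      fix \<epsilon> :: real assume "0 < \<epsilon>"
      from order_tendstoD(2)[OF e this]
      show "\<forall>\<^sub>F n in sequentially. \<forall>v\<in>S. dist (cinner (x n) (\<A> v (y n))) (cinner z (\<A> v w)) < \<epsilon>"
        by eventually_elim (use bound in \<open>blast intro: le_less_trans\<close>)
    qed
  qed simp
qed simp

context linear_sse
begin

section \<open>Measurability and integrated form of a given solution of the adjoint equation\<close>

context
  fixes \<A> :: "real \<Rightarrow> 'h \<Rightarrow> 'h" and A :: "'h \<Rightarrow> 'h" and t c :: real
  assumes qme: "adjoint_QME_C_solution G L C A \<A>" and t: "0 \<le> t"
    and c: "\<And>v. 0 \<le> v \<Longrightarrow> v \<le> t \<Longrightarrow> onorm (\<A> v) \<le> c"
begin

lemma QME_linear: "0 \<le> v \<Longrightarrow> bounded_clinear (\<A> v)"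
  using qme by (simp add: adjoint_QME_C_solution_def)

lemma QME_bound_nonneg: "0 \<le> c"
  using onorm_pos_le[OF bounded_clinear_linear[OF QME_linear[OF order_refl]]] c[of 0] t by simp

lemma QME_norm_le: "0 \<le> v \<Longrightarrow> v \<le> t \<Longrightarrow> norm (cinner z (\<A> v w)) \<le> norm z * norm w * c"
  by (intro norm_cinner_op_le QME_linear c)

lemma QME_derivative:
  assumes "0 \<le> v" "z \<in> dom C" "w \<in> dom C"
  shows "((\<lambda>v. cinner z (\<A> v w)) has_vector_derivative Phi (\<lambda>x y. cinner x (\<A> v y)) z w) (at v within {0..})"
proof -
  have "((\<lambda>s. cinner z (\<A> s w)) has_vector_derivative
      cinner z (\<A> v (G \<odot> w)) + cinner (G \<odot> z) (\<A> v w)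
        + (\<Sum>k. cinner (L k \<odot> z) (\<A> v (L k \<odot> w)))) (at v within {0..})"
    using qme assms unfolding adjoint_QME_C_solution_def by blast
  then show ?thesis
    using assms by (simp add: Phi_def Gp_dom Lp_dom add.commute)
qed

lemma QME_continuous: "continuous_on {0..t} (\<lambda>v. cinner z (\<A> v w))"
proof (rule continuous_cinner_op_dense[OF dom_C(2)])
  fix x y assume xy: "x \<in> dom C" "y \<in> dom C"
  have "continuous_on {0..} (\<lambda>v. cinner x (\<A> v y))"
    unfolding continuous_on_eq_continuous_within
    using has_vector_derivative_continuous[OF QME_derivative[OF _ xy]] by auto
  then show "continuous_on {0..t} (\<lambda>v. cinner x (\<A> v y))"
    by (rule continuous_on_subset) auto
qed (use QME_linear c in auto)

text \<open>The pair of vectors plays the part of the sample point of a Caratheodory function: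
  continuous in time for fixed vectors, Borel in the vectors for fixed time. Random times and
  vectors are then substituted.\<close>

lemma QME_form_measurable:
  assumes v: "\<alpha> \<in> measurable N (leb t)" and z: "\<zeta> \<in> borel_measurable N" and w: "\<eta> \<in> borel_measurable N"
  shows "(\<lambda>p. cinner (\<zeta> p) (\<A> (\<alpha> p) (\<eta> p))) \<in> borel_measurable N"
proof -
  have "(\<lambda>p. (\<lambda>v q. cinner (fst q) (\<A> v (snd q))) (fst p) (snd p)) \<in> borel_measurable (leb t \<Otimes>\<^sub>M (borel \<Otimes>\<^sub>M borel))"
  proof (rule caratheodory_measurable[OF t])
    fix r assume r: "0 \<le> r" "r \<le> t"
    show "(\<lambda>q. cinner (fst q) (\<A> r (snd q))) \<in> borel_measurable (borel \<Otimes>\<^sub>M borel)"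
      by (intro borel_measurable_bilinear[OF bounded_bilinear_cinner_op[OF QME_linear[OF r(1)]]]) measurable
  qed (rule QME_continuous)
  from measurable_compose[OF measurable_Pair[OF v measurable_Pair[OF z w]] this] show ?thesis
    by simp
qed

lemma QME_Phi_measurable:
  assumes v: "\<alpha> \<in> measurable N (leb t)" and [measurable]: "\<zeta> \<in> borel_measurable N" "\<eta> \<in> borel_measurable N"
  shows "(\<lambda>p. Phi (\<lambda>x y. cinner x (\<A> (\<alpha> p) y)) (\<zeta> p) (\<eta> p)) \<in> borel_measurable N"
  unfolding Phi_def
  by (intro borel_measurable_add borel_measurable_suminf QME_form_measurable[OF v]) measurable

lemma QME_Phi_le:
  "0 \<le> v \<Longrightarrow> v \<le> t \<Longrightarrow> norm (Phi (\<lambda>x y. cinner x (\<A> v y)) z w) \<le> c * (energy z + energy w)"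
  by (rule norm_Phi_le[OF bounded_bilinear_cinner_op[OF QME_linear] QME_norm_le QME_bound_nonneg])

text \<open>Lebesgue integrability of the derivative comes from its measurability and the energy
  bound. The fundamental theorem for the gauge integral, which asks only for the derivative at every
  point, evaluates the integral.\<close>

lemma QME_integrated:
  assumes u: "0 \<le> u" "u \<le> t" and zw: "z \<in> dom C" "w \<in> dom C"
  shows "cinner z (\<A> u w) = cinner z (A w) + (\<integral>v. Phi (\<lambda>x y. cinner x (\<A> v y)) z w \<partial>leb u)"
proof -
  let ?f = "\<lambda>v. Phi (\<lambda>x y. cinner x (\<A> v y)) z w"
  have "?f \<in> borel_measurable (leb t)"
    by (rule QME_Phi_measurable) simp_all
  then have "integrable (leb t) ?f"
    by (intro finite_measure.integrable_const_bound[OF finite_measure_leb, of _ "c * (energy z + energy w)"])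
      (auto intro!: AE_I2 QME_Phi_le)
  then have int: "integrable (leb u) ?f"
    by (rule integrable_leb_mono[OF _ u(2)])
  have "(?f has_integral (cinner z (\<A> u w) - cinner z (\<A> 0 w))) {0..u}"
  proof (rule fundamental_theorem_of_calculus[OF u(1)])
    fix v assume "v \<in> {0..u}"
    then show "((\<lambda>v. cinner z (\<A> v w)) has_vector_derivative ?f v) (at v within {0..u})"
      by (intro has_vector_derivative_within_subset[OF QME_derivative[OF _ zw]]) auto
  qed
  then have "integral\<^sup>L (leb u) ?f = cinner z (\<A> u w) - cinner z (\<A> 0 w)"
    by (simp add: integral_leb_HK(2)[OF int] integral_unique)
  moreover have "\<A> 0 = A"
    using qme by (simp add: adjoint_QME_C_solution_def)
  ultimately show ?thesis by simp
qed

lemma QME_solution_eq: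
  assumes X: "solution T x X" and Y: "solution T y Y"
    and T: "0 < T" "t \<le> T" and xy: "x \<in> dom C" "y \<in> dom C"
  shows "cinner x (\<A> t y) = (\<integral>\<omega>. cinner (X t \<omega>) (A (Y t \<omega>)) \<partial>M)"
proof -
  define b where "b v = (\<lambda>x y. cinner x (\<A> v y))" for v
  define g where "g u s = (\<integral>\<omega>. b u (X s \<omega>) (Y s \<omega>) \<partial>M)" for u s
  define h where "h u s = (\<integral>\<omega>. Phi (b u) (X s \<omega>) (Y s \<omega>) \<partial>M)" for u s
  have b: "bounded_bilinear (b u)" if "0 \<le> u" for u
    unfolding b_def by (rule bounded_bilinear_cinner_op[OF QME_linear[OF that]])
  obtain E where E: "\<And>r. 0 \<le> r \<Longrightarrow> r \<le> T \<Longrightarrow>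
    integrable M (\<lambda>\<omega>. energy (X r \<omega>)) \<and> (\<integral>\<omega>. energy (X r \<omega>) \<partial>M) \<le> E"
    by (rule energy_bound[OF X T(1)]) (rule that)
  obtain E' where E': "\<And>r. 0 \<le> r \<Longrightarrow> r \<le> T \<Longrightarrow>
    integrable M (\<lambda>\<omega>. energy (Y r \<omega>)) \<and> (\<integral>\<omega>. energy (Y r \<omega>) \<partial>M) \<le> E'"
    by (rule energy_bound[OF Y T(1)]) (rule that)
  have tt: "0 \<le> t" "t \<le> T" using t T by auto
  note Xp [measurable] = solution_adapted(4)[OF X tt] and Yp [measurable] = solution_adapted(4)[OF Y tt]
  have formula: "g u s = b u x y + (\<integral>r. h u r \<partial>leb s)" if "0 \<le> u" "0 \<le> s" "s \<le> t" for u s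
    unfolding g_def h_def using solution_ito_formula(2)[OF b[OF that(1)] X T(1) Y T(1) that(2)] that T by simp
  have g0: "g u 0 = b u x y" if "0 \<le> u" for u
  proof -
    \<comment> \<open>The time integral is over the single point 0.\<close>
    have "(\<integral>r. h u r \<partial>leb 0) = (\<integral>r. 0 \<partial>(lborel :: real measure))"
      unfolding integral_leb set_lebesgue_integral_def
      by (rule integral_discrete_difference[of "{0::real}"]) (auto simp: indicator_def)
    then show ?thesis
      using formula[OF that order_refl t] by simp
  qed
  have "g t 0 = g 0 t"
  \<comment> \<open>\<open>c\<close> bounds the operators and \<open>E\<close>, \<open>E'\<close>
    bound the mean energies at all times, so the product bounds \<open>h\<close> uniformly in both
    variables.\<close>
  proof (rule two_parameter_exchange[OF t, where h = h and c = "c * (E + E')"])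
    show "(\<lambda>p. h (fst p) (snd p)) \<in> borel_measurable (leb t \<Otimes>\<^sub>M leb t)"
      unfolding h_def
    proof (rule borel_measurable_lebesgue_integral)
      let ?N = "(leb t \<Otimes>\<^sub>M leb t) \<Otimes>\<^sub>M M"
      have s: "(\<lambda>q. (snd (fst q), snd q)) \<in> measurable ?N (leb t \<Otimes>\<^sub>M M)" by measurable
      have "(\<lambda>q. Phi (b (fst (fst q))) (X (snd (fst q)) (snd q)) (Y (snd (fst q)) (snd q))) \<in> borel_measurable ?N"
        unfolding b_def
        using measurable_compose[OF s Xp] measurable_compose[OF s Yp]
        by (intro QME_Phi_measurable measurable_compose[OF measurable_fst measurable_fst]) simp_all
      then show "(\<lambda>(p, \<omega>). Phi (b (fst p)) (X (snd p) \<omega>) (Y (snd p) \<omega>)) \<in> borel_measurable ?N"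
        by (simp add: case_prod_unfold)
    qed
  next
    fix u s assume us: "u \<in> {0..t}" "s \<in> {0..t}"
    then have s: "0 \<le> s" "s \<le> T" and u: "0 \<le> u" "u \<le> t" using T by auto
    note [measurable] = solution_adapted(2)[OF X s] solution_adapted(2)[OF Y s]
    have "cmod (h u s) \<le> (\<integral>\<omega>. cmod (Phi (b u) (X s \<omega>) (Y s \<omega>)) \<partial>M)"
      unfolding h_def by (rule integral_norm_bound)
    also have "\<dots> \<le> (\<integral>\<omega>. c * (energy (X s \<omega>) + energy (Y s \<omega>)) \<partial>M)"
    proof (rule integral_mono_AE')
      show "integrable M (\<lambda>\<omega>. c * (energy (X s \<omega>) + energy (Y s \<omega>)))"
        using E[OF s] E'[OF s] by auto
    qed (use u in \<open>auto simp: b_def energy_nonneg QME_bound_nonneg intro!: AE_I2 QME_Phi_le mult_nonneg_nonneg\<close>)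
    also have "\<dots> \<le> c * (E + E')"
      using E[OF s] E'[OF s] QME_bound_nonneg by (auto intro!: mult_left_mono add_mono)
    finally show "cmod (h u s) \<le> c * (E + E')" .
    show "g u s = g u 0 + (\<integral>r. h u r \<partial>leb s)"
      using formula g0 us by simp
    show "g u s = g 0 s + (\<integral>v. h v s \<partial>leb u)"
    proof -
      interpret P: pair_sigma_finite "leb u" M by (rule pair_leb)
      have sub: "(\<lambda>x. x) \<in> measurable (leb u) (leb t)"
        by (rule measurable_leb_mono[OF u(2)])
      have Pm: "(\<lambda>p. Phi (b (fst p)) (X s (snd p)) (Y s (snd p))) \<in> borel_measurable (leb u \<Otimes>\<^sub>M M)"
        unfolding b_def by (intro QME_Phi_measurable measurable_compose[OF measurable_fst sub]) measurable
      have Ei: "integrable (leb u \<Otimes>\<^sub>M M) (\<lambda>p. c * (energy (X s (snd p)) + energy (Y s (snd p))))"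
      proof -
        \<comment> \<open>Seen as the square of its root, the energy is lifted to the product with
          time by \<open>sq_integrable_snd\<close>.\<close>
        have sq: "sq_integrable M (\<lambda>\<omega>. sqrt (energy (X s \<omega>)))" "sq_integrable M (\<lambda>\<omega>. sqrt (energy (Y s \<omega>)))"
          using E[OF s] E'[OF s] by (auto simp: sq_integrable_def energy_nonneg)
        show ?thesis
          using sq_integrable_snd[OF sq(1), of u] sq_integrable_snd[OF sq(2), of u]
          by (auto simp: sq_integrable_def energy_nonneg)
      qed
      have int: "integrable (leb u \<Otimes>\<^sub>M M) (\<lambda>p. Phi (b (fst p)) (X s (snd p)) (Y s (snd p)))"
      proof (rule Bochner_Integration.integrable_bound[OF Ei Pm], unfold real_norm_def, intro AE_I2 order_trans[OF _ abs_ge_self])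
        fix p assume "p \<in> space (leb u \<Otimes>\<^sub>M M)"
        then show "cmod (Phi (b (fst p)) (X s (snd p)) (Y s (snd p))) \<le> c * (energy (X s (snd p)) + energy (Y s (snd p)))"
          unfolding b_def using u by (intro QME_Phi_le) (auto simp: space_pair_measure)
      qed
      have sq: "sq_integrable M (X s)" "sq_integrable M (Y s)"
        by (rule solution_adapted(5)[OF X s] solution_adapted(5)[OF Y s])+
      have i: "integrable M (\<lambda>\<omega>. b v (X s \<omega>) (Y s \<omega>))" if "0 \<le> v" for v
        by (rule sq_integrable_bilinear[OF b[OF that] sq])
      have int': "integrable M (\<lambda>\<omega>. \<integral>v. Phi (b v) (X s \<omega>) (Y s \<omega>) \<partial>leb u)"
        using P.integrable_snd[of "\<lambda>v \<omega>. Phi (b v) (X s \<omega>) (Y s \<omega>)"] int by (simp add: case_prod_unfold)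
      have A0: "\<A> 0 = A"
        using qme by (simp add: adjoint_QME_C_solution_def)
      have "g u s = (\<integral>\<omega>. b 0 (X s \<omega>) (Y s \<omega>) + (\<integral>v. Phi (b v) (X s \<omega>) (Y s \<omega>) \<partial>leb u) \<partial>M)"
        unfolding g_def
      proof (rule integral_cong_AE)
        \<comment> \<open>The integrated adjoint equation is available for vectors in
          \<open>dom C\<close>, where \<open>X s\<close> and \<open>Y s\<close> lie almost
          surely.\<close>
        show "AE \<omega> in M. b u (X s \<omega>) (Y s \<omega>) = b 0 (X s \<omega>) (Y s \<omega>) + (\<integral>v. Phi (b v) (X s \<omega>) (Y s \<omega>) \<partial>leb u)"
          using solution_adapted(3)[OF X s] solution_adapted(3)[OF Y s]
          by eventually_elim (simp add: b_def A0 QME_integrated[OF u])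
      qed (intro borel_measurable_integrable Bochner_Integration.integrable_add i u order_refl int')+
      also have "\<dots> = g 0 s + (\<integral>\<omega>. (\<integral>v. Phi (b v) (X s \<omega>) (Y s \<omega>) \<partial>leb u) \<partial>M)"
        unfolding g_def using i[OF order_refl] int' by simp
      also have "(\<integral>\<omega>. (\<integral>v. Phi (b v) (X s \<omega>) (Y s \<omega>) \<partial>leb u) \<partial>M) = (\<integral>v. h v s \<partial>leb u)"
        unfolding h_def by (rule P.Fubini_integral) (use int in \<open>simp add: case_prod_unfold\<close>)
      finally show ?thesis .
    qed
  qed
  moreover have "\<A> 0 = A"
    using qme by (simp add: adjoint_QME_C_solution_def)
  ultimately show ?thesis
    using g0[OF t] by (simp add: g_def b_def)
qed

end

text \<open>Local boundedness of the operator norms supplies the constant \<open>c\<close> for the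
  interval [0, t]; agreement of the two forms on the dense domain then determines the
  operator.\<close>

lemma QME_unique:
  assumes X: "\<And>T x. 0 < T \<Longrightarrow> x \<in> dom C \<Longrightarrow> solution T x (X T x)"
    and qme: "adjoint_QME_C_solution G L C A \<A>" and t: "0 \<le> t"
    and B: "heisenberg_evolution M C X A t B"
  shows "\<A> t = B"
proof (rule bounded_clinear_eq_dense[OF dom_C(2)])
  have "bdd_above ((\<lambda>s. onorm (\<A> s)) ` {0..t})"
    using qme t by (simp add: adjoint_QME_C_solution_def)
  then obtain c where c: "\<And>v. 0 \<le> v \<Longrightarrow> v \<le> t \<Longrightarrow> onorm (\<A> v) \<le> c"
    unfolding bdd_above_def by fastforce
  show "bounded_clinear (\<A> t)"
    using qme t by (simp add: adjoint_QME_C_solution_def)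
  show "bounded_clinear B"
    using B by (simp add: heisenberg_evolution_def)
  fix x y assume xy: "x \<in> dom C" "y \<in> dom C"
  have T: "0 < t + 1" "t \<le> t + 1" using t by auto
  have "cinner x (B y) = (LINT \<omega>|M. cinner (X (t + 1) x t \<omega>) (A (X (t + 1) y t \<omega>)))"
    using B xy T unfolding heisenberg_evolution_def by blast
  then show "cinner x (\<A> t y) = cinner x (B y)"
    using QME_solution_eq[OF qme t c X[OF T(1) xy(1)] X[OF T(1) xy(2)] T xy] by simp
qed

end

theorem theorem2p1:
  fixes M :: "'w measure" and F :: "real \<Rightarrow> 'w measure" and W :: "nat \<Rightarrow> real \<Rightarrow> 'w \<Rightarrow> real"
    and G C :: "'h::{complex_hilbert_space, second_countable_topology} \<rightharpoonup> 'h"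
    and L :: "nat \<Rightarrow> 'h \<rightharpoonup> 'h"
    and A :: "'h \<Rightarrow> 'h"
    and X :: "real \<Rightarrow> 'h \<Rightarrow> real \<Rightarrow> 'w \<Rightarrow> 'h"
  assumes "filtered_complete_prob_space M F"
    and "independent_wiener_processes M F W"
    and "linear_operator G" and "\<And>k. linear_operator (L k)"
    and "self_adjoint C" and "positive_operator C"
    and "hypothesis_A M F W G L C"
    and "bounded_clinear A"
    and "\<And>T x. T > 0 \<Longrightarrow> x \<in> dom C \<Longrightarrow>
              strong_C_solution M F W G L C {0..T} (\<lambda>_. x) (X T x)"
  shows "(\<forall>t\<ge>0. \<exists>!B. heisenberg_evolution M C X A t B) \<and>
    (\<forall>\<T>. (\<forall>t\<ge>0. heisenberg_evolution M C X A t (\<T> t)) \<longrightarrow>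
       (\<forall>\<A>. adjoint_QME_C_solution G L C A \<A> \<longrightarrow> (\<forall>t\<ge>0. \<A> t = \<T> t)) \<and>
       (\<forall>t\<ge>0. onorm (\<T> t) \<le> onorm A))"
proof -
  interpret linear_sse M F W G C L
    by unfold_locales (rule assms)+
  have "\<exists>!B. heisenberg_evolution M C X A t B" if "0 \<le> t" for t
  proof (rule ex_ex1I)
    show "\<exists>B. heisenberg_evolution M C X A t B"
      by (rule heisenberg_evolution_exists[OF _ assms(8) that]) (rule assms(9))
    show "B = B'" if "heisenberg_evolution M C X A t B" "heisenberg_evolution M C X A t B'" for B B'
      by (rule heisenberg_evolution_unique[OF _ assms(8) \<open>0 \<le> t\<close> that]) (rule assms(9))
  qed
  moreover have "onorm B \<le> onorm A" if "0 \<le> t" "heisenberg_evolution M C X A t B" for t B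
    by (rule heisenberg_evolution_onorm[OF _ assms(8) that]) (rule assms(9))
  moreover have "\<A> t = B"
    if "adjoint_QME_C_solution G L C A \<A>" "0 \<le> t" "heisenberg_evolution M C X A t B" for \<A> t B
    by (rule QME_unique[OF _ that]) (rule assms(9))
  ultimately show ?thesis by blast
qed

end
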